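(* Let $\alpha\in(0,1)$ and let $\vec{a}\in\mathbb{R}^3$ be a unit vector. Let $\Gamma\subset\mathbb{R}^3_+(\vec{a})$ be a simple closed curve contained in the plane $\Pi$ of equation $\langle p,\vec{a}\rangle=c>0$, let $\Omega\subset\Pi$ be the domain bounded by $\Gamma$, let $|\Omega|$ be its area and $L(\Gamma)$ the length of $\Gamma$. If $M$ is a compact $\alpha$-singular minimal graph on $\Pi$ (with density vector $\vec{a}$) with boundary $\Gamma$, then its area $A(M)$ satisfies $$A(M)\leq c\,L(\Gamma)+(1-\alpha)|\Omega|.$$ As a consequence, a necessary condition for the existence of a compact $\alpha$-singular minimal graph on $\Omega\subset\Pi$ with boundary $\Gamma$ is $$|\Omega|\leq\frac{c}{\alpha}\,L(\Gamma).$$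
   Context: For a unit vector $\vec{a}\in\mathbb{R}^3$ let $\mathbb{R}^3_+(\vec{a})=\{p\in\mathbb{R}^3:\langle p,\vec{a}\rangle>0\}$. For $\alpha\in\mathbb{R}$, $\alpha\neq 0$, an $\alpha$-singular minimal surface with density vector $\vec{a}$ is a smooth immersion $\phi:M\to\mathbb{R}^3_+(\vec{a})$ of an oriented surface $M$ (possibly with smooth boundary) such that $2H=\alpha\,\langle N,\vec{a}\rangle/\langle\phi,\vec{a}\rangle$ on $M$, where $N$ is the Gauss map and $H$ the mean curvature (half the sum of the principal curvatures, with sign such that $\Delta\phi=2HN$ for the Laplace-Beltrami operator of the induced metric). A surface has boundary $\Gamma$ if the restriction of the immersion to $\partial M$ is a diffeomorphism onto $\Gamma$. A surface $M$ is a graph on the plane $\Pi$ (orthogonal to $\vec{a}$) if it has the form $M=\{q+u(q)\vec{a}:q\in D\}$ for a function $u$ on a domain $D\subset\Pi$. *)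

theory Defs
  imports "HOL-Analysis.Analysis"
begin

primrec Ck_on :: "nat \<Rightarrow> ('a::real_normed_vector \<Rightarrow> 'b::real_normed_vector) \<Rightarrow> 'a set \<Rightarrow> bool" where
  "Ck_on 0 f S \<longleftrightarrow> continuous_on S f"
| "Ck_on (Suc k) f S \<longleftrightarrow>
     f differentiable_on S \<and> (\<forall>v. Ck_on k (\<lambda>x. frechet_derivative f (at x) v) S)"

text \<open>Only meaningful for open \<open>S\<close>, since the derivatives are taken in the full space.\<close>

definition smooth_on :: "('a::real_normed_vector \<Rightarrow> 'b::real_normed_vector) \<Rightarrow> 'a set \<Rightarrow> bool" where
  "smooth_on f S \<longleftrightarrow> (\<forall>k. Ck_on k f S)"

definition partial :: "2 \<Rightarrow> (real^2 \<Rightarrow> real^3) \<Rightarrow> real^2 \<Rightarrow> real^3" where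
  "partial i X x = frechet_derivative X (at x) (axis i 1)"

text \<open>A surface is a set \<open>M\<close> whose points have local parametrizations modelled on relatively
  open subsets \<open>U \<inter> half_plane\<close> of the closed half-plane. As usual, smoothness up to the edge of the
  half-plane means that the parametrization is the restriction of a smooth immersion of an open
  set \<open>U\<close> of the plane. If \<open>U\<close> lies in the open half-plane this is an interior parametrization.\<close>

definition half_plane :: "(real^2) set" where
  "half_plane = {x. 0 \<le> x$2}"

definition local_param :: "(real^3) set \<Rightarrow> (real^2) set \<Rightarrow> (real^2 \<Rightarrow> real^3) \<Rightarrow> bool" where
  "local_param M U X \<longleftrightarrow>
     open U \<and> smooth_on X U \<and> (\<forall>x\<in>U. inj (frechet_derivative X (at x))) \<and>
     openin (top_of_set M) (X ` (U \<inter> half_plane)) \<and>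
     (\<exists>Y. homeomorphism (U \<inter> half_plane) (X ` (U \<inter> half_plane)) X Y)"

definition smooth_surface :: "(real^3) set \<Rightarrow> bool" where
  "smooth_surface M \<longleftrightarrow> (\<forall>p\<in>M. \<exists>U X. local_param M U X \<and> p \<in> X ` (U \<inter> half_plane))"

definition surface_boundary :: "(real^3) set \<Rightarrow> (real^3) set" where
  "surface_boundary M = {p. \<exists>U X x. local_param M U X \<and> x \<in> U \<and> x$2 = 0 \<and> p = X x}"

definition first_form :: "(real^2 \<Rightarrow> real^3) \<Rightarrow> real^2 \<Rightarrow> real^2^2" where
  "first_form X x = (\<chi> i j. partial i X x \<bullet> partial j X x)"

definition second_form :: "(real^3 \<Rightarrow> real^3) \<Rightarrow> (real^2 \<Rightarrow> real^3) \<Rightarrow> real^2 \<Rightarrow> real^2^2" where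
  "second_form N X x = (\<chi> i j. partial i (partial j X) x \<bullet> N (X x))"

definition gauss_map :: "(real^3) set \<Rightarrow> (real^3 \<Rightarrow> real^3) \<Rightarrow> bool" where
  "gauss_map M N \<longleftrightarrow> continuous_on M N \<and> (\<forall>p\<in>M. norm (N p) = 1) \<and>
     (\<forall>U X. local_param M U X \<longrightarrow> (\<forall>x \<in> U \<inter> half_plane. \<forall>i. N (X x) \<bullet> partial i X x = 0))"

text \<open>\<open>matrix_inv I ** II\<close> is the matrix of the shape operator \<open>-dN\<close> in the basis of coordinate
  vectors; its eigenvalues are the principal curvatures. With this sign the Laplace-Beltrami
  operator of the position vector is \<open>2 H N\<close>.\<close>

definition mean_curvature :: "(real^3 \<Rightarrow> real^3) \<Rightarrow> (real^2 \<Rightarrow> real^3) \<Rightarrow> real^2 \<Rightarrow> real" where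
  "mean_curvature N X x = trace (matrix_inv (first_form X x) ** second_form N X x) / 2"

text \<open>The Riemannian area \<open>\<mu>\<close> of a surface is the measure given in each parametrization by the
  density \<open>sqrt (det I)\<close>. Since \<open>M\<close> is covered by countably many parametrizations and \<open>\<mu>\<close> is inner
  regular, \<open>\<mu> M\<close> is the supremum of the areas of finite disjoint unions of compact pieces, each
  lying in a single parametrization.\<close>

definition param_piece :: "(real^3) set \<Rightarrow> (real^2 \<Rightarrow> real^3) \<times> (real^2) set \<Rightarrow> bool" where
  "param_piece M = (\<lambda>(X, K). compact K \<and> (\<exists>U. local_param M U X \<and> K \<subseteq> U \<inter> half_plane))"

definition piece_area :: "(real^2 \<Rightarrow> real^3) \<times> (real^2) set \<Rightarrow> ennreal" where
  "piece_area = (\<lambda>(X, K). \<integral>\<^sup>+x\<in>K. ennreal (sqrt (det (first_form X x))) \<partial>lborel)"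

definition surface_area :: "(real^3) set \<Rightarrow> ennreal" where
  "surface_area M =
     (SUP F \<in> {F. finite F \<and> (\<forall>P\<in>F. param_piece M P) \<and> disjoint_family_on (\<lambda>(X, K). X ` K) F}.
        \<Sum>P\<in>F. piece_area P)"

definition pos_halfspace :: "real^3 \<Rightarrow> (real^3) set" where
  "pos_halfspace a = {p. p \<bullet> a > 0}"

definition singular_minimal :: "real \<Rightarrow> real^3 \<Rightarrow> (real^3) set \<Rightarrow> bool" where
  "singular_minimal \<alpha> a M \<longleftrightarrow> smooth_surface M \<and> M \<subseteq> pos_halfspace a \<and>
     (\<exists>N. gauss_map M N \<and>
        (\<forall>U X. local_param M U X \<longrightarrow>
          (\<forall>x \<in> U \<inter> half_plane.
             2 * mean_curvature N X x = \<alpha> * (N (X x) \<bullet> a) / (X x \<bullet> a))))"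

definition graph_over :: "real^3 \<Rightarrow> (real^3) set \<Rightarrow> (real^3) set \<Rightarrow> bool" where
  "graph_over a D M \<longleftrightarrow> (\<exists>u :: real^3 \<Rightarrow> real. M = (\<lambda>q. q + u q *\<^sub>R a) ` D)"

definition smooth_simple_closed_curve :: "(real \<Rightarrow> real^3) \<Rightarrow> bool" where
  "smooth_simple_closed_curve \<gamma> \<longleftrightarrow>
     smooth_on \<gamma> UNIV \<and> (\<forall>t. vector_derivative \<gamma> (at t) \<noteq> 0) \<and>
     (\<forall>t. \<gamma> (t + 1) = \<gamma> t) \<and> inj_on \<gamma> {0..<1}"

definition curve_length :: "(real \<Rightarrow> real^3) \<Rightarrow> real" where
  "curve_length \<gamma> = integral {0..1} (\<lambda>t. norm (vector_derivative \<gamma> (at t)))"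

text \<open>The union of the bounded components of \<open>P - G\<close>. The library's \<open>inside\<close> is taken relative to
  the whole space, so in dimension three \<open>inside G\<close> would be empty for a closed curve \<open>G\<close>.\<close>

definition inside_in :: "(real^3) set \<Rightarrow> (real^3) set \<Rightarrow> (real^3) set" where
  "inside_in P G = {q \<in> P - G. bounded (connected_component_set (P - G) q)}"

end

theory Submission
  imports Defs
begin

text \<open>Let \<open>z = \<langle>p, a\<rangle>\<close> be the height, \<open>\<nu> = \<langle>N, a\<rangle>\<close>. On an \<open>\<alpha>\<close>-singular minimal surface
  \<open>\<Delta>z = 2 H \<nu> = \<alpha> \<nu>\<^sup>2 / z\<close> and \<open>\<bar>\<nabla>z\<bar>\<^sup>2 = 1 - \<nu>\<^sup>2\<close>, so that \<open>div (z \<nabla>z) = 1 - (1 - \<alpha>) \<nu>\<^sup>2\<close>. As \<open>z = c\<close>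
  on the boundary, the divergence theorem gives \<open>\<integral>\<^sub>M (1 - (1 - \<alpha>) \<nu>\<^sup>2) \<le> c L(\<Gamma>)\<close>. For a graph over
  \<open>D\<close> the projection along \<open>a\<close> is injective with Jacobian \<open>\<bar>\<nu>\<bar>\<close>, hence \<open>\<integral>\<^sub>M \<bar>\<nu>\<bar> = |D|\<close>, also where the
  tangent plane is vertical. The first inequality follows from \<open>\<nu>\<^sup>2 \<le> \<bar>\<nu>\<bar>\<close>, the second from
  \<open>\<alpha> \<bar>\<nu>\<bar> \<le> 1 - (1 - \<alpha>) \<nu>\<^sup>2\<close>.\<close>

unbundle cross3_syntax

section \<open>Change of variables and vector algebra\<close>

text \<open>The function whose graph is \<open>M\<close> is arbitrary and tangent planes may be
  vertical, so no equation for it is available and all computations take place in charts. Three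
  obstacles shape the proof. \<open>surface_area\<close> is a supremum over families of compact
  pieces, whereas the divergence argument needs a measure: a Borel measure is glued from the charts
  and dominates that supremum. Charts carry no orientation and the Gauss map is only continuous:
  each chart uses its own differentiable normal, and what is kept is either even in the normal or
  bounded in absolute value. The flux is cut into charts by a partition of unity and estimated chart
  by chart; the cut-off heights are nonnegative on \<open>M\<close> and add up to the height, so
  taking absolute values separately loses nothing. Finally, the domain \<open>D\<close> of the graph
  has to be compared with \<Omega>, the union of bounded components of the plane minus \<Gamma>. In
  place of the Jordan curve theorem, \<open>D\<close> minus \<Gamma> is seen to be open and closed
  in the plane minus \<Gamma>, so the components that meet it stay in the compact set
  \<open>D\<close>.\<close>

lemma absolutely_integrable_iff_nn_integral_finite:
  fixes f :: "'a::euclidean_space \<Rightarrow> real"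
  assumes "set_borel_measurable borel S f" and nn: "\<And>x. x \<in> S \<Longrightarrow> 0 \<le> f x"
  shows "f absolutely_integrable_on S \<longleftrightarrow> (\<integral>\<^sup>+x\<in>S. f x \<partial>lborel) < \<infinity>"
proof
  assume "f absolutely_integrable_on S"
  then have "(f has_integral integral S f) S"
    using absolutely_integrable_on_def integrable_integral by blast
  from nn_integral_has_integral_lebesgue'[OF nn this]
  show "(\<integral>\<^sup>+x\<in>S. f x \<partial>lborel) < \<infinity>" by simp
next
  assume fin: "(\<integral>\<^sup>+x\<in>S. f x \<partial>lborel) < \<infinity>"
  have meas: "(\<lambda>x. indicator S x *\<^sub>R f x) \<in> borel_measurable borel"
    using assms(1) by (simp add: set_borel_measurable_def)
  have "(\<integral>\<^sup>+x. ennreal (norm (indicator S x *\<^sub>R f x)) \<partial>lborel) = (\<integral>\<^sup>+x\<in>S. f x \<partial>lborel)"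
    by (intro nn_integral_cong) (auto simp: indicator_def nn)
  then have "integrable lborel (\<lambda>x. indicator S x *\<^sub>R f x)"
    using fin meas by (intro integrableI_bounded) auto
  then have "integrable (completion lborel) (\<lambda>x. indicator S x *\<^sub>R f x)"
    by (subst integrable_completion) (use meas in simp_all)
  then show "f absolutely_integrable_on S" by (simp add: set_integrable_def)
qed

lemma ennreal_indicator_measurable:
  fixes f :: "'a::topological_space \<Rightarrow> real"
  assumes "A \<in> sets borel" "continuous_on A f"
  shows "(\<lambda>x. ennreal (f x) * indicator A x) \<in> borel_measurable borel"
proof -
  have "(\<lambda>x. ennreal (indicator A x *\<^sub>R f x)) \<in> borel_measurable borel"
    by (rule measurable_compose[OF borel_measurable_continuous_on_indicator[OF assms] measurable_ennreal])
  also have "(\<lambda>x. ennreal (indicator A x *\<^sub>R f x)) = (\<lambda>x. ennreal (f x) * indicator A x)"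
    by (auto simp: fun_eq_iff indicator_def)
  finally show ?thesis .
qed

text \<open>The last assumption has the shape in which change of variables theorems conclude: for
  each value \<open>b\<close>, one side is integrable with integral \<open>b\<close> exactly when
  the other is. It settles the infinite case too, since integrability of a nonnegative function
  fails only when its integral is \<infinity>.\<close>

lemma set_nn_integral_eqI:
  fixes f :: "'a::euclidean_space \<Rightarrow> real" and h :: "'b::euclidean_space \<Rightarrow> real"
  assumes "set_borel_measurable borel S f" "\<And>x. x \<in> S \<Longrightarrow> 0 \<le> f x"
    and "set_borel_measurable borel T h" "\<And>x. x \<in> T \<Longrightarrow> 0 \<le> h x"
    and "\<And>b. f absolutely_integrable_on S \<and> integral S f = b \<longleftrightarrow>
               h absolutely_integrable_on T \<and> integral T h = b"
  shows "(\<integral>\<^sup>+x\<in>S. f x \<partial>lborel) = (\<integral>\<^sup>+x\<in>T. h x \<partial>lborel)"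
proof (cases "f absolutely_integrable_on S")
  case True
  then show ?thesis
  proof -
    have h: "h absolutely_integrable_on T" and i: "integral T h = integral S f"
      using assms(5) True by blast+
    have "(\<integral>\<^sup>+x\<in>S. f x \<partial>lborel) = ennreal (integral S f)"
      by (rule set_nn_integral_lborel_eq_integral)
        (use assms absolutely_integrable_iff_nn_integral_finite[of S f] True in auto)
    moreover have "(\<integral>\<^sup>+x\<in>T. h x \<partial>lborel) = ennreal (integral T h)"
      by (rule set_nn_integral_lborel_eq_integral)
        (use assms absolutely_integrable_iff_nn_integral_finite[of T h] h in auto)
    ultimately show ?thesis using i by simp
  qed
next
  case False
  then have "\<not> h absolutely_integrable_on T" using assms(5) by blast
  then show ?thesis
    using False absolutely_integrable_iff_nn_integral_finite[of S f] assms(1,2)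
      absolutely_integrable_iff_nn_integral_finite[of T h] assms(3,4) by (simp add: not_less top_unique)
qed

text \<open>The scalar integrand enters the vector-valued theorem through \<open>real^1\<close>.
  Differentiability is asked only within \<open>S\<close>, so \<open>S\<close> may contain edge
  points of the half-plane, and the determinant may vanish.\<close>

lemma nn_integral_change_of_variables:
  fixes f :: "real^'m::{finite,wellorder} \<Rightarrow> real" and g :: "real^'m::_ \<Rightarrow> real^'m::_"
  assumes S: "S \<in> sets borel" and T: "g ` S \<in> sets borel"
    and der: "\<And>x. x \<in> S \<Longrightarrow> (g has_derivative g' x) (at x within S)"
    and inj: "inj_on g S"
    and f: "set_borel_measurable borel (g ` S) f" "\<And>y. y \<in> g ` S \<Longrightarrow> 0 \<le> f y"
    and fg: "set_borel_measurable borel S (\<lambda>x. \<bar>det (matrix (g' x))\<bar> * f (g x))"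
  shows "(\<integral>\<^sup>+x\<in>S. (\<bar>det (matrix (g' x))\<bar> * f (g x)) \<partial>lborel) = (\<integral>\<^sup>+y\<in>g ` S. f y \<partial>lborel)"
proof (rule set_nn_integral_eqI[OF fg _ f])
  fix b
  have "S \<in> sets lebesgue" using S by (simp add: sets_completionI_sets)
  from has_absolute_integral_change_of_variables[OF this der inj, of "\<lambda>x. vec (f x) :: real^1" "vec b"]
  show "(\<lambda>x. \<bar>det (matrix (g' x))\<bar> * f (g x)) absolutely_integrable_on S \<and>
      integral S (\<lambda>x. \<bar>det (matrix (g' x))\<bar> * f (g x)) = b \<longleftrightarrow>
      f absolutely_integrable_on g ` S \<and> integral (g ` S) f = b"
    unfolding absolutely_integrable_on_1_iff integral_on_1_eq by (simp add: vec_eq_iff)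
qed (use f in auto)

lemma nn_integral_change_of_variables_real:
  fixes f :: "real \<Rightarrow> real" and g :: "real \<Rightarrow> real"
  assumes S: "S \<in> sets borel"
    and der: "\<And>x. x \<in> S \<Longrightarrow> (g has_field_derivative g' x) (at x within S)"
    and inj: "inj_on g S"
    and f: "set_borel_measurable borel (g ` S) f" "\<And>y. y \<in> g ` S \<Longrightarrow> 0 \<le> f y"
    and fg: "set_borel_measurable borel S (\<lambda>x. \<bar>g' x\<bar> * f (g x))"
  shows "(\<integral>\<^sup>+x\<in>S. (\<bar>g' x\<bar> * f (g x)) \<partial>lborel) = (\<integral>\<^sup>+y\<in>g ` S. f y \<partial>lborel)"
proof (rule set_nn_integral_eqI[OF fg _ f])
  fix b
  have "S \<in> sets lebesgue" using S by (simp add: sets_completionI_sets)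
  from has_absolute_integral_change_of_variables_1'[OF this der inj, of f b]
  show "(\<lambda>x. \<bar>g' x\<bar> * f (g x)) absolutely_integrable_on S \<and>
      integral S (\<lambda>x. \<bar>g' x\<bar> * f (g x)) = b \<longleftrightarrow>
      f absolutely_integrable_on g ` S \<and> integral (g ` S) f = b"
    by simp
qed (use f in auto)

text \<open>A linear left inverse \<open>L\<close> of \<open>Y'\<close> turns
  \<open>Y (t y) = X y\<close> into \<open>F (t y) = L (X y)\<close>, where \<open>F\<close> has the
  identity as derivative at \<open>t x\<close>. Continuity of \<open>t\<close> makes the error of
  \<open>F\<close> small relative to the increment of \<open>t\<close>, and this error can be
  absorbed. As \<open>Y\<close> may map into a larger space, the same statement serves for
  transition maps between charts and for an edge arc expressed through the parameter of a
  curve.\<close>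

lemma has_derivative_implicit_left_inverse:
  fixes X :: "'a::real_normed_vector \<Rightarrow> 'c::euclidean_space" and Y :: "'b::euclidean_space \<Rightarrow> 'c"
  assumes X: "(X has_derivative X') (at x within S)"
    and Y: "(Y has_derivative Y') (at (t x))" and inj: "inj Y'"
    and t: "continuous (at x within S) t"
    and eq: "\<And>y. y \<in> S \<Longrightarrow> Y (t y) = X y" and x: "x \<in> S"
  obtains L where "(t has_derivative (\<lambda>v. L (X' v))) (at x within S)" "linear L"
proof -
  have "linear Y'" using Y has_derivative_linear by blast
  then obtain L where L: "linear L" "L \<circ> Y' = id"
    using linear_injective_left_inverse inj by blast
  then have LY: "L (Y' v) = v" for v by (metis comp_apply id_apply)
  define F where "F = (\<lambda>y. L (Y y))"
  interpret L: bounded_linear L using L(1) linear_conv_bounded_linear by blast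
  have F: "(F has_derivative (\<lambda>v. v)) (at (t x))"
    unfolding F_def using L.has_derivative[OF Y] by (simp add: LY)
  have G: "((\<lambda>y. L (X y)) has_derivative (\<lambda>v. L (X' v))) (at x within S)"
    using L.has_derivative[OF X] by simp
  obtain B where B: "\<And>v. norm (L (X' v)) \<le> norm v * B" "B > 0"
    using has_derivative_bounded_linear[OF G] bounded_linear.pos_bounded by blast
  have bl: "bounded_linear (\<lambda>v. L (X' v))" using G has_derivative_bounded_linear by blast
  have FG: "F (t y) = L (X y)" if "y \<in> S" for y using eq[OF that] by (simp add: F_def)
  have "(t has_derivative (\<lambda>v. L (X' v))) (at x within S)"
    unfolding has_derivative_within_alt
  proof (intro conjI bl allI impI)
    fix e :: real assume e: "e > 0"
    \<comment> \<open>The bound 1/2 allows \<open>e2 * norm w\<close> to be absorbed, giving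
      \<open>norm w \<le> 2 * (B + e1) * norm (y - x)\<close>. The other bound then makes
      \<open>e2 * norm w\<close> at most half of the permitted error; the \<open>+ 1\<close> is
      slack.\<close>
    define e2 where "e2 = min (1/2) (e / (2 * (2*B + e + 1)))"
    define e1 where "e1 = min (e/2) 1"
    have e2: "e2 > 0" "e2 \<le> 1/2" using e B by (auto simp: e2_def)
    have e1: "e1 > 0" using e by (auto simp: e1_def)
    obtain d where d: "d > 0" "\<And>y. norm (y - t x) < d \<Longrightarrow>
        norm (F y - F (t x) - (y - t x)) \<le> e2 * norm (y - t x)"
      using F e2 unfolding has_derivative_at_alt by blast
    obtain d1 where d1: "d1 > 0" "\<And>y. y \<in> S \<Longrightarrow> norm (y - x) < d1 \<Longrightarrow>
        norm (L (X y) - L (X x) - L (X' (y - x))) \<le> e1 * norm (y - x)"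
      using G e1 unfolding has_derivative_within_alt by blast
    obtain d2 where d2: "d2 > 0" "\<And>y. y \<in> S \<Longrightarrow> norm (y - x) < d2 \<Longrightarrow> norm (t y - t x) < d"
      using t d(1) unfolding continuous_within_eps_delta dist_norm by blast
    show "\<exists>d>0. \<forall>y\<in>S. norm (y - x) < d \<longrightarrow>
        norm (t y - t x - L (X' (y - x))) \<le> e * norm (y - x)"
    proof (intro exI[of _ "min d1 d2"] conjI ballI impI)
      fix y assume y: "y \<in> S" "norm (y - x) < min d1 d2"
      define w where "w = t y - t x"
      define r where "r = L (X y) - L (X x) - L (X' (y - x))"
      have a: "norm (L (X y) - L (X x) - w) \<le> e2 * norm w"
        using d(2)[of "t y"] d2(2)[of y] y FG[OF y(1)] FG[OF x] by (simp add: w_def)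
      have b: "norm r \<le> e1 * norm (y - x)" unfolding r_def using d1(2) y by simp
      have LXX: "L (X y) - L (X x) = r + L (X' (y - x))" by (simp add: r_def)
      have c: "norm (w - L (X' (y - x))) \<le> e2 * norm w + norm r"
      proof -
        have "w - L (X' (y - x)) = r - (L (X y) - L (X x) - w)" unfolding LXX by simp
        then have "norm (w - L (X' (y - x))) \<le> norm r + norm (L (X y) - L (X x) - w)"
            by (simp only: norm_triangle_ineq4)
          then show ?thesis using a by linarith
      qed
      have "norm w \<le> norm (L (X' (y - x))) + norm (w - L (X' (y - x)))"
        using norm_triangle_sub[of w "L (X' (y - x))"] by simp
      then have "norm w \<le> norm (y - x) * B + e2 * norm w + e1 * norm (y - x)"
        using B(1)[of "y - x"] b c by linarith
      moreover have "e2 * norm w \<le> 1/2 * norm w" using e2 by (intro mult_right_mono) auto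
      ultimately have w: "norm w \<le> 2 * (B + e1) * norm (y - x)" by (simp add: algebra_simps)
      have "e2 * norm w \<le> e2 * (2 * (B + e1) * norm (y - x))"
        using w e2 by (intro mult_left_mono) auto
      also have "\<dots> = (e2 * (2 * (B + e1))) * norm (y - x)" by simp
      also have "\<dots> \<le> (e/2) * norm (y - x)"
      proof (intro mult_right_mono)
        have "2 * (B + e1) \<le> 2*B + e + 1" unfolding e1_def using e by (simp add: min_def)
        then have "e2 * (2 * (B + e1)) \<le> (e / (2 * (2*B + e + 1))) * (2*B + e + 1)"
          using e B e1 unfolding e2_def by (intro mult_mono) auto
        also have "\<dots> = e/2" using e B by (simp add: field_simps)
        finally show "e2 * (2 * (B + e1)) \<le> e/2" .
      qed simp
      finally have "e2 * norm w \<le> (e/2) * norm (y - x)" .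
      moreover have "norm r \<le> (e/2) * norm (y - x)"
        using b by (rule order_trans) (rule mult_right_mono, simp_all add: e1_def)
      ultimately show "norm (t y - t x - L (X' (y - x))) \<le> e * norm (y - x)"
        using c unfolding w_def by (simp add: algebra_simps)
    qed (use d1 d2 in auto)
  qed
  with L(1) that show thesis by blast
qed

section \<open>Identities for cross products and 2 by 2 matrices\<close>

lemma cross3_linear_combination:
  fixes x1 x2 :: "real^3"
  shows "(a *\<^sub>R x1 + b *\<^sub>R x2) \<times> (c *\<^sub>R x1 + d *\<^sub>R x2) = (a * d - b * c) *\<^sub>R (x1 \<times> x2)"
  by (simp add: cross3_simps)

text \<open>Cramer's rule for the coordinates of \<open>v\<close> with respect to \<open>x\<close>,
  \<open>y\<close>, \<open>n\<close>, multiplied by the determinant so that the three vectors may be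
  dependent.\<close>

lemma cramer_cross3:
  fixes x y n v :: "real^3"
  shows "((y \<times> n) \<bullet> v) *\<^sub>R x + ((n \<times> x) \<bullet> v) *\<^sub>R y + ((x \<times> y) \<bullet> v) *\<^sub>R n = ((x \<times> y) \<bullet> n) *\<^sub>R v"
  by (simp add: cross3_simps forall_3)

lemma det_first_form: "det (first_form X x) = (norm (partial 1 X x \<times> partial 2 X x))\<^sup>2"
  using norm_cross_dot[of "partial 1 X x" "partial 2 X x"]
  by (simp add: det_2 first_form_def power_mult_distrib dot_square_norm inner_commute
      power2_eq_square[symmetric])

lemma sqrt_det_first_form: "sqrt (det (first_form X x)) = norm (partial 1 X x \<times> partial 2 X x)"
  by (simp add: det_first_form)

lemma trace_matrix_inv_mult_2:
  fixes A B :: "real^2^2"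
  assumes "det A \<noteq> 0"
  shows "trace (matrix_inv A ** B) * det A =
     A$2$2 * B$1$1 - A$1$2 * B$2$1 - A$2$1 * B$1$2 + A$1$1 * B$2$2"
proof -
  \<comment> \<open>The adjugate of \<open>A\<close>, which equals \<open>det A\<close> times the
    inverse.\<close>
  define C :: "real^2^2" where "C = vector [vector [A$2$2, - A$1$2], vector [- A$2$1, A$1$1]]"
  have C: "C ** A = det A *\<^sub>R mat 1"
    by (simp add: vec_eq_iff forall_2 matrix_matrix_mult_def sum_2 mat_def C_def det_2 algebra_simps)
  have "invertible A" using assms by (simp add: invertible_det_nz)
  then have "A ** matrix_inv A = mat 1"
    unfolding matrix_inv_def invertible_def by (rule someI2_ex) simp
  then have "C = (C ** A) ** matrix_inv A"
    by (metis matrix_mul_assoc matrix_mul_rid)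
  also have "\<dots> = det A *\<^sub>R matrix_inv A" unfolding C
    by (simp add: scalar_matrix_assoc[symmetric])
  finally have "C = det A *\<^sub>R matrix_inv A" .
  then have "trace (C ** B) = trace ((det A *\<^sub>R matrix_inv A) ** B)" by (rule arg_cong)
  also have "\<dots> = trace (matrix_inv A ** B) * det A"
    by (simp add: trace_def matrix_matrix_mult_def sum_2 algebra_simps)
  finally have "trace (matrix_inv A ** B) * det A = trace (C ** B)" ..
  also have "\<dots> = A$2$2 * B$1$1 - A$1$2 * B$2$1 - A$2$1 * B$1$2 + A$1$1 * B$2$2"
    by (simp add: C_def trace_def matrix_matrix_mult_def sum_2 algebra_simps)
  finally show ?thesis .
qed

section \<open>Charts and their transition maps\<close>

lemma smooth_on_continuous_on: "smooth_on f S \<Longrightarrow> continuous_on S f"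
  unfolding smooth_on_def by (metis Ck_on.simps(1))

lemma smooth_on_frechet_derivative:
  "smooth_on f S \<Longrightarrow> smooth_on (\<lambda>x. frechet_derivative f (at x) v) S"
  unfolding smooth_on_def by (metis Ck_on.simps(2))

lemma smooth_on_has_derivative:
  assumes "smooth_on f S" "open S" "x \<in> S"
  shows "(f has_derivative frechet_derivative f (at x)) (at x)"
proof -
  have "f differentiable_on S" using assms(1) unfolding smooth_on_def by (metis Ck_on.simps(2))
  then have "f differentiable at x" using assms(2,3) by (simp add: differentiable_on_eq_differentiable_at)
  then show ?thesis by (simp add: frechet_derivative_works)
qed

lemma smooth_on_partial: "smooth_on X U \<Longrightarrow> smooth_on (partial i X) U"
  unfolding partial_def[abs_def] by (rule smooth_on_frechet_derivative)

lemma linear_vec2_eq: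
  fixes f :: "real^2 \<Rightarrow> 'a::real_vector"
  assumes "linear f"
  shows "f v = v$1 *\<^sub>R f (axis 1 1) + v$2 *\<^sub>R f (axis 2 1)"
proof -
  have "v = v$1 *\<^sub>R axis 1 1 + v$2 *\<^sub>R axis 2 1"
    by (simp add: vec_eq_iff forall_2 axis_def)
  from arg_cong[OF this, of f] show ?thesis
    by (simp only: linear_add[OF assms] linear_scale[OF assms])
qed

lemma frechet_derivative_partial:
  assumes "smooth_on X U" "open U" "x \<in> U"
  shows "frechet_derivative X (at x) v = v$1 *\<^sub>R partial 1 X x + v$2 *\<^sub>R partial 2 X x"
  unfolding partial_def
  using linear_vec2_eq smooth_on_has_derivative[OF assms] has_derivative_linear by blast

lemma cross_partials_nonzero:
  assumes X: "smooth_on X U" "open U" "x \<in> U" and inj: "inj (frechet_derivative X (at x))"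
  shows "partial 1 X x \<times> partial 2 X x \<noteq> 0"
proof
  let ?D = "frechet_derivative X (at x)"
  have D: "?D (vector [a, b]) = a *\<^sub>R partial 1 X x + b *\<^sub>R partial 2 X x" for a b
    using frechet_derivative_partial[OF X] by simp
  have inj0: "a = 0 \<and> b = 0" if "a *\<^sub>R partial 1 X x + b *\<^sub>R partial 2 X x = 0" for a b
  proof -
    have "?D (vector [a, b]) = ?D (vector [0, 0])" using D[of a b] D[of 0 0] that by simp
    then have "(vector [a, b] :: real^2) = vector [0, 0]" using inj by (simp add: inj_eq)
    then show ?thesis by (metis vector_2)
  qed
  assume "partial 1 X x \<times> partial 2 X x = 0"
  then have "collinear {0, partial 1 X x, partial 2 X x}" by (simp add: cross_eq_0)
  then consider "partial 1 X x = 0" | "partial 2 X x = 0"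
    | c where "partial 2 X x = c *\<^sub>R partial 1 X x"
    by (auto simp: collinear_lemma)
  then show False
  proof cases
    case 1 then show False using inj0[of 1 0] by simp
  next
    case 2 then show False using inj0[of 0 1] by simp
  next
    case (3 c) then show False using inj0[of "-c" 1] by simp
  qed
qed

text \<open>This is \<open>sqrt (det I)\<close> by \<open>sqrt_det_first_form\<close>. In the form
  of a cross product it visibly picks up a determinant under a change of the tangent basis.\<close>

definition area_density :: "(real^2 \<Rightarrow> real^3) \<Rightarrow> real^2 \<Rightarrow> real" where
  "area_density X x = norm (partial 1 X x \<times> partial 2 X x)"

lemma area_density_nonneg [simp]: "0 \<le> area_density X x"
  by (simp add: area_density_def)

lemma continuous_on_area_density: "smooth_on X U \<Longrightarrow> continuous_on U (area_density X)"
  unfolding area_density_def[abs_def]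
  by (intro continuous_intros continuous_on_cross smooth_on_continuous_on smooth_on_partial)

lemma closed_half_plane: "closed half_plane"
  unfolding half_plane_def by (intro closed_Collect_le continuous_intros)

lemma half_plane_borel [measurable]: "half_plane \<in> sets borel"
  by (intro borel_closed closed_half_plane)

text \<open>This is the condition under which a derivative within a relatively open subset of the
  half-plane is unique, edge points included. Positive steps along either axis never decrease the
  second coordinate, so they stay in the half-plane.\<close>

lemma half_plane_axis_approach:
  assumes "open G" "x \<in> G \<inter> half_plane" "i \<in> Basis" "e > 0"
  shows "\<exists>d. 0 < \<bar>d\<bar> \<and> \<bar>d\<bar> < e \<and> x + d *\<^sub>R i \<in> G \<inter> half_plane"
proof -
  obtain r where r: "r > 0" "ball x r \<subseteq> G" using assms by (meson IntD1 open_contains_ball)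
  define d where "d = min e r / 2"
  have d: "0 < d" "d < e" "d < r" using assms r by (auto simp: d_def)
  obtain k where i: "i = axis k 1" using assms(3) by (auto simp: Basis_vec_def)
  have "x + d *\<^sub>R i \<in> ball x r" using d assms(3) by (simp add: dist_norm)
  moreover have "x + d *\<^sub>R i \<in> half_plane"
    using assms(2) d i by (auto simp: half_plane_def axis_def)
  ultimately show ?thesis using d r by (intro exI[of _ d]) auto
qed

lemma local_paramD:
  assumes "local_param M U X"
  shows "open U" "smooth_on X U" "\<And>x. x \<in> U \<Longrightarrow> inj (frechet_derivative X (at x))"
    "openin (top_of_set M) (X ` (U \<inter> half_plane))" "inj_on X (U \<inter> half_plane)"
    "continuous_on U X" "X ` (U \<inter> half_plane) \<subseteq> M"
proof -
  show *: "open U" "smooth_on X U" "\<And>x. x \<in> U \<Longrightarrow> inj (frechet_derivative X (at x))"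
    and o: "openin (top_of_set M) (X ` (U \<inter> half_plane))"
    using assms unfolding local_param_def by auto
  obtain Y where "homeomorphism (U \<inter> half_plane) (X ` (U \<inter> half_plane)) X Y"
    using assms unfolding local_param_def by blast
  then show "inj_on X (U \<inter> half_plane)"
    by (intro inj_on_inverseI[of _ Y]) (simp add: homeomorphism_def)
  show "continuous_on U X" by (rule smooth_on_continuous_on[OF *(2)])
  show "X ` (U \<inter> half_plane) \<subseteq> M" by (rule openin_imp_subset[OF o])
qed

text \<open>The transition map is the inverse of \<open>Y\<close> after \<open>X\<close>; at edge
  points it has a derivative only within \<open>S0\<close>. Differentiating
  \<open>Y (t x) = X x\<close> writes the partials of \<open>X\<close> as combinations of those of
  \<open>Y\<close> with the entries of \<open>t'\<close> as coefficients, and the cross product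
  extracts the determinant.\<close>

lemma local_param_transition:
  assumes X: "local_param M U X" and Y: "local_param M V Y"
  defines "S0 \<equiv> {x \<in> U \<inter> half_plane. X x \<in> Y ` (V \<inter> half_plane)}"
  obtains t t' where
    "\<And>x. x \<in> S0 \<Longrightarrow> t x \<in> V \<inter> half_plane \<and> Y (t x) = X x"
    "\<And>x. x \<in> S0 \<Longrightarrow> (t has_derivative t' x) (at x within S0)"
    "\<And>x. x \<in> S0 \<Longrightarrow> \<bar>det (matrix (t' x))\<bar> * area_density Y (t x) = area_density X x"
proof -
  note X' = local_paramD[OF X] and Y' = local_paramD[OF Y]
  obtain Yi where "homeomorphism (V \<inter> half_plane) (Y ` (V \<inter> half_plane)) Y Yi"
    using Y unfolding local_param_def by blast
  then have Yi: "continuous_on (Y ` (V \<inter> half_plane)) Yi" "\<And>y. y \<in> V \<inter> half_plane \<Longrightarrow> Yi (Y y) = y"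
    by (auto simp: homeomorphism_def)
  define t where "t = Yi \<circ> X"
  have t: "t x \<in> V \<inter> half_plane \<and> Y (t x) = X x" if "x \<in> S0" for x
    using that Yi(2) by (auto simp: S0_def t_def)
  have contX: "continuous_on S0 X" using X'(6) by (rule continuous_on_subset) (auto simp: S0_def)
  have contt: "continuous_on S0 t" unfolding t_def
    by (rule continuous_on_compose[OF contX]) (rule continuous_on_subset[OF Yi(1)], auto simp: S0_def)
  have "openin (top_of_set (U \<inter> half_plane)) (U \<inter> half_plane \<inter> X -` (Y ` (V \<inter> half_plane)))"
    by (rule continuous_openin_preimage[OF _ _ Y'(4)])
      (use X'(7) in \<open>auto intro: continuous_on_subset[OF X'(6)]\<close>)
  then obtain G0 where "open G0"
    "U \<inter> half_plane \<inter> X -` (Y ` (V \<inter> half_plane)) = (U \<inter> half_plane) \<inter> G0"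
    by (auto simp: openin_open)
  \<comment> \<open>\<open>S0\<close> is relatively open in the half-plane, so the derivatives of
    \<open>X\<close> and of \<open>Y\<close> after \<open>t\<close> within \<open>S0\<close> can be
    identified, also on the edge.\<close>
  then have G: "open (U \<inter> G0)" "S0 = (U \<inter> G0) \<inter> half_plane" using X'(1) by (auto simp: S0_def)
  have "\<exists>t'. (t has_derivative t') (at x within S0) \<and>
      \<bar>det (matrix t')\<bar> * area_density Y (t x) = area_density X x" if x: "x \<in> S0" for x
  proof -
    have xU: "x \<in> U" using x by (auto simp: S0_def)
    have tV: "t x \<in> V" using t[OF x] by auto
    note dX = smooth_on_has_derivative[OF X'(2,1) xU]
    note dY = smooth_on_has_derivative[OF Y'(2,1) tV]
    have dXS: "(X has_derivative frechet_derivative X (at x)) (at x within S0)"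
      using dX by (rule has_derivative_at_withinI)
    have ct: "continuous (at x within S0) t"
      using contt x by (simp add: continuous_on_eq_continuous_within)
    obtain L where L: "(t has_derivative (\<lambda>v. L (frechet_derivative X (at x) v))) (at x within S0)"
      by (rule has_derivative_implicit_left_inverse[where t=t and Y=Y, OF dXS dY Y'(3)[OF tV] ct _ x])
        (use t in auto)
    define t' where "t' = (\<lambda>v. L (frechet_derivative X (at x) v))"
    have t': "(t has_derivative t') (at x within S0)" using L by (simp add: t'_def)
    have "((\<lambda>x. Y (t x)) has_derivative (\<lambda>v. frechet_derivative Y (at (t x)) (t' v))) (at x within S0)"
      by (rule has_derivative_compose[OF t' dY])
    then have "(X has_derivative (\<lambda>v. frechet_derivative Y (at (t x)) (t' v))) (at x within S0)"
      by (rule has_derivative_transform[OF x, rotated]) (use t in auto)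
    then have eq: "frechet_derivative X (at x) = (\<lambda>v. frechet_derivative Y (at (t x)) (t' v))"
      by (rule frechet_derivative_unique_within[OF dXS])
        (use half_plane_axis_approach[OF G(1)] x G(2) in auto)
    have p: "partial i X x = t' (axis i 1) $ 1 *\<^sub>R partial 1 Y (t x) + t' (axis i 1) $ 2 *\<^sub>R partial 2 Y (t x)" for i
      unfolding partial_def[of i X] eq using frechet_derivative_partial[OF Y'(2,1) tV] by simp
    have "area_density X x = \<bar>det (matrix t')\<bar> * area_density Y (t x)"
      unfolding area_density_def p cross3_linear_combination
      by (simp add: det_2 matrix_def mult.commute)
    with t' show ?thesis by auto
  qed
  then obtain t' where "\<And>x. x \<in> S0 \<Longrightarrow> (t has_derivative t' x) (at x within S0)"
    "\<And>x. x \<in> S0 \<Longrightarrow> \<bar>det (matrix (t' x))\<bar> * area_density Y (t x) = area_density X x"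
    by metis
  with t that show thesis by blast
qed

text \<open>The push-forward under \<open>X\<close> of the area density. The indicators make density
  and map Borel on the whole plane; the points sent to 0 outside the parameter domain carry weight
  0.\<close>

definition chart_measure :: "(real^2) set \<Rightarrow> (real^2 \<Rightarrow> real^3) \<Rightarrow> (real^3) measure" where
  "chart_measure U X = distr (density lborel (\<lambda>x. indicator (U \<inter> half_plane) x * ennreal (area_density X x)))
     borel (\<lambda>x. indicator (U \<inter> half_plane) x *\<^sub>R X x)"

lemma sets_chart_measure [simp, measurable_cong]: "sets (chart_measure U X) = sets borel"
  by (simp add: chart_measure_def)

lemma space_chart_measure [simp]: "space (chart_measure U X) = UNIV"
  by (simp add: chart_measure_def)

lemma open_Int_half_plane_borel: "open U \<Longrightarrow> U \<inter> half_plane \<in> sets borel"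
  by (simp add: half_plane_borel)

lemma chart_measurable:
  assumes "smooth_on X U" "open U"
  shows "(\<lambda>x. indicator (U \<inter> half_plane) x *\<^sub>R X x) \<in> borel_measurable borel" (is ?X)
    and "(\<lambda>x. indicator (U \<inter> half_plane) x *\<^sub>R area_density X x) \<in> borel_measurable borel" (is ?J)
proof -
  have "continuous_on (U \<inter> half_plane) X" "continuous_on (U \<inter> half_plane) (area_density X)"
    using continuous_on_subset[OF smooth_on_continuous_on[OF assms(1)]]
      continuous_on_subset[OF continuous_on_area_density[OF assms(1)]] by auto
  then show ?X ?J
    by (intro borel_measurable_continuous_on_indicator open_Int_half_plane_borel assms; simp)+
qed

lemma chart_preimage_borel:
  fixes X :: "real^2 \<Rightarrow> real^3"
  assumes "smooth_on X U" "open U" "A \<in> sets borel"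
  shows "{x \<in> U \<inter> half_plane. X x \<in> A} \<in> sets borel"
proof -
  have "{x \<in> U \<inter> half_plane. X x \<in> A} =
      (U \<inter> half_plane) \<inter> ((\<lambda>x. indicator (U \<inter> half_plane) x *\<^sub>R X x) -` A \<inter> space borel)"
    by auto
  then show ?thesis
    using measurable_sets[OF chart_measurable(1)[OF assms(1,2)] assms(3)]
      open_Int_half_plane_borel[OF assms(2)] by auto
qed

lemma chart_density_measurable:
  assumes "smooth_on X U" "open U"
  shows "(\<lambda>x. indicator (U \<inter> half_plane) x * ennreal (area_density X x)) \<in> borel_measurable borel"
  unfolding mult.commute[of "indicator _ _"]
  by (intro ennreal_indicator_measurable open_Int_half_plane_borel assms
      continuous_on_subset[OF continuous_on_area_density[OF assms(1)]]) auto

lemma nn_integral_chart_measure: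
  assumes "smooth_on X U" "open U" and f [measurable]: "f \<in> borel_measurable borel"
  shows "(\<integral>\<^sup>+p. f p \<partial>chart_measure U X) = (\<integral>\<^sup>+x\<in>U \<inter> half_plane. (ennreal (area_density X x) * f (X x)) \<partial>lborel)"
proof -
  note [measurable] = chart_measurable(1)[OF assms(1,2)] chart_density_measurable[OF assms(1,2)]
  show ?thesis unfolding chart_measure_def
    by (subst nn_integral_distr, simp, simp, subst nn_integral_density, simp, measurable)
      (auto intro!: nn_integral_cong simp: indicator_def)
qed

lemma emeasure_chart_measure:
  assumes "smooth_on X U" "open U" and A: "A \<in> sets borel"
  shows "emeasure (chart_measure U X) A =
    (\<integral>\<^sup>+x\<in>{x \<in> U \<inter> half_plane. X x \<in> A}. area_density X x \<partial>lborel)"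
proof -
  have "emeasure (chart_measure U X) A = (\<integral>\<^sup>+p. indicator A p \<partial>chart_measure U X)"
    using A by (simp add: nn_integral_indicator)
  then show ?thesis
    by (subst (asm) nn_integral_chart_measure[OF assms(1,2)])
      (use A in \<open>auto intro!: nn_integral_cong simp: indicator_def\<close>)
qed

lemma integral_chart_measure:
  fixes f :: "real^3 \<Rightarrow> real"
  assumes "smooth_on X U" "open U" and f: "f \<in> borel_measurable borel"
  shows "integral\<^sup>L (chart_measure U X) f = (LINT x:U \<inter> half_plane|lborel. area_density X x * f (X x))"
proof -
  have d: "(\<lambda>x. indicator (U \<inter> half_plane) x * ennreal (area_density X x)) =
      (\<lambda>x. ennreal (indicator (U \<inter> half_plane) x *\<^sub>R area_density X x))"
    by (auto simp: fun_eq_iff indicator_def)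
  have e: "(\<lambda>x. (indicator (U \<inter> half_plane) x *\<^sub>R area_density X x) *\<^sub>R f (indicator (U \<inter> half_plane) x *\<^sub>R X x)) =
     (\<lambda>x. indicator (U \<inter> half_plane) x *\<^sub>R (area_density X x * f (X x)))"
    by (auto simp: fun_eq_iff indicator_def)
  let ?w = "\<lambda>x. indicator (U \<inter> half_plane) x *\<^sub>R area_density X x"
    and ?X = "\<lambda>x. indicator (U \<inter> half_plane) x *\<^sub>R X x"
  have c: "chart_measure U X = distr (density lborel (\<lambda>x. ennreal (?w x))) borel ?X"
    unfolding chart_measure_def d ..
  have f': "(\<lambda>x. f (?X x)) \<in> borel_measurable lborel"
    using measurable_compose[OF chart_measurable(1)[OF assms(1,2)] f] by simp
  have w: "?w \<in> borel_measurable lborel" "AE x in lborel. 0 \<le> ?w x"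
    using chart_measurable(2)[OF assms(1,2)] by simp_all
  have X: "?X \<in> density lborel (\<lambda>x. ennreal (?w x)) \<rightarrow>\<^sub>M borel"
    using chart_measurable(1)[OF assms(1,2)] by (simp add: measurable_density_eq1)
  have "integral\<^sup>L (chart_measure U X) f = integral\<^sup>L (density lborel (\<lambda>x. ennreal (?w x))) (\<lambda>x. f (?X x))"
    unfolding c by (rule integral_distr[OF X f])
  also have "\<dots> = integral\<^sup>L lborel (\<lambda>x. ?w x *\<^sub>R f (?X x))"
    by (rule integral_density[OF f' w])
  finally show "integral\<^sup>L (chart_measure U X) f =
      (LINT x:U \<inter> half_plane|lborel. area_density X x * f (X x))"
    unfolding set_lebesgue_integral_def e .
qed

text \<open>The transition map takes the parameters of \<open>A\<close> in one chart bijectively to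
  those in the other, and its Jacobian is the quotient of the two densities. This is the
  independence of the chart on which the global measure rests.\<close>

lemma emeasure_chart_measure_transition:
  assumes X: "local_param M U X" and Y: "local_param M V Y" and A: "A \<in> sets borel"
    and sub: "A \<subseteq> X ` (U \<inter> half_plane)" "A \<subseteq> Y ` (V \<inter> half_plane)"
  shows "emeasure (chart_measure U X) A = emeasure (chart_measure V Y) A"
proof -
  note X' = local_paramD[OF X] and Y' = local_paramD[OF Y]
  define S0 where "S0 = {x \<in> U \<inter> half_plane. X x \<in> Y ` (V \<inter> half_plane)}"
  obtain t t' where t: "\<And>x. x \<in> S0 \<Longrightarrow> t x \<in> V \<inter> half_plane \<and> Y (t x) = X x"
    and t': "\<And>x. x \<in> S0 \<Longrightarrow> (t has_derivative t' x) (at x within S0)"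
    and d: "\<And>x. x \<in> S0 \<Longrightarrow> \<bar>det (matrix (t' x))\<bar> * area_density Y (t x) = area_density X x"
    by (rule local_param_transition[OF X Y, folded S0_def]) blast
  define S where "S = {x \<in> U \<inter> half_plane. X x \<in> A}"
  define T where "T = {y \<in> V \<inter> half_plane. Y y \<in> A}"
  have S: "S \<in> sets borel" unfolding S_def by (rule chart_preimage_borel[OF X'(2,1) A])
  have T: "T \<in> sets borel" unfolding T_def by (rule chart_preimage_borel[OF Y'(2,1) A])
  have inS: "x \<in> S0" if "x \<in> S" for x
    using that sub by (auto simp: S_def S0_def)
  have im: "t ` S = T"
  proof
    show "t ` S \<subseteq> T" using t inS by (fastforce simp: S_def T_def)
    show "T \<subseteq> t ` S"
    proof
      fix y assume y: "y \<in> T"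
      then obtain x where x: "x \<in> U \<inter> half_plane" "Y y = X x" using sub by (auto simp: T_def)
      have xS: "x \<in> S" using x y by (auto simp: S_def T_def)
      then have "t x = y" using t[OF inS[OF xS]] x y Y'(5) by (auto simp: T_def inj_on_def)
      then show "y \<in> t ` S" using xS by blast
    qed
  qed
  have inj: "inj_on t S"
  proof (rule inj_onI)
    fix x y assume xy: "x \<in> S" "y \<in> S" "t x = t y"
    then have "X x = X y" using t inS by metis
    then show "x = y" using xy X'(5) by (auto simp: S_def inj_on_def)
  qed
  have der: "(t has_derivative t' x) (at x within S)" if "x \<in> S" for x
    by (rule has_derivative_subset[OF t'[OF inS[OF that]]]) (use inS in auto)
  have mY: "set_borel_measurable borel T (area_density Y)"
    unfolding set_borel_measurable_def
    by (intro borel_measurable_continuous_on_indicator T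
      continuous_on_subset[OF continuous_on_area_density[OF Y'(2)]]) (auto simp: T_def)
  have "set_borel_measurable borel S (area_density X)"
    unfolding set_borel_measurable_def
    by (intro borel_measurable_continuous_on_indicator S
      continuous_on_subset[OF continuous_on_area_density[OF X'(2)]]) (auto simp: S_def)
  moreover have "(\<lambda>x. indicator S x *\<^sub>R area_density X x) =
      (\<lambda>x. indicator S x *\<^sub>R (\<bar>det (matrix (t' x))\<bar> * area_density Y (t x)))"
    using d inS by (auto simp: fun_eq_iff indicator_def)
  ultimately have mX: "set_borel_measurable borel S (\<lambda>x. \<bar>det (matrix (t' x))\<bar> * area_density Y (t x))"
    unfolding set_borel_measurable_def by simp
  have "(\<integral>\<^sup>+x\<in>S. (\<bar>det (matrix (t' x))\<bar> * area_density Y (t x)) \<partial>lborel) =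
      (\<integral>\<^sup>+y\<in>t ` S. area_density Y y \<partial>lborel)"
    by (rule nn_integral_change_of_variables[OF S _ der inj]) (use im T mY mX in auto)
  moreover have "(\<integral>\<^sup>+x\<in>S. (\<bar>det (matrix (t' x))\<bar> * area_density Y (t x)) \<partial>lborel) =
     (\<integral>\<^sup>+x\<in>S. area_density X x \<partial>lborel)"
    using d inS by (intro nn_integral_cong) (auto simp: indicator_def)
  ultimately show ?thesis
    unfolding emeasure_chart_measure[OF X'(2,1) A] emeasure_chart_measure[OF Y'(2,1) A]
    using im by (simp add: S_def T_def)
qed

section \<open>The area measure of a compact surface\<close>

lemma compact_chart_preimage:
  assumes "local_param M U X" "compact C" "C \<subseteq> X ` (U \<inter> half_plane)"
  shows "compact {x \<in> U \<inter> half_plane. X x \<in> C}"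
proof -
  obtain Y where Y: "homeomorphism (U \<inter> half_plane) (X ` (U \<inter> half_plane)) X Y"
    using assms(1) unfolding local_param_def by blast
  have "{x \<in> U \<inter> half_plane. X x \<in> C} = Y ` C"
    using Y assms(3) by (force simp: homeomorphism_def)
  moreover have "continuous_on C Y"
    using Y assms(3) continuous_on_subset by (auto simp: homeomorphism_def)
  ultimately show ?thesis using compact_continuous_image assms(2) by metis
qed

lemma smooth_surface_chart_cball:
  assumes "smooth_surface M" "p \<in> M"
  obtains U X r where "local_param M U X" "r > 0" "M \<inter> cball p r \<subseteq> X ` (U \<inter> half_plane)"
proof -
  obtain U X where X: "local_param M U X" "p \<in> X ` (U \<inter> half_plane)"
    using assms unfolding smooth_surface_def by blast
  then obtain r where "r > 0" "ball p r \<inter> M \<subseteq> X ` (U \<inter> half_plane)"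
    using openin_contains_ball[of M] local_paramD(4)[OF X(1)] by blast
  then have "M \<inter> cball p (r/2) \<subseteq> X ` (U \<inter> half_plane)" by (auto simp: subset_iff)
  with X(1) \<open>r > 0\<close> that[of U X "r/2"] show thesis by simp
qed

lemma compact_surface_chart_cover:
  assumes M: "compact M" "smooth_surface M"
  obtains Q U X r where "Q \<subseteq> M" "finite Q" "M \<subseteq> (\<Union>p\<in>Q. ball p (r p))"
    "\<And>p. p \<in> M \<Longrightarrow> local_param M (U p) (X p)" "\<And>p. p \<in> M \<Longrightarrow> (r p :: real) > 0"
    "\<And>p. p \<in> M \<Longrightarrow> M \<inter> cball p (r p) \<subseteq> X p ` (U p \<inter> half_plane)"
proof -
  have "\<exists>U X r. local_param M U X \<and> r > 0 \<and> M \<inter> cball p r \<subseteq> X ` (U \<inter> half_plane)" if "p \<in> M" for p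
    using smooth_surface_chart_cball[OF M(2) that] by metis
  then obtain U X r where c: "\<And>p. p \<in> M \<Longrightarrow> local_param M (U p) (X p)" "\<And>p. p \<in> M \<Longrightarrow> (r p :: real) > 0"
    "\<And>p. p \<in> M \<Longrightarrow> M \<inter> cball p (r p) \<subseteq> X p ` (U p \<inter> half_plane)"
    by metis
  obtain Q where Q: "Q \<subseteq> M" "finite Q" "M \<subseteq> (\<Union>p\<in>Q. ball p (r p))"
    using compactE_image[OF M(1), of M "\<lambda>p. ball p (r p)"] c(2) by force
  with c that show thesis by blast
qed

lemma chart_image_borel:
  assumes "local_param M U X" "closed M"
  shows "X ` (U \<inter> half_plane) \<in> sets borel"
proof -
  obtain G where "open G" "X ` (U \<inter> half_plane) = M \<inter> G"
    using local_paramD(4)[OF assms(1)] by (auto simp: openin_open)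
  then show ?thesis using assms(2) by auto
qed

lemma emeasure_chart_measure_compact:
  assumes X: "local_param M U X" and C: "compact C" "C \<subseteq> X ` (U \<inter> half_plane)"
  shows "emeasure (chart_measure U X) C < \<infinity>"
proof -
  note X' = local_paramD[OF X]
  define K where "K = {x \<in> U \<inter> half_plane. X x \<in> C}"
  have K: "compact K" unfolding K_def by (rule compact_chart_preimage[OF X C])
  have "continuous_on K (area_density X)"
    by (rule continuous_on_subset[OF continuous_on_area_density[OF X'(2)]]) (auto simp: K_def)
  then have "integrable lborel (\<lambda>x. indicator K x *\<^sub>R area_density X x)"
    by (rule borel_integrable_compact[OF K])
  then have "(\<integral>\<^sup>+x. ennreal (norm (indicator K x *\<^sub>R area_density X x)) \<partial>lborel) < \<infinity>"
    by (simp only: integrable_iff_bounded)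
  moreover have "(\<integral>\<^sup>+x. ennreal (norm (indicator K x *\<^sub>R area_density X x)) \<partial>lborel)
      = (\<integral>\<^sup>+x\<in>K. area_density X x \<partial>lborel)"
    by (intro nn_integral_cong) (auto simp: indicator_def)
  ultimately show ?thesis
    using emeasure_chart_measure[OF X'(2,1), of C] C(1) by (simp add: K_def compact_imp_closed)
qed

text \<open>Finitely many balls cover \<open>M\<close>, and each piece is the trace of a closed ball
  minus its predecessors. Closed balls are used because their traces on \<open>M\<close> are compact
  inside one chart, which yields the finite chart measure.\<close>

lemma compact_surface_chart_partition:
  assumes M: "compact M" "smooth_surface M"
  obtains n :: nat and U X F where
    "\<And>i. i < n \<Longrightarrow> local_param M (U i) (X i)" "\<And>i. i < n \<Longrightarrow> F i \<in> sets borel"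
    "\<And>i. i < n \<Longrightarrow> F i \<subseteq> X i ` (U i \<inter> half_plane)" "disjoint_family_on F {..<n}"
    "(\<Union>i<n. F i) = M" "\<And>i. i < n \<Longrightarrow> emeasure (chart_measure (U i) (X i)) (F i) < \<infinity>"
proof -
  obtain Q U X r where Q: "Q \<subseteq> M" "finite Q" "M \<subseteq> (\<Union>p\<in>Q. ball p (r p))"
    and c: "\<And>p. p \<in> M \<Longrightarrow> local_param M (U p) (X p)" "\<And>p. p \<in> M \<Longrightarrow> (r p :: real) > 0"
      "\<And>p. p \<in> M \<Longrightarrow> M \<inter> cball p (r p) \<subseteq> X p ` (U p \<inter> half_plane)"
    by (rule compact_surface_chart_cover[OF M]) blast
  obtain q where q: "bij_betw q {..<card Q} Q"
    using ex_bij_betw_nat_finite[OF Q(2)] by (auto simp: atLeast0LessThan)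
  define E where "E = (\<lambda>i. M \<inter> cball (q i) (r (q i)))"
  define F where "F = (\<lambda>i. E i - (\<Union>j<i. E j))"
  have qQ: "q i \<in> M" if "i < card Q" for i using q Q(1) that by (auto simp: bij_betw_def)
  have compE: "compact (E i)" for i unfolding E_def by (intro compact_Int_closed M) simp
  have Eb: "E i \<in> sets borel" for i using compE by (simp add: borel_compact)
  have FE: "F i \<subseteq> E i" for i by (auto simp: F_def)
  show thesis
  proof (rule that[of "card Q" "U \<circ> q" "X \<circ> q" F])
    fix i assume i: "i < card Q"
    show "local_param M ((U \<circ> q) i) ((X \<circ> q) i)" using c(1) qQ i by simp
    show "F i \<in> sets borel" unfolding F_def using Eb by auto
    have ES: "E i \<subseteq> X (q i) ` (U (q i) \<inter> half_plane)" unfolding E_def using c(3)[OF qQ[OF i]] .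
    then show "F i \<subseteq> (X \<circ> q) i ` ((U \<circ> q) i \<inter> half_plane)" using FE by fastforce
    have "emeasure (chart_measure (U (q i)) (X (q i))) (F i) \<le> emeasure (chart_measure (U (q i)) (X (q i))) (E i)"
      using FE Eb by (intro emeasure_mono) auto
    also have "\<dots> < \<infinity>" by (rule emeasure_chart_measure_compact[OF c(1)[OF qQ[OF i]] compE ES])
    finally show "emeasure (chart_measure ((U \<circ> q) i) ((X \<circ> q) i)) (F i) < \<infinity>" by simp
  next
    show "disjoint_family_on F {..<card Q}"
      unfolding disjoint_family_on_def
    proof (intro ballI impI)
      fix i j :: nat assume "i \<noteq> j"
      then show "F i \<inter> F j = {}" unfolding F_def by (cases i j rule: linorder_cases) auto
    qed
    show "(\<Union>i<card Q. F i) = M"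
    proof
      show "(\<Union>i<card Q. F i) \<subseteq> M" by (auto simp: F_def E_def)
      show "M \<subseteq> (\<Union>i<card Q. F i)"
      proof
        fix p assume p: "p \<in> M"
        then obtain s where "s \<in> Q" "p \<in> ball s (r s)" using Q(3) by blast
        moreover have "s \<in> q ` {..<card Q}" using \<open>s \<in> Q\<close> bij_betw_imp_surj_on[OF q] by simp
        then obtain k where "k < card Q" "q k = s" by auto
        ultimately have "\<exists>i. i < card Q \<and> p \<in> E i" using p by (auto simp: E_def)
        then obtain i where i: "i < card Q \<and> p \<in> E i" and least: "\<And>j. j < i \<Longrightarrow> \<not> (j < card Q \<and> p \<in> E j)"
          using exists_least_iff[of "\<lambda>i. i < card Q \<and> p \<in> E i"] by blast
        then have "p \<in> F i" by (auto simp: F_def)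
        then show "p \<in> (\<Union>i<card Q. F i)" using i by blast
      qed
    qed
  qed
qed

text \<open>The measure lives on all of \<open>real^3\<close> with no mass off \<open>M\<close>,
  which avoids a separate measurable space on \<open>M\<close>. The last clause determines it on
  every chart.\<close>

definition surface_measure :: "(real^3) set \<Rightarrow> (real^3) measure \<Rightarrow> bool" where
  "surface_measure M \<mu> \<longleftrightarrow> sets \<mu> = sets borel \<and> finite_measure \<mu> \<and> emeasure \<mu> (- M) = 0 \<and>
     (\<forall>U X A. local_param M U X \<longrightarrow> A \<in> sets borel \<longrightarrow> A \<subseteq> X ` (U \<inter> half_plane) \<longrightarrow>
        emeasure \<mu> A = emeasure (chart_measure U X) A)"

text \<open>Each piece \<open>F i\<close> of a chart partition is measured in its own chart and the
  results are added. For an arbitrary chart \<open>Y\<close>, every summand can be moved to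
  \<open>Y\<close> by the transition lemma, and additivity reassembles the set.\<close>

lemma surface_measure_exists:
  assumes M: "compact M" "smooth_surface M"
  obtains \<mu> where "surface_measure M \<mu>"
proof -
  obtain n :: nat and U X F where c: "\<And>i. i < n \<Longrightarrow> local_param M (U i) (X i)"
    and Fb: "\<And>i. i < n \<Longrightarrow> F i \<in> sets borel"
    and FX: "\<And>i. i < n \<Longrightarrow> F i \<subseteq> X i ` (U i \<inter> half_plane)" and disj: "disjoint_family_on F {..<n}"
    and FM: "(\<Union>i<n. F i) = M" and fin: "\<And>i. i < n \<Longrightarrow> emeasure (chart_measure (U i) (X i)) (F i) < \<infinity>"
    using compact_surface_chart_partition[OF M] by metis
  define m where "m = (\<lambda>A. \<Sum>i<n. emeasure (chart_measure (U i) (X i)) (A \<inter> F i))"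
  define \<mu> where "\<mu> = measure_of UNIV (sets borel) m"
  have sets: "sets \<mu> = sets borel" unfolding \<mu>_def
    by (simp add: sets.sigma_sets_eq[of borel, simplified])
  have space: "space \<mu> = UNIV" unfolding \<mu>_def by (simp add: space_measure_of_conv)
  have "countably_additive (sets borel) m"
  proof (rule countably_additiveI)
    fix A :: "nat \<Rightarrow> (real^3) set"
    assume A: "range A \<subseteq> sets borel" "disjoint_family A" "(\<Union>i. A i) \<in> sets borel"
    have "(\<Sum>k. m (A k)) = (\<Sum>i<n. \<Sum>k. emeasure (chart_measure (U i) (X i)) (A k \<inter> F i))"
      unfolding m_def by (rule suminf_sum) simp
    also have "\<dots> = (\<Sum>i<n. emeasure (chart_measure (U i) (X i)) ((\<Union>k. A k) \<inter> F i))"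
    proof (rule sum.cong[OF refl])
      fix i assume "i \<in> {..<n}"
      then have "range (\<lambda>k. A k \<inter> F i) \<subseteq> sets (chart_measure (U i) (X i))"
        using A(1) Fb by auto
      moreover have "disjoint_family (\<lambda>k. A k \<inter> F i)"
        using A(2) by (auto simp: disjoint_family_on_def)
      ultimately have "(\<Sum>k. emeasure (chart_measure (U i) (X i)) (A k \<inter> F i)) =
          emeasure (chart_measure (U i) (X i)) (\<Union>k. A k \<inter> F i)"
        by (rule suminf_emeasure)
      then show "(\<Sum>k. emeasure (chart_measure (U i) (X i)) (A k \<inter> F i)) =
          emeasure (chart_measure (U i) (X i)) ((\<Union>k. A k) \<inter> F i)" by simp
    qed
    finally show "(\<Sum>k. m (A k)) = m (\<Union>i. A i)" by (simp add: m_def)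
  qed
  moreover have "positive (sets borel) m" by (simp add: positive_def m_def)
  ultimately have em: "emeasure \<mu> A = m A" if "A \<in> sets borel" for A
    using that sets space unfolding \<mu>_def
    by (intro emeasure_measure_of_sigma) (auto simp: sets.sigma_algebra_axioms[of borel, simplified])
  have "emeasure \<mu> A = emeasure (chart_measure V Y) A"
    if Y: "local_param M V Y" and A: "A \<in> sets borel" "A \<subseteq> Y ` (V \<inter> half_plane)" for V Y A
  proof -
    have "m A = (\<Sum>i<n. emeasure (chart_measure V Y) (A \<inter> F i))" unfolding m_def
    proof (rule sum.cong[OF refl])
      fix i assume "i \<in> {..<n}"
      then show "emeasure (chart_measure (U i) (X i)) (A \<inter> F i) = emeasure (chart_measure V Y) (A \<inter> F i)"
        using A FX[of i] Fb[of i] by (intro emeasure_chart_measure_transition[OF c Y]) auto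
    qed
    also have "\<dots> = emeasure (chart_measure V Y) (\<Union>i<n. A \<inter> F i)"
    proof (rule sum_emeasure)
      show "disjoint_family_on (\<lambda>i. A \<inter> F i) {..<n}"
        by (rule disjoint_family_on_bisimulation[OF disj]) auto
    qed (use A Fb in auto)
    also have "(\<Union>i<n. A \<inter> F i) = A"
    proof -
      have "A \<subseteq> (\<Union>i<n. F i)" using A(2) local_paramD(7)[OF Y] FM by simp
      then show ?thesis by auto
    qed
    finally show ?thesis using em[OF A(1)] by simp
  qed
  moreover have "emeasure \<mu> (- M) = 0"
  proof -
    have "- M \<inter> F i = {}" if "i < n" for i using FM that by auto
    moreover have "- M \<in> sets borel" using M(1) by (intro borel_open) (simp add: compact_imp_closed open_Compl)
    ultimately show ?thesis by (simp add: em m_def)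
  qed
  moreover have "finite_measure \<mu>"
  proof
    show "emeasure \<mu> (space \<mu>) \<noteq> \<infinity>"
      using fin by (simp add: space em m_def less_top[symmetric] ennreal_sum_less_top)
  qed
  ultimately show thesis using that sets unfolding surface_measure_def by blast
qed

lemma surface_measureD:
  assumes "surface_measure M \<mu>"
  shows "sets \<mu> = sets borel" "space \<mu> = UNIV" "finite_measure \<mu>" "emeasure \<mu> (- M) = 0"
    "\<And>U X A. local_param M U X \<Longrightarrow> A \<in> sets borel \<Longrightarrow> A \<subseteq> X ` (U \<inter> half_plane) \<Longrightarrow>
        emeasure \<mu> A = emeasure (chart_measure U X) A"
  using assms sets_eq_imp_space_eq[of \<mu> borel] by (auto simp: surface_measure_def)

text \<open>Agreement on subsets of the chart image upgrades to equality of measures, because a set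
  outside the image has no parameters and hence chart measure 0. Integrals of functions supported in
  one chart can then be computed there.\<close>

lemma density_surface_measure:
  assumes \<mu>: "surface_measure M \<mu>" and X: "local_param M U X" and "closed M"
  shows "density \<mu> (indicator (X ` (U \<inter> half_plane))) = chart_measure U X"
proof (rule measure_eqI)
  note m = surface_measureD[OF \<mu>] and X' = local_paramD[OF X]
  let ?E = "X ` (U \<inter> half_plane)"
  have E: "?E \<in> sets borel" by (rule chart_image_borel[OF X \<open>closed M\<close>])
  fix A assume "A \<in> sets (density \<mu> (indicator ?E))"
  then have A: "A \<in> sets borel" by (simp add: m(1))
  have "emeasure (density \<mu> (indicator ?E)) A = emeasure \<mu> (?E \<inter> A)"
  proof -
    have "emeasure (density \<mu> (indicator ?E)) A = (\<integral>\<^sup>+p. indicator ?E p * indicator A p \<partial>\<mu>)"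
      using A E m(1) by (intro emeasure_density) auto
    also have "\<dots> = (\<integral>\<^sup>+p. indicator (?E \<inter> A) p \<partial>\<mu>)" by (simp add: indicator_inter_arith)
    finally show ?thesis using A E m(1) by simp
  qed
  also have "\<dots> = emeasure (chart_measure U X) (?E \<inter> A)"
    by (rule m(5)[OF X]) (use A E in auto)
  also have "\<dots> = emeasure (chart_measure U X) A"
  proof -
    have "{x \<in> U \<inter> half_plane. X x \<in> ?E \<inter> A} = {x \<in> U \<inter> half_plane. X x \<in> A}" by auto
    then show ?thesis using A E by (simp only: emeasure_chart_measure[OF X'(2,1)] sets.Int)
  qed
  finally show "emeasure (density \<mu> (indicator ?E)) A = emeasure (chart_measure U X) A" .
qed (simp add: surface_measureD[OF \<mu>])

lemma integral_surface_measure_chart: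
  fixes f :: "real^3 \<Rightarrow> real"
  assumes \<mu>: "surface_measure M \<mu>" and X: "local_param M U X" and "closed M"
    and f: "f \<in> borel_measurable borel" "\<And>p. p \<in> M - X ` (U \<inter> half_plane) \<Longrightarrow> f p = 0"
  shows "integral\<^sup>L \<mu> f = (LINT x:U \<inter> half_plane|lborel. area_density X x * f (X x))"
proof -
  note m = surface_measureD[OF \<mu>] and X' = local_paramD[OF X]
  let ?E = "X ` (U \<inter> half_plane)"
  have E: "?E \<in> sets borel" by (rule chart_image_borel[OF X \<open>closed M\<close>])
  have ae: "AE p in \<mu>. p \<in> M"
    using m(4) \<open>closed M\<close> by (intro AE_I[where N="-M"]) (auto simp: m)
  have fm: "f \<in> borel_measurable \<mu>" using f(1) m(1) by (simp cong: measurable_cong_sets)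
  have im: "(indicator ?E :: _ \<Rightarrow> real) \<in> borel_measurable \<mu>" using E m(1) by simp
  have "integral\<^sup>L \<mu> f = integral\<^sup>L \<mu> (\<lambda>p. indicator ?E p *\<^sub>R f p)"
  proof (rule integral_cong_AE)
    show "AE p in \<mu>. f p = indicator ?E p *\<^sub>R f p"
      using ae by eventually_elim (use f(2) in \<open>auto simp: indicator_def\<close>)
  qed (use fm im in simp_all)
  also have "\<dots> = integral\<^sup>L (density \<mu> (\<lambda>p. ennreal (indicator ?E p))) f"
    by (rule integral_density[symmetric]) (use fm im in simp_all)
  also have "density \<mu> (\<lambda>p. ennreal (indicator ?E p)) = chart_measure U X"
    using density_surface_measure[OF \<mu> X \<open>closed M\<close>] by (simp add: ennreal_indicator)
  also have "integral\<^sup>L (chart_measure U X) f = (LINT x:U \<inter> half_plane|lborel. area_density X x * f (X x))"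
    by (rule integral_chart_measure[OF X'(2,1) f(1)])
  finally show ?thesis .
qed

lemma piece_area_eq_emeasure:
  assumes \<mu>: "surface_measure M \<mu>" and P: "param_piece M (X, K)"
  shows "piece_area (X, K) = emeasure \<mu> (X ` K)" "X ` K \<in> sets borel" "X ` K \<subseteq> M"
proof -
  obtain U where X: "local_param M U X" and K: "K \<subseteq> U \<inter> half_plane" "compact K"
    using P by (auto simp: param_piece_def)
  note X' = local_paramD[OF X]
  have "compact (X ` K)"
    using K by (intro compact_continuous_image continuous_on_subset[OF X'(6)]) auto
  then show b: "X ` K \<in> sets borel" by (simp add: borel_compact)
  show "X ` K \<subseteq> M" using K X'(7) by blast
  have "{x \<in> U \<inter> half_plane. X x \<in> X ` K} = K"
    using X'(5) K by (auto simp: inj_on_def)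
  then show "piece_area (X, K) = emeasure \<mu> (X ` K)"
    using surface_measureD(5)[OF \<mu> X b] K emeasure_chart_measure[OF X'(2,1) b]
    by (auto simp: piece_area_def sqrt_det_first_form area_density_def image_mono)
qed

text \<open>Disjoint pieces have measures that add up to at most the total mass. This is the
  direction that an upper bound for the area of \<open>M\<close> calls for.\<close>

lemma surface_area_le_emeasure:
  assumes \<mu>: "surface_measure M \<mu>"
  shows "surface_area M \<le> emeasure \<mu> UNIV"
  unfolding surface_area_def
proof (intro SUP_least)
  fix F assume "F \<in> {F. finite F \<and> (\<forall>P\<in>F. param_piece M P) \<and> disjoint_family_on (\<lambda>(X, K). X ` K) F}"
  then have F: "finite F" "\<And>P. P \<in> F \<Longrightarrow> param_piece M P" "disjoint_family_on (\<lambda>(X, K). X ` K) F"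
    by auto
  have "(\<Sum>P\<in>F. piece_area P) = (\<Sum>P\<in>F. emeasure \<mu> ((\<lambda>(X, K). X ` K) P))"
    using piece_area_eq_emeasure[OF \<mu>] F(2) by (intro sum.cong) auto
  also have "\<dots> = emeasure \<mu> (\<Union>P\<in>F. (\<lambda>(X, K). X ` K) P)"
    using piece_area_eq_emeasure(2)[OF \<mu>] F surface_measureD(1)[OF \<mu>] by (intro sum_emeasure) auto
  also have "\<dots> \<le> emeasure \<mu> UNIV"
    using surface_measureD(1)[OF \<mu>] by (intro emeasure_mono) auto
  finally show "(\<Sum>P\<in>F. piece_area P) \<le> emeasure \<mu> UNIV" .
qed

section \<open>Projection of a surface to a plane\<close>

text \<open>Some \<open>a \<times> axis i 1\<close> is nonzero; normalising it gives
  \<open>e1\<close>, and \<open>e2\<close> is \<open>a \<times> e1\<close>. The expansion of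
  \<open>p\<close> is Cramer's rule in this frame.\<close>

lemma orthonormal_cross_frame:
  fixes a :: "real^3"
  assumes "norm a = 1"
  obtains e1 e2 where "norm e1 = 1" "norm e2 = 1" "e1 \<bullet> e2 = 0" "e1 \<bullet> a = 0" "e2 \<bullet> a = 0"
    "e1 \<times> e2 = a" "\<And>p. p = (p \<bullet> e1) *\<^sub>R e1 + (p \<bullet> e2) *\<^sub>R e2 + (p \<bullet> a) *\<^sub>R a"
proof -
  have aa: "a \<bullet> a = 1" using assms by (simp add: dot_square_norm)
  obtain i where i: "a \<times> axis i 1 \<noteq> 0"
  proof (rule ccontr)
    assume "\<not> thesis"
    then have z: "a \<times> axis i 1 = 0" for i using that by blast
    have "a = 0" using z[of 1] z[of 2] z[of 3]
      by (simp add: cross3_def axis_def vec_eq_iff forall_3)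
    then show False using assms by simp
  qed
  define e1 where "e1 = (1 / norm (a \<times> axis i 1)) *\<^sub>R (a \<times> axis i 1)"
  define e2 where "e2 = a \<times> e1"
  have e1: "norm e1 = 1" "e1 \<bullet> a = 0" using i by (auto simp: e1_def dot_cross_self)
  have e11: "e1 \<bullet> e1 = 1" using e1 by (simp add: dot_square_norm)
  have "(norm e2)\<^sup>2 = 1" using norm_cross_dot[of a e1] e1 assms by (simp add: e2_def inner_commute)
  then have e2: "norm e2 = 1" by (simp add: power2_eq_1_iff) (metis norm_ge_zero not_one_le_zero neg_0_le_iff_le order_trans)
  have o: "e1 \<bullet> e2 = 0" "e2 \<bullet> a = 0" by (auto simp: e2_def dot_cross_self)
  have "e1 \<times> e2 = (e1 \<bullet> e1) *\<^sub>R a - (e1 \<bullet> a) *\<^sub>R e1"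
    unfolding e2_def by (simp add: cross3_simps forall_3)
  then have c: "e1 \<times> e2 = a" using e11 e1 by simp
  have "e2 \<times> a = (a \<bullet> a) *\<^sub>R e1 - (e1 \<bullet> a) *\<^sub>R a"
    unfolding e2_def by (simp add: cross3_simps forall_3)
  then have c2: "e2 \<times> a = e1" using aa e1 by simp
  have "p = (p \<bullet> e1) *\<^sub>R e1 + (p \<bullet> e2) *\<^sub>R e2 + (p \<bullet> a) *\<^sub>R a" for p
    using cramer_cross3[of e2 a p e1] unfolding c c2 e2_def[symmetric] by (simp add: aa inner_commute)
  with that e1 e2 o c show thesis by blast
qed

text \<open>For orthonormal \<open>e1\<close>, \<open>e2\<close> these are the coordinates of the
  projection along \<open>e1 \<times> e2\<close>. Taking values in \<open>real^2\<close> lets charts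
  compose with it to maps of the plane, whose images \<open>lborel\<close> measures.\<close>

definition proj2 :: "real^3 \<Rightarrow> real^3 \<Rightarrow> real^3 \<Rightarrow> real^2" where
  "proj2 e1 e2 p = vector [p \<bullet> e1, p \<bullet> e2]"

lemma bounded_linear_proj2: "bounded_linear (proj2 e1 e2)"
proof -
  have "linear (proj2 e1 e2)"
    by (rule linearI) (simp_all add: proj2_def vec_eq_iff forall_2 inner_add_left)
  then show ?thesis by (simp add: linear_conv_bounded_linear)
qed

lemma continuous_on_proj2: "continuous_on S (proj2 e1 e2)"
  by (intro linear_continuous_on bounded_linear_proj2)

lemma binet_cauchy_cross3:
  fixes u v w z :: "real^3"
  shows "(u \<times> v) \<bullet> (w \<times> z) = (u \<bullet> w) * (v \<bullet> z) - (u \<bullet> z) * (v \<bullet> w)"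
  by (simp add: cross3_simps)

text \<open>By the Binet-Cauchy identity the Jacobian of the chart followed by the projection is the
  inner product of the two cross products. It vanishes where the tangent plane contains
  \<open>e1 \<times> e2\<close>, which change of variables for injective maps tolerates.\<close>

lemma emeasure_proj2_chart:
  assumes X: "local_param M U X" and S: "S \<in> sets borel" "S \<subseteq> U \<inter> half_plane"
    and inj: "inj_on (\<lambda>x. proj2 e1 e2 (X x)) S" and T: "(\<lambda>x. proj2 e1 e2 (X x)) ` S \<in> sets borel"
  shows "(\<integral>\<^sup>+x\<in>S. \<bar>(partial 1 X x \<times> partial 2 X x) \<bullet> (e1 \<times> e2)\<bar> \<partial>lborel) =
    emeasure lborel ((\<lambda>x. proj2 e1 e2 (X x)) ` S)"
proof -
  note X' = local_paramD[OF X]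
  define g' where "g' = (\<lambda>x v. proj2 e1 e2 (frechet_derivative X (at x) v))"
  have der: "((\<lambda>x. proj2 e1 e2 (X x)) has_derivative g' x) (at x within S)" if "x \<in> S" for x
    unfolding g'_def using that S(2)
    by (intro bounded_linear.has_derivative[OF bounded_linear_proj2
          has_derivative_at_withinI[OF smooth_on_has_derivative[OF X'(2,1)]]]) auto
  have det: "det (matrix (g' x)) = (partial 1 X x \<times> partial 2 X x) \<bullet> (e1 \<times> e2)" for x
    by (simp add: binet_cauchy_cross3 det_2 matrix_def g'_def proj2_def partial_def mult.commute)
  have m: "set_borel_measurable borel S (\<lambda>x. \<bar>det (matrix (g' x))\<bar> * 1)"
    unfolding set_borel_measurable_def det
    by (intro borel_measurable_continuous_on_indicator S continuous_intros continuous_on_cross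
        continuous_on_subset[OF smooth_on_continuous_on[OF smooth_on_partial[OF X'(2)]]])
      (use S in auto)
  have "(\<integral>\<^sup>+x\<in>S. (\<bar>det (matrix (g' x))\<bar> * 1) \<partial>lborel) =
      (\<integral>\<^sup>+y\<in>(\<lambda>x. proj2 e1 e2 (X x)) ` S. ennreal 1 \<partial>lborel)"
    by (rule nn_integral_change_of_variables[OF S(1) T der inj _ _ m])
      (use T in \<open>auto simp: set_borel_measurable_def\<close>)
  then show ?thesis using T by (simp add: det)
qed

text \<open>In Cramer's rule for \<open>u\<close>, \<open>v\<close>, \<open>u \<times> v\<close>
  only the component of \<open>n\<close> along \<open>u \<times> v\<close> survives. Multiplying by
  the squared norm instead of dividing covers the case \<open>u \<times> v = 0\<close>.\<close>

lemma unit_normal_cross3: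
  fixes u v n :: "real^3"
  assumes "norm n = 1" "n \<bullet> u = 0" "n \<bullet> v = 0"
  shows "(norm (u \<times> v))\<^sup>2 *\<^sub>R n = ((u \<times> v) \<bullet> n) *\<^sub>R (u \<times> v)"
    "\<bar>(u \<times> v) \<bullet> n\<bar> = norm (u \<times> v)"
proof -
  let ?w = "u \<times> v"
  have 1: "(v \<times> ?w) \<bullet> n = (v \<bullet> v) * (u \<bullet> n) - (u \<bullet> v) * (v \<bullet> n)"
    "(?w \<times> u) \<bullet> n = (u \<bullet> u) * (v \<bullet> n) - (u \<bullet> v) * (u \<bullet> n)"
    by (simp_all add: cross3_simps)
  then have "(v \<times> ?w) \<bullet> n = 0" "(?w \<times> u) \<bullet> n = 0" using assms by (simp_all add: inner_commute)
  then show *: "(norm ?w)\<^sup>2 *\<^sub>R n = (?w \<bullet> n) *\<^sub>R ?w"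
    using cramer_cross3[of v ?w n u] by (simp add: dot_square_norm)
  have "(norm ?w)\<^sup>2 = \<bar>?w \<bullet> n\<bar> * norm ?w" using arg_cong[OF *, of norm] assms by simp
  then show "\<bar>?w \<bullet> n\<bar> = norm ?w" by (cases "?w = 0") (auto simp: power2_eq_square)
qed

text \<open>With \<open>v\<close> the direction of projection, this matches the Jacobian of the
  projected chart with the area density times the absolute normal component. The absolute value
  removes the dependence on the orientation of the chart.\<close>

lemma unit_normal_inner_density:
  assumes "norm n = 1" "\<And>i. n \<bullet> partial i X x = 0"
  shows "area_density X x * \<bar>n \<bullet> v\<bar> = \<bar>(partial 1 X x \<times> partial 2 X x) \<bullet> v\<bar>"
proof -
  let ?w = "partial 1 X x \<times> partial 2 X x"
  note u = unit_normal_cross3[OF assms(1) assms(2)[of 1] assms(2)[of 2]]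
  have "\<bar>(norm ?w)\<^sup>2 * (n \<bullet> v)\<bar> = norm ?w * \<bar>?w \<bullet> v\<bar>"
    using arg_cong[OF u(1), of "\<lambda>z. \<bar>z \<bullet> v\<bar>"] u(2) by (simp add: abs_mult)
  then have "norm ?w * (norm ?w * \<bar>n \<bullet> v\<bar>) = norm ?w * \<bar>?w \<bullet> v\<bar>"
    by (simp add: abs_mult power2_eq_square)
  then show ?thesis by (cases "?w = 0") (auto simp: area_density_def)
qed

lemma nn_integral_surface_measure_chart:
  fixes f :: "real^3 \<Rightarrow> ennreal"
  assumes \<mu>: "surface_measure M \<mu>" and X: "local_param M U X" and "closed M"
    and f: "f \<in> borel_measurable borel" "\<And>p. p \<notin> X ` (U \<inter> half_plane) \<Longrightarrow> f p = 0"
  shows "integral\<^sup>N \<mu> f = (\<integral>\<^sup>+x\<in>U \<inter> half_plane. (area_density X x * f (X x)) \<partial>lborel)"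
proof -
  note m = surface_measureD[OF \<mu>] and X' = local_paramD[OF X]
  let ?E = "X ` (U \<inter> half_plane)"
  have E: "?E \<in> sets borel" by (rule chart_image_borel[OF X \<open>closed M\<close>])
  have "integral\<^sup>N \<mu> f = (\<integral>\<^sup>+p. indicator ?E p * f p \<partial>\<mu>)"
    by (intro nn_integral_cong) (use f(2) in \<open>auto simp: indicator_def\<close>)
  also have "\<dots> = integral\<^sup>N (density \<mu> (indicator ?E)) f"
    by (rule nn_integral_density[symmetric]) (use f(1) E m(1) in \<open>simp_all cong: measurable_cong_sets\<close>)
  finally show ?thesis
    using nn_integral_chart_measure[OF X'(2,1) f(1)] density_surface_measure[OF \<mu> X \<open>closed M\<close>] by simp
qed

lemma gauss_mapD:
  assumes "gauss_map M N"
  shows "continuous_on M N" "\<And>p. p \<in> M \<Longrightarrow> norm (N p) = 1"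
    "\<And>U X x i. local_param M U X \<Longrightarrow> x \<in> U \<inter> half_plane \<Longrightarrow> N (X x) \<bullet> partial i X x = 0"
  using assms by (auto simp: gauss_map_def)

text \<open>On a piece inside one chart both sides are the same parameter integral of the Jacobian.
  Injectivity of the projection on \<open>M\<close> keeps the images of the pieces disjoint, so the
  measures of the images add up.\<close>

lemma nn_integral_normal_component:
  assumes M: "compact M" "smooth_surface M" and \<mu>: "surface_measure M \<mu>" and N: "gauss_map M N"
    and inj: "inj_on (proj2 e1 e2) M"
  shows "(\<integral>\<^sup>+p\<in>M. \<bar>N p \<bullet> (e1 \<times> e2)\<bar> \<partial>\<mu>) = emeasure lborel (proj2 e1 e2 ` M)"
proof -
  obtain n :: nat and U X F where c: "\<And>i. i < n \<Longrightarrow> local_param M (U i) (X i)"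
    and Fb: "\<And>i. i < n \<Longrightarrow> F i \<in> sets borel"
    and FX: "\<And>i. i < n \<Longrightarrow> F i \<subseteq> X i ` (U i \<inter> half_plane)" and disj: "disjoint_family_on F {..<n}"
    and FM: "(\<Union>i<n. F i) = M"
    using compact_surface_chart_partition[OF M] by metis
  note m = surface_measureD[OF \<mu>] and N' = gauss_mapD[OF N]
  let ?\<pi> = "proj2 e1 e2"
  have cl: "closed M" by (simp add: M compact_imp_closed)
  have g: "(\<lambda>p. ennreal \<bar>N p \<bullet> (e1 \<times> e2)\<bar> * indicator B p) \<in> borel_measurable borel"
    if "B \<in> sets borel" "B \<subseteq> M" for B
    by (intro ennreal_indicator_measurable that continuous_intros continuous_on_subset[OF N'(1)])
  obtain \<psi> where \<psi>: "homeomorphism M (?\<pi> ` M) ?\<pi> \<psi>"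
    using homeomorphism_compact[OF M(1) continuous_on_proj2 refl inj] by blast
  \<comment> \<open>On the compact \<open>M\<close> the injective projection is a homeomorphism onto
    its image, so the image of a Borel set is a preimage under the continuous inverse
    \<psi>.\<close>
  have im: "?\<pi> ` B \<in> sets borel" if B: "B \<in> sets borel" "B \<subseteq> M" for B
  proof -
    have cM: "compact (?\<pi> ` M)" by (intro compact_continuous_image continuous_on_proj2 M)
    have "(\<lambda>y. indicator (?\<pi> ` M) y *\<^sub>R \<psi> y) \<in> borel_measurable borel"
      by (intro borel_measurable_continuous_on_indicator)
        (use \<psi> cM in \<open>auto simp: homeomorphism_def borel_compact\<close>)
    from measurable_sets[OF this B(1)]
    have "(\<lambda>y. indicator (?\<pi> ` M) y *\<^sub>R \<psi> y) -` B \<inter> ?\<pi> ` M \<in> sets borel"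
      using cM by (auto simp: borel_compact)
    moreover have "(\<lambda>y. indicator (?\<pi> ` M) y *\<^sub>R \<psi> y) -` B \<inter> ?\<pi> ` M = ?\<pi> ` B"
      using \<psi> B(2) by (force simp: homeomorphism_def)
    ultimately show ?thesis by simp
  qed
  have FM': "F i \<subseteq> M" if "i < n" for i using FM that by blast
  have loc: "(\<integral>\<^sup>+p\<in>F i. \<bar>N p \<bullet> (e1 \<times> e2)\<bar> \<partial>\<mu>) = emeasure lborel (?\<pi> ` F i)" if i: "i < n" for i
  proof -
    note Xi = c[OF i] and X' = local_paramD[OF c[OF i]]
    define S where "S = {x \<in> U i \<inter> half_plane. X i x \<in> F i}"
    have S: "S \<in> sets borel" "S \<subseteq> U i \<inter> half_plane" unfolding S_def
      using chart_preimage_borel[OF X'(2,1) Fb[OF i]] by auto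
    have XS: "X i ` S = F i" using FX[OF i] by (auto simp: S_def)
    have piS: "(\<lambda>x. ?\<pi> (X i x)) ` S = ?\<pi> ` F i" unfolding XS[symmetric] by auto
    have injS: "inj_on (\<lambda>x. ?\<pi> (X i x)) S"
    proof (rule inj_onI)
      fix x y assume xy: "x \<in> S" "y \<in> S" "?\<pi> (X i x) = ?\<pi> (X i y)"
      then have "X i x = X i y" using inj FM'[OF i] by (auto simp: S_def inj_on_def)
      then show "x = y" using xy X'(5) S(2) by (auto simp: inj_on_def)
    qed
    have "(\<integral>\<^sup>+p\<in>F i. \<bar>N p \<bullet> (e1 \<times> e2)\<bar> \<partial>\<mu>) =
       (\<integral>\<^sup>+x\<in>U i \<inter> half_plane. (area_density (X i) x *
          (ennreal \<bar>N (X i x) \<bullet> (e1 \<times> e2)\<bar> * indicator (F i) (X i x))) \<partial>lborel)"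
      by (rule nn_integral_surface_measure_chart[OF \<mu> Xi cl g])
        (use Fb[OF i] FM'[OF i] FX[OF i] in \<open>auto simp: indicator_def\<close>)
    also have "\<dots> = (\<integral>\<^sup>+x\<in>S. \<bar>(partial 1 (X i) x \<times> partial 2 (X i) x) \<bullet> (e1 \<times> e2)\<bar> \<partial>lborel)"
    proof (intro nn_integral_cong)
      fix x
      show "ennreal (area_density (X i) x) * (ennreal \<bar>N (X i x) \<bullet> (e1 \<times> e2)\<bar> *
            indicator (F i) (X i x)) * indicator (U i \<inter> half_plane) x =
          ennreal \<bar>(partial 1 (X i) x \<times> partial 2 (X i) x) \<bullet> (e1 \<times> e2)\<bar> * indicator S x"
      proof (cases "x \<in> S")
        case True
        then have x: "x \<in> U i \<inter> half_plane" "X i x \<in> F i" by (auto simp: S_def)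
        have "area_density (X i) x * \<bar>N (X i x) \<bullet> (e1 \<times> e2)\<bar> =
            \<bar>(partial 1 (X i) x \<times> partial 2 (X i) x) \<bullet> (e1 \<times> e2)\<bar>"
          by (rule unit_normal_inner_density)
            (use N'(2)[of "X i x"] N'(3)[OF Xi x(1)] x(2) FM'[OF i] in auto)
        then show ?thesis using x True by (simp add: ennreal_mult'[symmetric])
      qed (auto simp: S_def indicator_def)
    qed
    also have "\<dots> = emeasure lborel ((\<lambda>x. ?\<pi> (X i x)) ` S)"
      by (rule emeasure_proj2_chart[OF Xi S injS]) (simp only: piS im Fb[OF i] FM'[OF i])
    finally show ?thesis by (simp only: piS)
  qed
  have "(\<integral>\<^sup>+p\<in>M. \<bar>N p \<bullet> (e1 \<times> e2)\<bar> \<partial>\<mu>) = (\<integral>\<^sup>+p. (\<Sum>i<n. ennreal \<bar>N p \<bullet> (e1 \<times> e2)\<bar> * indicator (F i) p) \<partial>\<mu>)"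
  proof (intro nn_integral_cong)
    fix p
    have "(indicator M p :: ennreal) = (\<Sum>i<n. indicator (F i) p)"
      unfolding FM[symmetric] by (rule indicator_UN_disjoint) (use disj in auto)
    then show "ennreal \<bar>N p \<bullet> (e1 \<times> e2)\<bar> * indicator M p = (\<Sum>i<n. ennreal \<bar>N p \<bullet> (e1 \<times> e2)\<bar> * indicator (F i) p)"
      by (simp only: sum_distrib_left)
  qed
  also have "\<dots> = (\<Sum>i<n. \<integral>\<^sup>+p\<in>F i. \<bar>N p \<bullet> (e1 \<times> e2)\<bar> \<partial>\<mu>)"
    by (rule nn_integral_sum) (use g Fb FM' m(1) in \<open>simp cong: measurable_cong_sets\<close>)
  also have "\<dots> = (\<Sum>i<n. emeasure lborel (?\<pi> ` F i))" by (simp add: loc)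
  also have "\<dots> = emeasure lborel (\<Union>i<n. ?\<pi> ` F i)"
  proof (rule sum_emeasure)
    show "disjoint_family_on (\<lambda>i. ?\<pi> ` F i) {..<n}"
      unfolding disjoint_family_on_def
    proof (intro ballI impI)
      fix i j assume ij: "i \<in> {..<n}" "j \<in> {..<n}" "i \<noteq> j"
      then have "F i \<inter> F j = {}" using disj by (auto simp: disjoint_family_on_def)
      then show "?\<pi> ` F i \<inter> ?\<pi> ` F j = {}"
        using inj_on_image_Int[OF inj, of "F i" "F j"] FM' ij by auto
    qed
  qed (use im Fb FM' in auto)
  also have "(\<Union>i<n. ?\<pi> ` F i) = ?\<pi> ` M" unfolding FM[symmetric] by blast
  finally show ?thesis .
qed

section \<open>Areas of planar surfaces\<close>

lemma planar_partial_orthogonal: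
  assumes X: "local_param W U X" and W: "W \<subseteq> {p. p \<bullet> a = c}" and x: "x \<in> U \<inter> half_plane"
  shows "partial i X x \<bullet> a = 0"
proof -
  note X' = local_paramD[OF X]
  have "(X has_derivative frechet_derivative X (at x)) (at x within U \<inter> half_plane)"
    by (rule has_derivative_at_withinI[OF smooth_on_has_derivative[OF X'(2,1)]]) (use x in simp)
  then have "((\<lambda>x. X x \<bullet> a) has_derivative (\<lambda>v. frechet_derivative X (at x) v \<bullet> a)) (at x within U \<inter> half_plane)"
    by (rule has_derivative_inner_left)
  moreover have "((\<lambda>x. X x \<bullet> a) has_derivative (\<lambda>v. 0)) (at x within U \<inter> half_plane)"
    by (rule has_derivative_transform[OF x, where f="\<lambda>_. c"]) (use X'(7) W in auto)
  ultimately have "(\<lambda>v. frechet_derivative X (at x) v \<bullet> a) = (\<lambda>v. 0)"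
    by (rule frechet_derivative_unique_within) (use half_plane_axis_approach[OF X'(1) x] in auto)
  then show ?thesis by (metis partial_def)
qed

lemma proj2_inj_on_plane:
  assumes fr: "\<And>p. p = (p \<bullet> e1) *\<^sub>R e1 + (p \<bullet> e2) *\<^sub>R e2 + (p \<bullet> a) *\<^sub>R a"
  shows "inj_on (proj2 e1 e2) {p. p \<bullet> a = c}"
proof (rule inj_onI)
  fix p q assume pq: "p \<in> {p. p \<bullet> a = c}" "q \<in> {p. p \<bullet> a = c}" "proj2 e1 e2 p = proj2 e1 e2 q"
  then have "p \<bullet> e1 = q \<bullet> e1" "p \<bullet> e2 = q \<bullet> e2" by (auto simp: proj2_def vec_eq_iff forall_2)
  then show "p = q" using fr[of p] fr[of q] pq by simp
qed

text \<open>All tangent planes are parallel to the plane containing \<open>D\<close>, so the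
  projection has Jacobian 1 and every piece keeps its area. Disjoint pieces project to disjoint
  compact subsets of the projection of \<open>D\<close>.\<close>

lemma planar_surface_area_le:
  assumes a: "norm a = 1" and c: "e1 \<times> e2 = a"
    and fr: "\<And>p. p = (p \<bullet> e1) *\<^sub>R e1 + (p \<bullet> e2) *\<^sub>R e2 + (p \<bullet> a) *\<^sub>R a"
    and W: "W \<subseteq> D" "D \<subseteq> {p. p \<bullet> a = c}" "compact D"
  shows "surface_area W \<le> emeasure lborel (proj2 e1 e2 ` D)"
  unfolding surface_area_def
proof (intro SUP_least)
  let ?\<pi> = "proj2 e1 e2"
  note injP = proj2_inj_on_plane[OF fr, of c]
  fix F assume "F \<in> {F. finite F \<and> (\<forall>P\<in>F. param_piece W P) \<and> disjoint_family_on (\<lambda>(X, K). X ` K) F}"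
  then have F: "finite F" "\<And>P. P \<in> F \<Longrightarrow> param_piece W P" "disjoint_family_on (\<lambda>(X, K). X ` K) F"
    by auto
  have piece: "piece_area (X, K) = emeasure lborel (?\<pi> ` X ` K) \<and> compact (?\<pi> ` X ` K) \<and> X ` K \<subseteq> W"
    if P: "param_piece W (X, K)" for X K
  proof -
    obtain U where X: "local_param W U X" and K: "K \<subseteq> U \<inter> half_plane" "compact K"
      using P by (auto simp: param_piece_def)
    note X' = local_paramD[OF X]
    have XW: "X ` K \<subseteq> W" using K X'(7) by blast
    have comp: "compact (?\<pi> ` X ` K)"
      using K by (intro compact_continuous_image continuous_on_proj2 continuous_on_subset[OF X'(6)]) auto
    have inj: "inj_on (\<lambda>x. ?\<pi> (X x)) K"
    proof (rule inj_onI)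
      fix x y assume xy: "x \<in> K" "y \<in> K" "?\<pi> (X x) = ?\<pi> (X y)"
      then have "X x \<in> {p. p \<bullet> a = c}" "X y \<in> {p. p \<bullet> a = c}" using XW W by blast+
      then have "X x = X y" using inj_onD[OF injP xy(3)] by blast
      then show "x = y" using X'(5) K xy by (auto simp: inj_on_def)
    qed
    have "(\<integral>\<^sup>+x\<in>K. \<bar>(partial 1 X x \<times> partial 2 X x) \<bullet> (e1 \<times> e2)\<bar> \<partial>lborel) =
      emeasure lborel ((\<lambda>x. ?\<pi> (X x)) ` K)"
      by (rule emeasure_proj2_chart[OF X _ K(1) inj])
        (use K comp in \<open>auto simp: borel_compact image_image\<close>)
    moreover have "(\<integral>\<^sup>+x\<in>K. \<bar>(partial 1 X x \<times> partial 2 X x) \<bullet> (e1 \<times> e2)\<bar> \<partial>lborel) = piece_area (X, K)"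
      unfolding piece_area_def prod.case
    proof (intro nn_integral_cong)
      fix x
      show "ennreal \<bar>(partial 1 X x \<times> partial 2 X x) \<bullet> (e1 \<times> e2)\<bar> * indicator K x =
          ennreal (sqrt (det (first_form X x))) * indicator K x"
      proof (cases "x \<in> K")
        case True
        then have "a \<bullet> partial i X x = 0" for i
          using planar_partial_orthogonal[OF X _, of a c x i] K W by (auto simp: inner_commute)
        from unit_normal_inner_density[OF a this, of a]
        show ?thesis using a
          by (simp add: c sqrt_det_first_form area_density_def dot_square_norm)
      qed simp
    qed
    ultimately show ?thesis using comp XW by (simp add: image_image)
  qed
  have pb: "?\<pi> ` (case P of (X, K) \<Rightarrow> X ` K) \<in> sets borel" if "P \<in> F" for P
    using piece F(2)[OF that] by (cases P) (auto simp: borel_compact)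
  have sub: "(case P of (X, K) \<Rightarrow> X ` K) \<subseteq> D" if "P \<in> F" for P
    using piece F(2)[OF that] W(1) by (cases P) auto
  have "(\<Sum>P\<in>F. piece_area P) = (\<Sum>P\<in>F. emeasure lborel (?\<pi> ` (case P of (X, K) \<Rightarrow> X ` K)))"
    using piece F(2) by (intro sum.cong) auto
  also have "\<dots> = emeasure lborel (\<Union>P\<in>F. ?\<pi> ` (case P of (X, K) \<Rightarrow> X ` K))"
  proof (rule sum_emeasure)
    show "disjoint_family_on (\<lambda>P. ?\<pi> ` (case P of (X, K) \<Rightarrow> X ` K)) F"
      unfolding disjoint_family_on_def
    proof (intro ballI impI)
      fix P Q assume PQ: "P \<in> F" "Q \<in> F" "P \<noteq> Q"
      let ?f = "\<lambda>P. (case P of (X, K) \<Rightarrow> X ` K) :: (real^3) set"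
      have "?f P \<inter> ?f Q = {}" using disjoint_family_onD[OF F(3) PQ] by simp
      moreover have "inj_on ?\<pi> D" by (rule inj_on_subset[OF injP W(2)])
      ultimately show "?\<pi> ` ?f P \<inter> ?\<pi> ` ?f Q = {}"
        using inj_on_image_Int[of ?\<pi> D "?f P" "?f Q"] sub PQ by (metis image_empty)
    qed
  qed (use pb F in auto)
  also have "\<dots> \<le> emeasure lborel (?\<pi> ` D)"
  proof (rule emeasure_mono)
    show "(\<Union>P\<in>F. ?\<pi> ` (case P of (X, K) \<Rightarrow> X ` K)) \<subseteq> ?\<pi> ` D" using sub by blast
    have "compact (?\<pi> ` D)" by (intro compact_continuous_image continuous_on_proj2 W)
    then show "?\<pi> ` D \<in> sets lborel" by (simp add: borel_compact)
  qed
  finally show "(\<Sum>P\<in>F. piece_area P) \<le> emeasure lborel (?\<pi> ` D)" .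
qed

section \<open>An open planar set as a single affine chart\<close>

lemma Ck_on_const: "Ck_on k (\<lambda>_. c) S"
  by (induction k arbitrary: c) (auto simp: frechet_derivative_const)

lemma has_derivative_affine:
  assumes "bounded_linear L"
  shows "((\<lambda>x. c + L x) has_derivative L) (at x within S)"
  using has_derivative_add[OF has_derivative_const bounded_linear_imp_has_derivative[OF assms]] by simp

lemma smooth_on_affine:
  assumes "bounded_linear L"
  shows "smooth_on (\<lambda>x. c + L x) S"
proof -
  note d = has_derivative_affine[OF assms, of c]
  have fd: "frechet_derivative (\<lambda>x. c + L x) (at x) = L" for x
    using frechet_derivative_at[OF d, of x] by simp
  have "Ck_on k (\<lambda>x. c + L x) S" for k
  proof (cases k)
    case 0
    have "continuous_on S (\<lambda>x. c + L x)"
      using assms by (intro continuous_intros linear_continuous_on)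
    then show ?thesis by (simp add: 0)
  next
    case (Suc j)
    then show ?thesis using d by (auto simp: fd Ck_on_const differentiable_on_def differentiable_def)
  qed
  then show ?thesis by (simp add: smooth_on_def)
qed

lemma emeasure_lborel_translation:
  fixes t :: "'a::euclidean_space"
  assumes "S \<in> sets borel"
  shows "emeasure lborel ((+) t ` S) = emeasure lborel S"
proof -
  have inv: "(+) t ` S = (+) (- t) -` S"
  proof (intro equalityI subsetI)
    fix x assume "x \<in> (+) (- t) -` S"
    then have "x = t + (- t + x)" "- t + x \<in> S" by simp_all
    then show "x \<in> (+) t ` S" by (rule image_eqI)
  qed auto
  have "(+) (- t) -` S \<inter> space lborel \<in> sets lborel"
    by (rule measurable_sets[OF _ assms]) simp
  then have "emeasure lborel S = emeasure (distr lborel borel ((+) (- t))) S"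
    by (simp add: lborel_distr_plus)
  also have "\<dots> = emeasure lborel ((+) (- t) -` S \<inter> space lborel)"
    by (rule emeasure_distr) (use assms in simp_all)
  finally show ?thesis by (simp add: inv)
qed

text \<open>The projection of \<open>O'\<close>, shifted into the upper half-plane, is the parameter
  domain of one affine isometric chart. Pieces must be compact, so the open domain is exhausted by
  compact sets and each of them alone is an admissible family.\<close>

lemma planar_surface_area_ge:
  assumes e: "norm e1 = 1" "norm e2 = 1" "e1 \<bullet> e2 = 0" "e1 \<bullet> a = 0" "e2 \<bullet> a = 0" "norm a = 1"
    and c: "e1 \<times> e2 = a"
    and fr: "\<And>p. p = (p \<bullet> e1) *\<^sub>R e1 + (p \<bullet> e2) *\<^sub>R e2 + (p \<bullet> a) *\<^sub>R a"
    and W: "O' \<subseteq> W" "W \<subseteq> {p. p \<bullet> a = c}"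
    and B: "open (proj2 e1 e2 ` O')" "bounded (proj2 e1 e2 ` O')"
  shows "emeasure lborel (proj2 e1 e2 ` O') \<le> surface_area W"
proof -
  let ?\<pi> = "proj2 e1 e2"
  let ?B = "?\<pi> ` O'"
  obtain s where s: "s > 0" "\<And>y. y \<in> ?B \<Longrightarrow> norm y < s"
    using B(2) unfolding bounded_pos_less by blast
  \<comment> \<open>Shifting up by a bound on the norm puts the whole parameter domain above the
    edge, so that intersecting with the half-plane removes nothing. The constant \<open>d\<close>
    below undoes the shift in the chart and sets the height \<open>c\<close>.\<close>
  define t :: "real^2" where "t = vector [0, s]"
  define L where "L = (\<lambda>x::real^2. x$1 *\<^sub>R e1 + x$2 *\<^sub>R e2)"
  define d where "d = c *\<^sub>R a - L t"
  define X where "X = (\<lambda>x. d + L x)"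
  define U where "U = (+) t ` ?B"
  have linL: "linear L" by (rule linearI) (simp_all add: L_def algebra_simps)
  then have blL: "bounded_linear L" by (simp add: linear_conv_bounded_linear)
  have Xt: "X (t + y) = c *\<^sub>R a + L y" for y
    by (simp add: X_def d_def linear_add[OF linL])
  have ee: "e1 \<bullet> e1 = 1" "e2 \<bullet> e2 = 1" "a \<bullet> a = 1" using e by (simp_all add: dot_square_norm)
  have piL: "?\<pi> (r *\<^sub>R a + L y) = y" for r y
    using ee e inner_commute[of e2 e1] inner_commute[of a e1] inner_commute[of a e2]
    by (simp add: proj2_def L_def vec_eq_iff forall_2 inner_add_left)
  have Lpi: "c *\<^sub>R a + L (?\<pi> p) = p" if "p \<bullet> a = c" for p
    using fr[of p, symmetric] that by (simp add: L_def proj2_def add.commute)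
  have openU: "open U" unfolding U_def by (rule open_translation[OF B(1)])
  have UH: "U \<inter> half_plane = U"
  proof -
    have "0 \<le> (t + y) $ 2" if "y \<in> ?B" for y
      using s(2)[OF that] component_le_norm_cart[of y 2] by (simp add: t_def)
    then show ?thesis by (auto simp: U_def half_plane_def)
  qed
  have XU: "X ` U = O'"
  proof -
    have "X ` U = (\<lambda>p. c *\<^sub>R a + L (?\<pi> p)) ` O'" by (auto simp: U_def Xt image_image)
    also have "\<dots> = (\<lambda>p. p) ` O'" using Lpi W by (intro image_cong) auto
    finally show ?thesis by simp
  qed
  have smooth: "smooth_on X U" unfolding X_def by (rule smooth_on_affine[OF blL])
  have fd: "frechet_derivative X (at x) = L" for x
  proof -
    have "(X has_derivative L) (at x)" unfolding X_def by (rule has_derivative_affine[OF blL])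
    then show ?thesis by (metis frechet_derivative_at)
  qed
  have p: "partial 1 X x = e1" "partial 2 X x = e2" for x
    by (simp_all add: partial_def fd L_def axis_def)
  have "inj L" by (rule inj_on_inverseI[where g="?\<pi>"]) (use piL[of 0] in simp)
  have lp: "local_param W U X"
    unfolding local_param_def
  proof (intro conjI ballI)
    show "openin (top_of_set W) (X ` (U \<inter> half_plane))"
    proof -
      have "X ` (U \<inter> half_plane) = W \<inter> ?\<pi> -` ?B"
      proof -
        have "p \<in> O'" if "p \<in> W" "?\<pi> p = ?\<pi> q" "q \<in> O'" for p q
          using proj2_inj_on_plane[OF fr, of c] that W by (metis inj_onD subsetD)
        then show ?thesis using W by (auto simp: UH XU)
      qed
      moreover have "open (?\<pi> -` ?B)"
        using continuous_on_proj2[of UNIV] B(1) by (intro open_vimage)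
      ultimately show ?thesis by (auto simp: openin_open)
    qed
    have "homeomorphism (U \<inter> half_plane) (X ` (U \<inter> half_plane)) X (\<lambda>p. t + ?\<pi> p)"
    proof -
      have inv: "t + ?\<pi> (X x) = x" if "x \<in> U" for x
        using that by (auto simp: U_def Xt piL)
      moreover have "continuous_on U X" by (rule smooth_on_continuous_on[OF smooth])
      moreover have "continuous_on (X ` U) (\<lambda>p. t + ?\<pi> p)"
        by (intro continuous_intros continuous_on_proj2)
      ultimately show ?thesis unfolding homeomorphism_def UH by (auto simp: image_image)
    qed
    then show "\<exists>Y. homeomorphism (U \<inter> half_plane) (X ` (U \<inter> half_plane)) X Y" by blast
  qed (use openU smooth fd \<open>inj L\<close> in auto)
  obtain C where C: "\<And>n. compact (C n)" "\<And>n::nat. C n \<subseteq> U"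
    "\<And>n. C n \<subseteq> interior (C (Suc n))" "\<Union> (range C) = U"
    by (rule open_Union_compact_subsets[OF openU]) blast
  have le: "emeasure lborel (C n) \<le> surface_area W" for n
  proof -
    have "C n \<subseteq> U \<inter> half_plane" using C(2) UH by simp
    then have "param_piece W (X, C n)" using C(1) lp unfolding param_piece_def by blast
    then have "(\<Sum>P\<in>{(X, C n)}. piece_area P) \<le> surface_area W"
      unfolding surface_area_def by (intro SUP_upper) (auto simp: disjoint_family_on_def)
    moreover have "norm a = 1" by (rule e)
    then have "piece_area (X, C n) = emeasure lborel (C n)"
      using C(1)[of n] by (simp add: piece_area_def sqrt_det_first_form p c borel_compact)
    ultimately show ?thesis by simp
  qed
  have inc: "incseq C" using C(3) interior_subset by (intro incseq_SucI) blast
  have "emeasure lborel U = (SUP n. emeasure lborel (C n))"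
    using SUP_emeasure_incseq[of C lborel] C inc by (simp add: borel_compact image_subset_iff)
  also have "\<dots> \<le> surface_area W" by (intro SUP_least le)
  finally show ?thesis unfolding U_def by (simp add: emeasure_lborel_translation B(1) borel_open)
qed

section \<open>The divergence theorem in the half-plane\<close>

lemma has_real_derivative_along_line:
  fixes f :: "'a::real_normed_vector \<Rightarrow> real"
  assumes "(f has_derivative f') (at (y + s *\<^sub>R e))"
  shows "((\<lambda>s. f (y + s *\<^sub>R e)) has_real_derivative f' e) (at s)"
proof -
  have "((\<lambda>s. y + s *\<^sub>R e) has_derivative (\<lambda>v. v *\<^sub>R e)) (at s)"
    by (auto intro!: derivative_eq_intros)
  from has_derivative_compose[OF this assms]
  have "((\<lambda>s. f (y + s *\<^sub>R e)) has_derivative (\<lambda>v. f' (v *\<^sub>R e))) (at s)" .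
  moreover have "f' (v *\<^sub>R e) = f' e * v" for v
    using linear_scale[OF has_derivative_linear[OF assms], of v e] by simp
  ultimately show ?thesis by (simp add: has_field_derivative_def)
qed

text \<open>The second difference is the increment over \<open>[0, h]\<close>, along
  \<open>e\<close>, of the first difference in direction \<open>d\<close>. One mean value theorem
  along \<open>e\<close> and another along \<open>d\<close> produce the mixed derivative at an
  intermediate point.\<close>

lemma second_difference_mvt:
  fixes f :: "'a::real_normed_vector \<Rightarrow> real"
  assumes h: "h > 0"
    and f: "\<And>s t. 0 \<le> s \<Longrightarrow> s \<le> h \<Longrightarrow> 0 \<le> t \<Longrightarrow> t \<le> h \<Longrightarrow>
      (f has_derivative f' (x + s *\<^sub>R e + t *\<^sub>R d)) (at (x + s *\<^sub>R e + t *\<^sub>R d))"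
    and g: "\<And>s t. 0 \<le> s \<Longrightarrow> s \<le> h \<Longrightarrow> 0 \<le> t \<Longrightarrow> t \<le> h \<Longrightarrow>
      ((\<lambda>y. f' y e) has_derivative g' (x + s *\<^sub>R e + t *\<^sub>R d)) (at (x + s *\<^sub>R e + t *\<^sub>R d))"
  obtains s t where "0 < s" "s < h" "0 < t" "t < h"
    "f (x + h *\<^sub>R e + h *\<^sub>R d) - f (x + h *\<^sub>R e) - f (x + h *\<^sub>R d) + f x =
      h * h * g' (x + s *\<^sub>R e + t *\<^sub>R d) d"
proof -
  define \<phi> where "\<phi> = (\<lambda>s. f ((x + h *\<^sub>R d) + s *\<^sub>R e) - f (x + s *\<^sub>R e))"
  have "(\<phi> has_real_derivative (f' ((x + h *\<^sub>R d) + s *\<^sub>R e) e - f' (x + s *\<^sub>R e) e)) (at s)"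
    if "0 \<le> s" "s \<le> h" for s
    unfolding \<phi>_def
    by (intro DERIV_diff has_real_derivative_along_line)
      (use f[of s h] f[of s 0] that h in \<open>simp_all add: algebra_simps\<close>)
  from MVT2[OF h this] obtain s where s: "0 < s" "s < h"
    "\<phi> h - \<phi> 0 = h * (f' ((x + h *\<^sub>R d) + s *\<^sub>R e) e - f' (x + s *\<^sub>R e) e)"
    by auto
  define \<psi> where "\<psi> = (\<lambda>t. f' ((x + s *\<^sub>R e) + t *\<^sub>R d) e)"
  have "(\<psi> has_real_derivative g' ((x + s *\<^sub>R e) + t *\<^sub>R d) d) (at t)" if "0 \<le> t" "t \<le> h" for t
    unfolding \<psi>_def by (rule has_real_derivative_along_line[OF g]) (use that s in auto)
  from MVT2[OF h this] obtain t where t: "0 < t" "t < h"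
    "\<psi> h - \<psi> 0 = h * g' ((x + s *\<^sub>R e) + t *\<^sub>R d) d" by auto
  have "\<phi> h - \<phi> 0 = h * (\<psi> h - \<psi> 0)" unfolding s(3) \<psi>_def by (simp add: algebra_simps)
  then have "\<phi> h - \<phi> 0 = h * h * g' (x + s *\<^sub>R e + t *\<^sub>R d) d" using t(3) by simp
  then have "f (x + h *\<^sub>R e + h *\<^sub>R d) - f (x + h *\<^sub>R e) - f (x + h *\<^sub>R d) + f x =
      h * h * g' (x + s *\<^sub>R e + t *\<^sub>R d) d" unfolding \<phi>_def by (simp add: algebra_simps)
  with s t that show thesis by blast
qed

text \<open>Swapping \<open>e\<close> and \<open>d\<close> leaves the second difference unchanged,
  so the two mixed derivatives agree at intermediate points arbitrarily close to \<open>x\<close>.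
  If they differed at \<open>x\<close>, continuity would keep each within half the gap of its value
  there, which is impossible.\<close>

lemma mixed_derivatives_eq:
  fixes f :: "'a::real_normed_vector \<Rightarrow> real"
  assumes U: "open U" "x \<in> U"
    and f: "\<And>y. y \<in> U \<Longrightarrow> (f has_derivative f' y) (at y)"
    and g: "\<And>y. y \<in> U \<Longrightarrow> ((\<lambda>y. f' y e) has_derivative g' y) (at y)"
    and h: "\<And>y. y \<in> U \<Longrightarrow> ((\<lambda>y. f' y d) has_derivative h' y) (at y)"
    and cont: "continuous_on U (\<lambda>y. g' y d)" "continuous_on U (\<lambda>y. h' y e)"
  shows "g' x d = h' x e"
proof (rule ccontr)
  assume ne: "g' x d \<noteq> h' x e"
  define \<epsilon> where "\<epsilon> = \<bar>g' x d - h' x e\<bar> / 2"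
  have \<epsilon>: "\<epsilon> > 0" using ne by (simp add: \<epsilon>_def)
  obtain r0 where r0: "r0 > 0" "ball x r0 \<subseteq> U" using U by (meson open_contains_ball)
  obtain r1 where r1: "r1 > 0" "\<And>y. y \<in> U \<Longrightarrow> dist y x < r1 \<Longrightarrow> \<bar>g' y d - g' x d\<bar> < \<epsilon>"
    using cont(1) U(2) \<epsilon> unfolding continuous_on_iff dist_real_def by blast
  obtain r2 where r2: "r2 > 0" "\<And>y. y \<in> U \<Longrightarrow> dist y x < r2 \<Longrightarrow> \<bar>h' y e - h' x e\<bar> < \<epsilon>"
    using cont(2) U(2) \<epsilon> unfolding continuous_on_iff dist_real_def by blast
  define r where "r = min r0 (min r1 r2)"
  \<comment> \<open>This size keeps the parallelogram with sides \<open>k *\<^sub>R e\<close> and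
    \<open>k *\<^sub>R d\<close> within distance \<open>r / 2\<close> of \<open>x\<close>; the
    \<open>+ 1\<close> keeps the denominator positive even if \<open>e\<close> and \<open>d\<close>
    vanish.\<close>
  define k where "k = r / (2 * (norm e + norm d + 1))"
  have r: "r > 0" using r0 r1 r2 by (simp add: r_def)
  have den: "norm e + norm d + 1 > 0" by (smt (verit) norm_ge_zero)
  have k: "k > 0" unfolding k_def using r den by simp
  have near: "dist (x + s *\<^sub>R u + t *\<^sub>R v) x < r"
    if "0 \<le> s" "s \<le> k" "0 \<le> t" "t \<le> k" "{u, v} = {e, d}" for s t u v
  proof -
    have uv: "norm u + norm v \<le> norm e + norm d + 1"
      using that(5) by (auto simp: doubleton_eq_iff)
    have "dist (x + s *\<^sub>R u + t *\<^sub>R v) x = norm (s *\<^sub>R u + t *\<^sub>R v)" by (simp add: dist_norm add.assoc)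
    also have "\<dots> \<le> s * norm u + t * norm v"
      using norm_triangle_ineq[of "s *\<^sub>R u" "t *\<^sub>R v"] that by simp
    also have "\<dots> \<le> k * norm u + k * norm v"
      using that by (intro add_mono mult_right_mono) auto
    also have "\<dots> \<le> k * (norm e + norm d + 1)"
      using mult_left_mono[OF uv, of k] k by (simp add: algebra_simps)
    also have "\<dots> = r / 2" using den unfolding k_def
      by (metis (no_types, lifting) mult.commute nonzero_mult_divide_mult_cancel_left order_less_irrefl
          times_divide_eq_left)
    finally show ?thesis using r by simp
  qed
  have inU: "x + s *\<^sub>R u + t *\<^sub>R v \<in> U"
    if "0 \<le> s" "s \<le> k" "0 \<le> t" "t \<le> k" "{u, v} = {e, d}" for s t u v
    using near[OF that] r0 by (auto simp: r_def dist_commute)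
  obtain s t where st: "0 < s" "s < k" "0 < t" "t < k"
    "f (x + k *\<^sub>R e + k *\<^sub>R d) - f (x + k *\<^sub>R e) - f (x + k *\<^sub>R d) + f x =
      k * k * g' (x + s *\<^sub>R e + t *\<^sub>R d) d"
    by (rule second_difference_mvt[of k f f' x e d g']) (use k f g inU in auto)
  obtain s' t' where st': "0 < s'" "s' < k" "0 < t'" "t' < k"
    "f (x + k *\<^sub>R d + k *\<^sub>R e) - f (x + k *\<^sub>R d) - f (x + k *\<^sub>R e) + f x =
      k * k * h' (x + s' *\<^sub>R d + t' *\<^sub>R e) e"
    by (rule second_difference_mvt[of k f f' x d e h']) (use k f h inU in \<open>auto simp: insert_commute\<close>)
  have c: "x + k *\<^sub>R d + k *\<^sub>R e = x + k *\<^sub>R e + k *\<^sub>R d" by (simp add: algebra_simps)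
  have "k * k * g' (x + s *\<^sub>R e + t *\<^sub>R d) d = k * k * h' (x + s' *\<^sub>R d + t' *\<^sub>R e) e"
    using st(5) st'(5) unfolding c by linarith
  then have eq: "g' (x + s *\<^sub>R e + t *\<^sub>R d) d = h' (x + s' *\<^sub>R d + t' *\<^sub>R e) e" using k by simp
  have "\<bar>g' (x + s *\<^sub>R e + t *\<^sub>R d) d - g' x d\<bar> < \<epsilon>"
    using near[of s t e d] inU[of s t e d] st r1(2) by (simp add: r_def)
  moreover have "\<bar>h' (x + s' *\<^sub>R d + t' *\<^sub>R e) e - h' x e\<bar> < \<epsilon>"
    using near[of s' t' d e] inU[of s' t' d e] st' r2(2) by (simp add: r_def insert_commute)
  ultimately show False using eq unfolding \<epsilon>_def by (simp add: abs_if split: if_splits)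
qed

lemma partial_commute:
  assumes X: "smooth_on X U" "open U" "x \<in> U"
  shows "partial i (partial j X) x = partial j (partial i X) x"
proof -
  have "partial i (partial j X) x \<bullet> b = partial j (partial i X) x \<bullet> b" for b
  proof -
    have c: "continuous_on U (\<lambda>y. partial k (partial l X) y \<bullet> b)" for k l
      by (intro continuous_intros smooth_on_continuous_on[OF smooth_on_partial[OF smooth_on_partial[OF X(1)]]])
    show ?thesis unfolding partial_def[of i "partial j X"] partial_def[of j "partial i X"]
    proof (rule mixed_derivatives_eq[of U x "\<lambda>y. X y \<bullet> b" "\<lambda>y v. frechet_derivative X (at y) v \<bullet> b"
        "axis j 1" "\<lambda>y v. frechet_derivative (partial j X) (at y) v \<bullet> b" "axis i 1"
        "\<lambda>y v. frechet_derivative (partial i X) (at y) v \<bullet> b"])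
      fix y assume y: "y \<in> U"
      show "((\<lambda>y. X y \<bullet> b) has_derivative (\<lambda>v. frechet_derivative X (at y) v \<bullet> b)) (at y)"
        by (rule has_derivative_inner_left[OF smooth_on_has_derivative[OF X(1,2) y]])
      show "((\<lambda>y. frechet_derivative X (at y) (axis j 1) \<bullet> b) has_derivative
          (\<lambda>v. frechet_derivative (partial j X) (at y) v \<bullet> b)) (at y)"
        using has_derivative_inner_left[OF smooth_on_has_derivative[OF smooth_on_partial[OF X(1), of j] X(2) y], of b]
        unfolding partial_def[of j X] .
      show "((\<lambda>y. frechet_derivative X (at y) (axis i 1) \<bullet> b) has_derivative
          (\<lambda>v. frechet_derivative (partial i X) (at y) v \<bullet> b)) (at y)"
        using has_derivative_inner_left[OF smooth_on_has_derivative[OF smooth_on_partial[OF X(1), of i] X(2) y], of b]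
        unfolding partial_def[of i X] .
    qed (use X c[of i j] c[of j i] in \<open>auto simp: partial_def\<close>)
  qed
  then show ?thesis by (metis inner_commute vector_eq_rdot)
qed

section \<open>Iterated integrals in the plane and the fundamental theorem on lines\<close>

lemma measurable_vec2: "(\<lambda>(x, y). vector [x, y] :: real^2) \<in> lborel \<Otimes>\<^sub>M lborel \<rightarrow>\<^sub>M borel"
proof -
  have v: "(\<lambda>(x, y). vector [x, y] :: real^2) = (\<lambda>p. fst p *\<^sub>R axis 1 1 + snd p *\<^sub>R axis 2 1)"
    by (auto simp: fun_eq_iff vec_eq_iff forall_2 axis_def)
  show ?thesis unfolding v by measurable
qed

lemma lborel_vec2: "(lborel :: (real^2) measure) = distr (lborel \<Otimes>\<^sub>M lborel) borel (\<lambda>(x, y). vector [x, y])"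
proof (rule lborel_eqI)
  note m = measurable_vec2
  fix l u :: "real^2"
  assume le: "\<And>b. b \<in> Basis \<Longrightarrow> l \<bullet> b \<le> u \<bullet> b"
  have le': "l$1 \<le> u$1" "l$2 \<le> u$2"
    using le[of "axis 1 1"] le[of "axis 2 1"] by (auto simp: axis_in_Basis_iff cart_eq_inner_axis)
  have "(\<lambda>(x, y). vector [x, y] :: real^2) -` box l u \<inter> space (lborel \<Otimes>\<^sub>M lborel) = Sigma {l$1<..<u$1} (\<lambda>_. {l$2<..<u$2})"
    by (auto simp: mem_box_cart forall_2 space_pair_measure)
  then have "emeasure (distr (lborel \<Otimes>\<^sub>M lborel) borel (\<lambda>(x, y). vector [x, y] :: real^2)) (box l u) =
      emeasure (lborel \<Otimes>\<^sub>M lborel) (Sigma {l$1<..<u$1} (\<lambda>_. {l$2<..<u$2}))"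
    by (subst emeasure_distr[OF m]) auto
  also have "\<dots> = ennreal (u$1 - l$1) * ennreal (u$2 - l$2)"
    by (subst lborel.emeasure_pair_measure_Times) (use le' in auto)
  also have "\<dots> = ennreal (\<Prod>b\<in>Basis. (u - l) \<bullet> b)"
  proof -
    have B: "(Basis :: (real^2) set) = {axis 1 1, axis 2 1}"
      by (auto simp: Basis_vec_def UNIV_2)
    have ne: "axis 1 1 \<noteq> (axis 2 1 :: real^2)" by (simp add: axis_eq_axis)
    have "(\<Prod>b\<in>Basis. (u - l) \<bullet> b) = (u - l) \<bullet> axis 1 1 * ((u - l) \<bullet> axis 2 1)"
      unfolding B using ne by (subst prod.insert) auto
    then have "(\<Prod>b\<in>Basis. (u - l) \<bullet> b) = (u$1 - l$1) * (u$2 - l$2)"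
      by (simp only: inner_axis) simp
    then show ?thesis using le' by (simp add: ennreal_mult'[symmetric])
  qed
  finally show "emeasure (distr (lborel \<Otimes>\<^sub>M lborel) borel (\<lambda>(x, y). vector [x, y] :: real^2)) (box l u) =
      ennreal (\<Prod>b\<in>Basis. (u - l) \<bullet> b)" .
qed simp

lemma
  fixes f :: "real^2 \<Rightarrow> real"
  assumes f: "integrable lborel f"
  shows integral_lborel_vec2: "integral\<^sup>L lborel f = (\<integral>x. (\<integral>y. f (vector [x, y]) \<partial>lborel) \<partial>lborel)"
    and integral_lborel_vec2': "integral\<^sup>L lborel f = (\<integral>y. (\<integral>x. f (vector [x, y]) \<partial>lborel) \<partial>lborel)"
proof -
  note m = measurable_vec2
  have fb: "f \<in> borel_measurable borel" using borel_measurable_integrable[OF f] by simp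
  have c: "(\<lambda>p. f (case p of (x, y) \<Rightarrow> vector [x, y])) = (\<lambda>(x, y). f (vector [x, y]))" by auto
  have "integrable (lborel \<Otimes>\<^sub>M lborel) (\<lambda>(x, y). f (vector [x, y]))"
    using f unfolding lborel_vec2 integrable_distr_eq[OF m fb] c .
  moreover have "integral\<^sup>L lborel f = integral\<^sup>L (lborel \<Otimes>\<^sub>M lborel) (\<lambda>(x, y). f (vector [x, y]))"
    unfolding lborel_vec2 integral_distr[OF m fb] c ..
  ultimately show "integral\<^sup>L lborel f = (\<integral>x. (\<integral>y. f (vector [x, y]) \<partial>lborel) \<partial>lborel)"
    "integral\<^sup>L lborel f = (\<integral>y. (\<integral>x. f (vector [x, y]) \<partial>lborel) \<partial>lborel)"
    using lborel_pair.integral_fst[of "\<lambda>x y. f (vector [x, y])"] lborel_pair.integral_snd[of "\<lambda>x y. f (vector [x, y])"] by simp_all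
qed

text \<open>The fundamental theorem yields a gauge integral over the interval; the assumed
  integrability identifies it with the Lebesgue integral over the line.\<close>

lemma integral_lborel_ftc:
  fixes F f :: "real \<Rightarrow> real"
  assumes "a \<le> b" "\<And>s. s \<in> {a..b} \<Longrightarrow> (F has_vector_derivative f s) (at s within {a..b})"
    and z: "\<And>s. s \<notin> {a..b} \<Longrightarrow> f s = 0" and f: "integrable lborel f"
  shows "integral\<^sup>L lborel f = F b - F a"
proof -
  have "(f has_integral (F b - F a)) {a..b}"
    by (rule fundamental_theorem_of_calculus) (use assms in auto)
  then have "(f has_integral (F b - F a)) UNIV"
    by (rule has_integral_on_superset) (use z in auto)
  moreover have "(f has_integral integral\<^sup>L lborel f) UNIV"
    by (rule has_integral_integral_lborel[OF f])
  ultimately show ?thesis using has_integral_unique by blast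
qed

text \<open>Near a point of \<open>K\<close> the extension by zero coincides with \<open>w\<close>
  inside \<open>H\<close>, because \<open>w\<close> already vanishes on
  \<open>U \<inter> H - K\<close>; near a point off the closed set \<open>K\<close> it is
  identically zero. The derivative is taken within the interval since the line may end on the edge
  of \<open>H\<close>.\<close>

lemma has_vector_derivative_cut_off_line:
  fixes w :: "'a::real_normed_vector \<Rightarrow> real"
  assumes U: "open U" "K \<subseteq> U" and K: "closed K"
    and w: "\<And>x. x \<in> U \<Longrightarrow> (w has_derivative w' x) (at x)"
    and zero: "\<And>x. x \<in> U \<inter> H - K \<Longrightarrow> w x = 0"
    and H: "\<And>s. s \<in> {a..b} \<Longrightarrow> p + s *\<^sub>R e \<in> H" and s: "s \<in> {a..b}"
  shows "((\<lambda>s. if p + s *\<^sub>R e \<in> K then w (p + s *\<^sub>R e) else 0) has_vector_derivative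
    (if p + s *\<^sub>R e \<in> K then w' (p + s *\<^sub>R e) e else 0)) (at s within {a..b})"
proof -
  have contL: "isCont (\<lambda>s. p + s *\<^sub>R e) s" by (intro continuous_intros)
  show ?thesis
  proof (cases "p + s *\<^sub>R e \<in> K")
    case True
    then have sU: "p + s *\<^sub>R e \<in> U" using U by blast
    have "eventually (\<lambda>r. p + r *\<^sub>R e \<in> U) (at s)"
      using contL U(1) sU unfolding isCont_def by (rule topological_tendstoD)
    then obtain d where d: "d > 0" "\<And>r. r \<noteq> s \<Longrightarrow> dist r s < d \<Longrightarrow> p + r *\<^sub>R e \<in> U"
      unfolding eventually_at by blast
    have "((\<lambda>s. w (p + s *\<^sub>R e)) has_vector_derivative w' (p + s *\<^sub>R e) e) (at s within {a..b})"
      using has_real_derivative_along_line[OF w[OF sU]]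
      by (auto simp: has_real_derivative_iff_has_vector_derivative intro: has_vector_derivative_at_within)
    then have "((\<lambda>s. if p + s *\<^sub>R e \<in> K then w (p + s *\<^sub>R e) else 0) has_vector_derivative
        w' (p + s *\<^sub>R e) e) (at s within {a..b})"
    proof (rule has_vector_derivative_transform_within[OF _ d(1) s])
      fix r assume r: "r \<in> {a..b}" "dist r s < d"
      then have "p + r *\<^sub>R e \<in> U" using d(2)[of r] sU by (cases "r = s") auto
      then show "w (p + r *\<^sub>R e) = (if p + r *\<^sub>R e \<in> K then w (p + r *\<^sub>R e) else 0)"
        using zero H[OF r(1)] by auto
    qed
    then show ?thesis using True by simp
  next
    case False
    have "eventually (\<lambda>r. p + r *\<^sub>R e \<in> - K) (at s)"
      using contL open_Compl[OF K] False unfolding isCont_def by (intro topological_tendstoD) auto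
    then obtain d where d: "d > 0" "\<And>r. r \<noteq> s \<Longrightarrow> dist r s < d \<Longrightarrow> p + r *\<^sub>R e \<notin> K"
      unfolding eventually_at by blast
    have "((\<lambda>s. 0::real) has_vector_derivative 0) (at s within {a..b})" by simp
    then have "((\<lambda>s. if p + s *\<^sub>R e \<in> K then w (p + s *\<^sub>R e) else 0) has_vector_derivative
        0) (at s within {a..b})"
    proof (rule has_vector_derivative_transform_within[OF _ d(1) s])
      fix r assume r: "r \<in> {a..b}" "dist r s < d"
      then have "p + r *\<^sub>R e \<notin> K" using d(2)[of r] False by (cases "r = s") auto
      then show "0 = (if p + r *\<^sub>R e \<in> K then w (p + r *\<^sub>R e) else 0)" by simp
    qed
    then show ?thesis using False by simp
  qed
qed

lemma integrable_cut_off: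
  fixes f :: "'a::euclidean_space \<Rightarrow> real"
  assumes "compact K" "continuous_on K f"
  shows "integrable lborel (\<lambda>x. if x \<in> K then f x else 0)"
proof -
  have "(\<lambda>x. if x \<in> K then f x else 0) = (\<lambda>x. indicator K x *\<^sub>R f x)"
    by (auto simp: fun_eq_iff indicator_def)
  then show ?thesis using borel_integrable_compact[OF assms] by simp
qed

lemma integrable_cut_off_line:
  fixes f :: "'a::euclidean_space \<Rightarrow> real"
  assumes K: "compact K" and f: "continuous_on K f" and e: "norm e = 1"
  shows "integrable lborel (\<lambda>s. if p + s *\<^sub>R e \<in> K then f (p + s *\<^sub>R e) else 0)"
proof -
  define S where "S = {s. p + s *\<^sub>R e \<in> K}"
  have "closed ((\<lambda>s. p + s *\<^sub>R e) -` K)"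
    by (intro closed_vimage compact_imp_closed K continuous_intros)
  moreover have "(\<lambda>s. p + s *\<^sub>R e) -` K = S" by (auto simp: S_def)
  moreover have "bounded S"
  proof (rule bounded_subset)
    show "bounded ((\<lambda>x. (x - p) \<bullet> e) ` K)"
      by (intro compact_imp_bounded compact_continuous_image K continuous_intros)
    show "S \<subseteq> (\<lambda>x. (x - p) \<bullet> e) ` K"
    proof
      fix s assume "s \<in> S"
      then show "s \<in> (\<lambda>x. (x - p) \<bullet> e) ` K"
        using e by (intro image_eqI[where x="p + s *\<^sub>R e"]) (auto simp: S_def dot_square_norm)
    qed
  qed
  ultimately have S: "compact S" by (simp add: compact_eq_bounded_closed)
  have "continuous_on S (\<lambda>s. f (p + s *\<^sub>R e))"
    by (rule continuous_on_compose2[OF f]) (auto simp: S_def intro!: continuous_intros)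
  from integrable_cut_off[OF S this] show ?thesis by (simp add: S_def)
qed

text \<open>Integrate the first term along horizontal lines and the second along vertical ones. A
  horizontal line enters and leaves \<open>K\<close>, so it contributes nothing; a vertical ray
  starts on the edge and contributes minus the value of \<open>w2\<close> there.\<close>

lemma half_plane_divergence:
  fixes w1 w2 :: "real^2 \<Rightarrow> real"
  assumes K: "compact K" "K \<subseteq> U \<inter> half_plane" and U: "open U"
    and w1: "\<And>x. x \<in> U \<Longrightarrow> (w1 has_derivative w1' x) (at x)"
    and w2: "\<And>x. x \<in> U \<Longrightarrow> (w2 has_derivative w2' x) (at x)"
    and zero: "\<And>x. x \<in> U \<inter> half_plane - K \<Longrightarrow> w1 x = 0" "\<And>x. x \<in> U \<inter> half_plane - K \<Longrightarrow> w2 x = 0"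
    and cont: "continuous_on K (\<lambda>x. w1' x (axis 1 1))" "continuous_on K (\<lambda>x. w2' x (axis 2 1))"
  shows "(LINT x:K|lborel. w1' x (axis 1 1) + w2' x (axis 2 1)) =
    - (\<integral>s. (if vector [s, 0] \<in> K then w2 (vector [s, 0]) else 0) \<partial>lborel)"
proof -
  let ?c1 = "\<lambda>x. if x \<in> K then w1' x (axis 1 1) else 0"
  let ?c2 = "\<lambda>x. if x \<in> K then w2' x (axis 2 1) else 0"
  have KU: "K \<subseteq> U" and KH: "K \<subseteq> half_plane" and clK: "closed K" using K by (auto intro: compact_imp_closed)
  \<comment> \<open>\<open>R\<close> bounds \<open>K\<close> strictly, so the far end points of all
    lines lie off \<open>K\<close> and the cut-off functions vanish there.\<close>
  obtain R where R: "R > 0" "\<And>x. x \<in> K \<Longrightarrow> norm x < R"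
    using compact_imp_bounded[OF K(1)] unfolding bounded_pos_less by blast
  have KR: "\<bar>x$i\<bar> < R" if "x \<in> K" for x i
    using R(2)[OF that] component_le_norm_cart[of x i] by linarith
  have v1: "vector [s, t] = vector [0, t] + s *\<^sub>R (axis 1 1 :: real^2)"
    and v2: "vector [s, t] = vector [s, 0] + t *\<^sub>R (axis 2 1 :: real^2)" for s t :: real
    by (simp_all add: vec_eq_iff forall_2 axis_def)
  have int: "integrable lborel ?c1" "integrable lborel ?c2"
    by (intro integrable_cut_off K(1) cont)+
  have s1: "(\<integral>s. ?c1 (vector [s, t]) \<partial>lborel) = 0" for t
  proof (cases "t \<ge> 0")
    case True
    let ?F = "\<lambda>s. if vector [0, t] + s *\<^sub>R axis 1 1 \<in> K then w1 (vector [0, t] + s *\<^sub>R axis 1 1) else 0"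
    have "(\<integral>s. ?c1 (vector [0, t] + s *\<^sub>R axis 1 1) \<partial>lborel) = ?F R - ?F (-R)"
    proof (rule integral_lborel_ftc[where F="?F" and a="-R" and b=R])
      fix s assume "s \<in> {-R..R}"
      then show "(?F has_vector_derivative ?c1 (vector [0, t] + s *\<^sub>R axis 1 1)) (at s within {-R..R})"
        using True
        by (intro has_vector_derivative_cut_off_line[where H=half_plane and w=w1 and w'=w1',
              OF U KU clK w1 zero(1)]) (auto simp: half_plane_def axis_def)
    next
      fix s assume "s \<notin> {-R..R}"
      then have "vector [s, t] \<notin> K" using KR[of "vector [s, t]" 1] by auto
      then show "?c1 (vector [0, t] + s *\<^sub>R axis 1 1) = 0" unfolding v1[of s t] by simp
    next
      show "integrable lborel (\<lambda>s. ?c1 (vector [0, t] + s *\<^sub>R axis 1 1))"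
        by (rule integrable_cut_off_line[OF K(1) cont(1)]) simp
    qed (use R in auto)
    moreover have "vector [0, t] + R *\<^sub>R axis 1 1 \<notin> K" "vector [0, t] + (-R) *\<^sub>R axis 1 1 \<notin> K"
      using KR[of "vector [R, t]" 1] KR[of "vector [-R, t]" 1] unfolding v1[of R t] v1[of "-R" t] by auto
    ultimately have "(\<integral>s. ?c1 (vector [0, t] + s *\<^sub>R axis 1 1) \<partial>lborel) = 0" by simp
    then show ?thesis unfolding v1[of "_ :: real" t, symmetric] .
  next
    case False
    then have "vector [s, t] \<notin> K" for s using KH by (auto simp: half_plane_def)
    then show ?thesis by simp
  qed
  have s2: "(\<integral>t. ?c2 (vector [s, t]) \<partial>lborel) = - (if vector [s, 0] \<in> K then w2 (vector [s, 0]) else 0)" for s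
  proof -
    let ?F = "\<lambda>t. if vector [s, 0] + t *\<^sub>R axis 2 1 \<in> K then w2 (vector [s, 0] + t *\<^sub>R axis 2 1) else 0"
    have "(\<integral>t. ?c2 (vector [s, 0] + t *\<^sub>R axis 2 1) \<partial>lborel) = ?F R - ?F 0"
    proof (rule integral_lborel_ftc[where F="?F" and a=0 and b=R])
      fix t assume "t \<in> {0..R}"
      then show "(?F has_vector_derivative ?c2 (vector [s, 0] + t *\<^sub>R axis 2 1)) (at t within {0..R})"
        by (intro has_vector_derivative_cut_off_line[where H=half_plane and w=w2 and w'=w2',
              OF U KU clK w2 zero(2)]) (auto simp: half_plane_def axis_def)
    next
      fix t assume "t \<notin> {0..R}"
      then have "vector [s, t] \<notin> K" using KR[of "vector [s, t]" 2] KH by (auto simp: half_plane_def)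
      then show "?c2 (vector [s, 0] + t *\<^sub>R axis 2 1) = 0" unfolding v2[of s t] by simp
    next
      show "integrable lborel (\<lambda>t. ?c2 (vector [s, 0] + t *\<^sub>R axis 2 1))"
        by (rule integrable_cut_off_line[OF K(1) cont(2)]) simp
    qed (use R in auto)
    moreover have "vector [s, 0] + R *\<^sub>R axis 2 1 \<notin> K"
      using KR[of "vector [s, R]" 2] unfolding v2[of s R] by auto
    ultimately have "(\<integral>t. ?c2 (vector [s, 0] + t *\<^sub>R axis 2 1) \<partial>lborel) =
        - (if vector [s, 0] \<in> K then w2 (vector [s, 0]) else 0)" by simp
    then show ?thesis unfolding v2[of s "_ :: real", symmetric] .
  qed
  have "(LINT x:K|lborel. w1' x (axis 1 1) + w2' x (axis 2 1)) = (\<integral>x. ?c1 x + ?c2 x \<partial>lborel)"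
    unfolding set_lebesgue_integral_def
    by (intro Bochner_Integration.integral_cong) (auto simp: indicator_def)
  also have "\<dots> = (\<integral>x. ?c1 x \<partial>lborel) + (\<integral>x. ?c2 x \<partial>lborel)"
    by (rule Bochner_Integration.integral_add[OF int])
  also have "(\<integral>x. ?c1 x \<partial>lborel) = 0"
    unfolding integral_lborel_vec2'[OF int(1)] s1 by simp
  also have "(\<integral>x. ?c2 x \<partial>lborel) = - (\<integral>s. (if vector [s, 0] \<in> K then w2 (vector [s, 0]) else 0) \<partial>lborel)"
    unfolding integral_lborel_vec2[OF int(2)] s2 by simp
  finally show ?thesis by simp
qed

section \<open>Flux through a chart\<close>

text \<open>The normal determined by the chart itself. The Gauss map is only assumed continuous and
  lives on \<open>M\<close>; this one is differentiable on the open parameter domain and agrees with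
  the Gauss map up to sign.\<close>

definition unormal :: "(real^2 \<Rightarrow> real^3) \<Rightarrow> real^2 \<Rightarrow> real^3" where
  "unormal X x = inverse (area_density X x) *\<^sub>R (partial 1 X x \<times> partial 2 X x)"

lemma bounded_bilinear_cross3: "bounded_bilinear (\<times>)"
  using bilinear_cross bilinear_conv_bounded_bilinear by blast

lemma unormal_has_derivative:
  assumes X: "smooth_on X U" "open U" and inj: "\<And>x. x \<in> U \<Longrightarrow> inj (frechet_derivative X (at x))"
  obtains n' where "\<And>x. x \<in> U \<Longrightarrow> (unormal X has_derivative n' x) (at x)"
    "\<And>i. continuous_on U (\<lambda>x. n' x (axis i 1))"
proof -
  define D where "D = (\<lambda>i x. frechet_derivative (partial i X) (at x))"
  define w where "w = (\<lambda>x. partial 1 X x \<times> partial 2 X x)"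
  define w' where "w' = (\<lambda>x v. partial 1 X x \<times> D 2 x v + D 1 x v \<times> partial 2 X x)"
  define n' where "n' = (\<lambda>x v. inverse (norm (w x)) *\<^sub>R w' x v + (- (inverse (norm (w x)) * (w' x v \<bullet> sgn (w x)) * inverse (norm (w x)))) *\<^sub>R w x)"
  have ne: "w x \<noteq> 0" if "x \<in> U" for x
    unfolding w_def using cross_partials_nonzero[OF X that inj[OF that]] .
  have D: "(partial i X has_derivative D i x) (at x)" if "x \<in> U" for i x
    unfolding D_def by (rule smooth_on_has_derivative[OF smooth_on_partial[OF X(1)] X(2) that])
  have w: "(w has_derivative w' x) (at x)" if "x \<in> U" for x
    unfolding w_def w'_def
    by (rule bounded_bilinear.FDERIV[OF bounded_bilinear_cross3 D[OF that] D[OF that]])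
  have "(unormal X has_derivative n' x) (at x)" if x: "x \<in> U" for x
  proof -
    have "((\<lambda>x. norm (w x)) has_derivative (\<lambda>v. w' x v \<bullet> sgn (w x))) (at x)"
      by (rule has_derivative_compose[OF w[OF x] has_derivative_norm[OF ne[OF x]]])
    from Deriv.has_derivative_inverse[OF _ this]
    have "((\<lambda>x. inverse (norm (w x))) has_derivative
        (\<lambda>v. - (inverse (norm (w x)) * (w' x v \<bullet> sgn (w x)) * inverse (norm (w x))))) (at x)"
      using ne[OF x] by simp
    from has_derivative_scaleR[OF this w[OF x]]
    show ?thesis by (simp add: unormal_def[abs_def] area_density_def n'_def w_def)
  qed
  moreover have "continuous_on U (\<lambda>x. n' x (axis i 1))" for i
  proof -
    have s: "smooth_on (\<lambda>x. D j x (axis i 1)) U" for j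
      unfolding D_def by (rule smooth_on_frechet_derivative[OF smooth_on_partial[OF X(1)]])
    have cw: "continuous_on U w" unfolding w_def
      by (intro continuous_on_cross smooth_on_continuous_on smooth_on_partial X)
    have cw': "continuous_on U (\<lambda>x. w' x (axis i 1))" unfolding w'_def
      by (intro continuous_intros continuous_on_cross smooth_on_continuous_on smooth_on_partial X s)
    show ?thesis unfolding n'_def sgn_div_norm
      by (intro continuous_intros cw cw') (use ne in auto)
  qed
  ultimately show thesis using that by blast
qed

lemma unormal_props:
  assumes "smooth_on X U" "open U" "x \<in> U" "inj (frechet_derivative X (at x))"
  shows "norm (unormal X x) = 1" "unormal X x \<bullet> partial 1 X x = 0" "unormal X x \<bullet> partial 2 X x = 0"
    "partial 1 X x \<times> partial 2 X x = area_density X x *\<^sub>R unormal X x" "area_density X x > 0"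
  using cross_partials_nonzero[OF assms]
  by (simp_all add: unormal_def area_density_def dot_cross_self)

text \<open>Both \<open>n1\<close> and \<open>n2\<close> are combinations of \<open>x1\<close>,
  \<open>x2\<close>, since they are orthogonal to \<open>x1 \<times> x2\<close>. Only the diagonal
  coefficients \<open>p\<close> and \<open>s\<close> survive in the cross products, leaving minus
  the trace of the Weingarten map. The factor \<open>(norm (x1 \<times> x2))\<^sup>2\<close>, the
  determinant of the first form, expresses this trace by inner products alone.\<close>

lemma shape_operator_cross3:
  fixes x1 x2 n1 n2 :: "real^3"
  assumes w: "x1 \<times> x2 \<noteq> 0" and n: "(x1 \<times> x2) \<bullet> n1 = 0" "(x1 \<times> x2) \<bullet> n2 = 0"
  shows "(norm (x1 \<times> x2))\<^sup>2 *\<^sub>R (x2 \<times> n1 + n2 \<times> x1) =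
    ((x1 \<bullet> x2) * (n2 \<bullet> x1) + (x1 \<bullet> x2) * (n1 \<bullet> x2) - (x2 \<bullet> x2) * (n1 \<bullet> x1) - (x1 \<bullet> x1) * (n2 \<bullet> x2)) *\<^sub>R (x1 \<times> x2)"
proof -
  let ?w = "x1 \<times> x2"
  have span: "\<exists>p q. v = p *\<^sub>R x1 + q *\<^sub>R x2" if "?w \<bullet> v = 0" for v
  proof -
    have "((x2 \<times> ?w) \<bullet> v) *\<^sub>R x1 + ((?w \<times> x1) \<bullet> v) *\<^sub>R x2 = (?w \<bullet> ?w) *\<^sub>R v"
      using cramer_cross3[of x2 ?w v x1] that by simp
    then have "v = (1 / (?w \<bullet> ?w)) *\<^sub>R (((x2 \<times> ?w) \<bullet> v) *\<^sub>R x1 + ((?w \<times> x1) \<bullet> v) *\<^sub>R x2)"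
      using w by simp
    then show ?thesis unfolding scaleR_add_right scaleR_scaleR by blast
  qed
  obtain p q where n1: "n1 = p *\<^sub>R x1 + q *\<^sub>R x2" using span[OF n(1)] by blast
  obtain r s where n2: "n2 = r *\<^sub>R x1 + s *\<^sub>R x2" using span[OF n(2)] by blast
  have a: "x2 \<times> n1 + n2 \<times> x1 = (- (p + s)) *\<^sub>R ?w"
    unfolding n1 n2 by (simp add: cross_add_left cross_add_right cross_mult_left cross_mult_right
        cross_skew[of x2 x1] algebra_simps)
  have b: "(norm ?w)\<^sup>2 = (x1 \<bullet> x1) * (x2 \<bullet> x2) - (x1 \<bullet> x2)\<^sup>2"
    using norm_cross_dot[of x1 x2] by (simp add: power_mult_distrib dot_square_norm)
  have "(norm ?w)\<^sup>2 * (- (p + s)) = (x1 \<bullet> x2) * (n2 \<bullet> x1) + (x1 \<bullet> x2) * (n1 \<bullet> x2)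
      - (x2 \<bullet> x2) * (n1 \<bullet> x1) - (x1 \<bullet> x1) * (n2 \<bullet> x2)"
    unfolding b n1 n2 by (simp add: inner_add_left inner_commute[of x2 x1] algebra_simps power2_eq_square)
  then show ?thesis unfolding a by (metis scaleR_scaleR)
qed

text \<open>Differentiating \<open>n \<bullet> n = 1\<close> makes the derivatives of the normal
  tangential, and differentiating \<open>n \<bullet> X_j = 0\<close> gives the second form as
  \<open>- n_i \<bullet> X_j\<close>. With these, \<open>shape_operator_cross3\<close> turns the
  left side into the trace of the shape operator times \<open>X_1 \<times> X_2\<close>.\<close>

lemma unormal_divergence:
  assumes X: "smooth_on X U" "open U" "x \<in> U" and inj: "\<And>x. x \<in> U \<Longrightarrow> inj (frechet_derivative X (at x))"
    and n': "(unormal X has_derivative n') (at x)"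
  shows "partial 2 X x \<times> n' (axis 1 1) + n' (axis 2 1) \<times> partial 1 X x =
    trace (matrix_inv (first_form X x) ** second_form (\<lambda>_. unormal X x) X x) *\<^sub>R (partial 1 X x \<times> partial 2 X x)"
proof -
  let ?x1 = "partial 1 X x" and ?x2 = "partial 2 X x"
  let ?w = "?x1 \<times> ?x2"
  note P = unormal_props[OF X(1,2) _ inj]
  have w: "?w \<noteq> 0" by (rule cross_partials_nonzero[OF X inj[OF X(3)]])
  have nn: "unormal X x \<bullet> n' v = 0" for v
  proof -
    have "((\<lambda>y. unormal X y \<bullet> unormal X y) has_derivative (\<lambda>v. unormal X x \<bullet> n' v + n' v \<bullet> unormal X x)) (at x)"
      by (rule has_derivative_inner[OF n' n'])
    moreover have "((\<lambda>y. unormal X y \<bullet> unormal X y) has_derivative (\<lambda>v. 0)) (at x)"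
      by (rule has_derivative_transform_within_open[OF has_derivative_const X(2,3)])
        (use P(1) in \<open>simp add: dot_square_norm\<close>)
    ultimately have "(\<lambda>v. unormal X x \<bullet> n' v + n' v \<bullet> unormal X x) = (\<lambda>v. 0)"
      by (rule has_derivative_unique)
    from fun_cong[OF this, of v] show ?thesis by (simp add: inner_commute)
  qed
  have wn: "?w \<bullet> n' v = 0" for v using nn[of v] unfolding P(4)[OF X(3) X(3)] by simp
  have h: "partial i (partial j X) x \<bullet> unormal X x = - (n' (axis i 1) \<bullet> partial j X x)" for i j
  proof -
    have "((\<lambda>y. unormal X y \<bullet> partial j X y) has_derivative
        (\<lambda>v. unormal X x \<bullet> frechet_derivative (partial j X) (at x) v + n' v \<bullet> partial j X x)) (at x)"
      by (rule has_derivative_inner[OF n' smooth_on_has_derivative[OF smooth_on_partial[OF X(1)] X(2,3)]])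
    moreover have "((\<lambda>y. unormal X y \<bullet> partial j X y) has_derivative (\<lambda>v. 0)) (at x)"
    proof (rule has_derivative_transform_within_open[OF has_derivative_const X(2,3)])
      fix y assume "y \<in> U"
      then show "0 = unormal X y \<bullet> partial j X y"
        using P(2,3)[of y] exhaust_2[of j] by auto
    qed
    ultimately have "(\<lambda>v. unormal X x \<bullet> frechet_derivative (partial j X) (at x) v + n' v \<bullet> partial j X x) = (\<lambda>v. 0)"
      by (rule has_derivative_unique)
    from fun_cong[OF this, of "axis i 1"]
    have "unormal X x \<bullet> partial i (partial j X) x + n' (axis i 1) \<bullet> partial j X x = 0"
      unfolding partial_def[of i "partial j X"] .
    then show ?thesis by (simp add: inner_commute add_eq_0_iff)
  qed
  define T where "T = trace (matrix_inv (first_form X x) ** second_form (\<lambda>_. unormal X x) X x)"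
  have det: "det (first_form X x) = (norm ?w)\<^sup>2" by (rule det_first_form)
  have ff: "first_form X x $ i $ j = partial i X x \<bullet> partial j X x" for i j
    by (simp add: first_form_def)
  have sf: "second_form (\<lambda>_. unormal X x) X x $ i $ j = - (n' (axis i 1) \<bullet> partial j X x)" for i j
    by (simp add: second_form_def h)
  have "det (first_form X x) \<noteq> 0" using w by (simp add: det)
  from trace_matrix_inv_mult_2[OF this, of "second_form (\<lambda>_. unormal X x) X x", folded T_def]
  have T: "T * (norm ?w)\<^sup>2 = (?x1 \<bullet> ?x2) * (n' (axis 2 1) \<bullet> ?x1) + (?x1 \<bullet> ?x2) * (n' (axis 1 1) \<bullet> ?x2)
      - (?x2 \<bullet> ?x2) * (n' (axis 1 1) \<bullet> ?x1) - (?x1 \<bullet> ?x1) * (n' (axis 2 1) \<bullet> ?x2)"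
    unfolding ff sf det by (simp add: inner_commute[of ?x2 ?x1])
  have "(norm ?w)\<^sup>2 *\<^sub>R (?x2 \<times> n' (axis 1 1) + n' (axis 2 1) \<times> ?x1) = (norm ?w)\<^sup>2 *\<^sub>R (T *\<^sub>R ?w)"
    unfolding shape_operator_cross3[OF w wn wn] T[symmetric] by (simp add: mult.commute)
  then show ?thesis using w unfolding T_def[symmetric] scaleR_cancel_left by simp
qed

text \<open>The second form is linear in the normal, so the trace changes by the same sign
  \<epsilon> as the normal, and the product of the two does not change. The sign is chosen at each
  point separately.\<close>

lemma mean_curvature_unormal:
  assumes X: "smooth_on X U" "open U" "x \<in> U" and inj: "inj (frechet_derivative X (at x))"
    and N: "norm (N (X x)) = 1" "\<And>i. N (X x) \<bullet> partial i X x = 0"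
  obtains \<epsilon> :: real where "\<epsilon> * \<epsilon> = 1" "N (X x) = \<epsilon> *\<^sub>R unormal X x"
    "trace (matrix_inv (first_form X x) ** second_form (\<lambda>_. unormal X x) X x) = \<epsilon> * (2 * mean_curvature N X x)"
proof -
  let ?w = "partial 1 X x \<times> partial 2 X x"
  note P = unormal_props[OF X inj]
  note u = unit_normal_cross3[OF N(1) N(2)[of 1] N(2)[of 2]]
  define \<epsilon> where "\<epsilon> = unormal X x \<bullet> N (X x)"
  have J: "norm ?w = area_density X x" by (simp add: area_density_def)
  have "(area_density X x * area_density X x) *\<^sub>R N (X x) = (area_density X x * area_density X x) *\<^sub>R (\<epsilon> *\<^sub>R unormal X x)"
    using u(1) unfolding J unfolding P(4) by (simp add: \<epsilon>_def power2_eq_square mult_ac)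
  then have Ne: "N (X x) = \<epsilon> *\<^sub>R unormal X x" using P(5) unfolding scaleR_cancel_left by simp
  have "\<bar>\<epsilon>\<bar> = 1" using arg_cong[OF Ne, of norm] N(1) P(1) by simp
  then have ee: "\<epsilon> * \<epsilon> = 1" by (metis abs_mult_self_eq mult_1)
  have "second_form N X x = \<epsilon> *\<^sub>R second_form (\<lambda>_. unormal X x) X x"
    by (simp add: second_form_def vec_eq_iff Ne)
  then have "2 * mean_curvature N X x = trace (matrix_inv (first_form X x) ** (\<epsilon> *\<^sub>R second_form (\<lambda>_. unormal X x) X x))"
    by (simp add: mean_curvature_def)
  also have "\<dots> = \<epsilon> * trace (matrix_inv (first_form X x) ** second_form (\<lambda>_. unormal X x) X x)"
    by (simp add: trace_def matrix_matrix_mult_def sum_2 algebra_simps)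
  finally have "\<epsilon> * (2 * mean_curvature N X x) = \<epsilon> * \<epsilon> * trace (matrix_inv (first_form X x) ** second_form (\<lambda>_. unormal X x) X x)"
    by simp
  then show thesis using that[OF ee Ne] ee by simp
qed

text \<open>The vector \<open>a - (N p \<bullet> a) *\<^sub>R N p\<close> is the tangential part of
  \<open>a\<close>, the gradient of the height on \<open>M\<close>. The integrand is the divergence
  of \<theta> times this gradient, with the Laplacian of the height replaced through the curvature
  equation. As \<theta> vanishes on \<open>M - C\<close>, the half-plane divergence applies on the
  compact set \<open>K\<close> and only the edge integral remains.\<close>

lemma chart_flux:
  fixes \<theta> :: "real^3 \<Rightarrow> real" and G :: "real^3 \<Rightarrow> real^3"
  assumes X: "local_param M U X" and N: "gauss_map M N"
    and H: "\<And>x. x \<in> U \<inter> half_plane \<Longrightarrow> 2 * mean_curvature N X x = \<alpha> * (N (X x) \<bullet> a) / (X x \<bullet> a)"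
    and W: "open W" "M \<subseteq> W" and G: "\<And>p. p \<in> W \<Longrightarrow> (\<theta> has_derivative (\<lambda>v. G p \<bullet> v)) (at p)"
    and cG: "continuous_on W G"
    and C: "compact C" "C \<subseteq> X ` (U \<inter> half_plane)" and zero: "\<And>p. p \<in> M - C \<Longrightarrow> \<theta> p = 0"
  defines "K \<equiv> {x \<in> U \<inter> half_plane. X x \<in> C}"
  shows "(LINT x:K|lborel. area_density X x * (G (X x) \<bullet> (a - (N (X x) \<bullet> a) *\<^sub>R N (X x)) +
        \<theta> (X x) * \<alpha> * (N (X x) \<bullet> a)\<^sup>2 / (X x \<bullet> a))) =
     - (\<integral>s. (if vector [s, 0] \<in> K then \<theta> (X (vector [s, 0])) *
          ((unormal X (vector [s, 0]) \<times> partial 1 X (vector [s, 0])) \<bullet> a) else 0) \<partial>lborel)"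
proof -
  note X' = local_paramD[OF X] and N' = gauss_mapD[OF N]
  \<comment> \<open>Points of \<open>U\<close> below the edge may be mapped outside
    \<open>W\<close>, where \<theta> has no known derivative. Shrinking to \<open>V\<close> keeps
    all of \<open>U \<inter> half_plane\<close>, since \<open>X\<close> maps it into
    \<open>M\<close>.\<close>
  define V where "V = U \<inter> X -` W"
  have V: "open V" "V \<subseteq> U" unfolding V_def using continuous_open_preimage[OF X'(6,1) W(1)] by auto
  have VH: "U \<inter> half_plane \<subseteq> V" using X'(7) W(2) by (auto simp: V_def)
  have K: "compact K" "K \<subseteq> V \<inter> half_plane"
    unfolding K_def using compact_chart_preimage[OF X C] VH by auto
  have sV: "smooth_on X V"
  proof -
    have "Ck_on k f U \<Longrightarrow> Ck_on k f V" for k and f :: "real^2 \<Rightarrow> real^3"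
      using V(2) by (induction k arbitrary: f) (auto intro: continuous_on_subset differentiable_on_subset)
    then show ?thesis using X'(2) by (auto simp: smooth_on_def)
  qed
  have inj: "inj (frechet_derivative X (at x))" if "x \<in> V" for x using X'(3) V(2) that by blast
  obtain n' where n': "\<And>x. x \<in> V \<Longrightarrow> (unormal X has_derivative n' x) (at x)"
    and cn': "\<And>i. continuous_on V (\<lambda>x. n' x (axis i 1))"
    using unormal_has_derivative[OF sV V(1) inj] by blast
  define D where "D = (\<lambda>i x. frechet_derivative (partial i X) (at x))"
  have D: "(partial i X has_derivative D i x) (at x)" if "x \<in> V" for i x
    unfolding D_def by (rule smooth_on_has_derivative[OF smooth_on_partial[OF sV] V(1) that])
  have XW: "X x \<in> W" if "x \<in> V" for x using that by (simp add: V_def)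
  have dX: "(X has_derivative frechet_derivative X (at x)) (at x)" if "x \<in> V" for x
    by (rule smooth_on_has_derivative[OF sV V(1) that])
  \<comment> \<open>The conormals \<open>X\<^sub>2 \<times> n\<close> and \<open>n \<times> X\<^sub>1\<close> are the vectors \<open>sqrt g g\<^sup>j\<^sup>k X\<^sub>k\<close>, written without the inverse
    metric. In their divergence the mixed second derivatives of \<open>X\<close> cancel and the rest is \<open>2 H sqrt g n\<close>.\<close>
  define w1 where "w1 = (\<lambda>x. \<theta> (X x) * ((partial 2 X x \<times> unormal X x) \<bullet> a))"
  define w2 where "w2 = (\<lambda>x. \<theta> (X x) * ((unormal X x \<times> partial 1 X x) \<bullet> a))"
  define w1' where "w1' = (\<lambda>x v. \<theta> (X x) * ((partial 2 X x \<times> n' x v + D 2 x v \<times> unormal X x) \<bullet> a) +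
      (G (X x) \<bullet> frechet_derivative X (at x) v) * ((partial 2 X x \<times> unormal X x) \<bullet> a))"
  define w2' where "w2' = (\<lambda>x v. \<theta> (X x) * ((unormal X x \<times> D 1 x v + n' x v \<times> partial 1 X x) \<bullet> a) +
      (G (X x) \<bullet> frechet_derivative X (at x) v) * ((unormal X x \<times> partial 1 X x) \<bullet> a))"
  have dw1: "(w1 has_derivative w1' x) (at x)" if x: "x \<in> V" for x
    unfolding w1_def w1'_def
    by (intro has_derivative_mult has_derivative_inner_left
        bounded_bilinear.FDERIV[OF bounded_bilinear_cross3] has_derivative_compose[OF dX[OF x] G[OF XW[OF x]]]
        D[OF x] n'[OF x])
  have dw2: "(w2 has_derivative w2' x) (at x)" if x: "x \<in> V" for x
    unfolding w2_def w2'_def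
    by (intro has_derivative_mult has_derivative_inner_left
        bounded_bilinear.FDERIV[OF bounded_bilinear_cross3] has_derivative_compose[OF dX[OF x] G[OF XW[OF x]]]
        D[OF x] n'[OF x])
  have cX: "continuous_on V X" by (rule smooth_on_continuous_on[OF sV])
  have cu: "continuous_on V (unormal X)"
    by (rule has_derivative_continuous_on[OF has_derivative_at_withinI[OF n']])
  have cp: "continuous_on V (partial i X)" for i by (rule smooth_on_continuous_on[OF smooth_on_partial[OF sV]])
  have cD: "continuous_on V (\<lambda>x. D i x (axis j 1))" for i j
    unfolding D_def by (rule smooth_on_continuous_on[OF smooth_on_frechet_derivative[OF smooth_on_partial[OF sV]]])
  have c\<theta>: "continuous_on V (\<lambda>x. \<theta> (X x))"
  proof (rule continuous_on_compose2[OF _ cX, of W])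
    show "continuous_on W \<theta>" by (rule has_derivative_continuous_on[OF has_derivative_at_withinI[OF G]])
  qed (use XW in auto)
  have cGX: "continuous_on V (\<lambda>x. G (X x))"
    by (rule continuous_on_compose2[OF cG cX]) (use XW in auto)
  have cf: "continuous_on V (\<lambda>x. frechet_derivative X (at x) v)" for v
    by (rule smooth_on_continuous_on[OF smooth_on_frechet_derivative[OF sV]])
  have cont: "continuous_on K (\<lambda>x. w1' x (axis 1 1))" "continuous_on K (\<lambda>x. w2' x (axis 2 1))"
    by (rule continuous_on_subset[of V]; (use K(2) in blast)?;
        unfold w1'_def w2'_def; intro continuous_intros continuous_on_cross c\<theta> cGX cf cD cp cu cn')+
  have div: "w1' x (axis 1 1) + w2' x (axis 2 1) = area_density X x *
      (G (X x) \<bullet> (a - (N (X x) \<bullet> a) *\<^sub>R N (X x)) + \<theta> (X x) * \<alpha> * (N (X x) \<bullet> a)\<^sup>2 / (X x \<bullet> a))"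
    if x: "x \<in> K" for x
  proof -
    have xV: "x \<in> V" and xH: "x \<in> U \<inter> half_plane" using x K by (auto simp: K_def)
    let ?n = "unormal X x" and ?x1 = "partial 1 X x" and ?x2 = "partial 2 X x"
    note P = unormal_props[OF sV V(1) xV inj[OF xV]]
    define T where "T = trace (matrix_inv (first_form X x) ** second_form (\<lambda>_. ?n) X x)"
    have XM: "X x \<in> M" using X'(7) xH by blast
    obtain \<epsilon> where \<epsilon>: "\<epsilon> * \<epsilon> = 1" "N (X x) = \<epsilon> *\<^sub>R ?n" "T = \<epsilon> * (2 * mean_curvature N X x)"
      using mean_curvature_unormal[OF sV V(1) xV inj[OF xV], of N] N'(2)[OF XM] N'(3)[OF X xH]
      unfolding T_def by blast
    have Na: "N (X x) \<bullet> a = \<epsilon> * (?n \<bullet> a)" by (simp add: \<epsilon>(2))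
    have "T = (\<epsilon> * \<epsilon>) * \<alpha> * (?n \<bullet> a) / (X x \<bullet> a)" unfolding \<epsilon>(3) H[OF xH] Na by simp
    then have T: "T = \<alpha> * (?n \<bullet> a) / (X x \<bullet> a)" using \<epsilon>(1) by simp
    have comm: "D 2 x (axis 1 1) = D 1 x (axis 2 1)"
      using partial_commute[OF sV V(1) xV, of 1 2] by (simp add: D_def partial_def[of _ "partial _ X"])
    have cancel: "D 2 x (axis 1 1) \<times> ?n + ?n \<times> D 1 x (axis 2 1) = 0"
      unfolding comm using cross_skew[of ?n "D 1 x (axis 2 1)"] by simp
    have Td: "?x2 \<times> n' x (axis 1 1) + n' x (axis 2 1) \<times> ?x1 = T *\<^sub>R (?x1 \<times> ?x2)"
      unfolding T_def by (rule unormal_divergence[OF sV V(1) xV inj n'[OF xV]])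
    have A: "(?x2 \<times> n' x (axis 1 1) + D 2 x (axis 1 1) \<times> ?n) + (?n \<times> D 1 x (axis 2 1) + n' x (axis 2 1) \<times> ?x1)
        = (T * area_density X x) *\<^sub>R ?n"
    proof -
      have "(?x2 \<times> n' x (axis 1 1) + D 2 x (axis 1 1) \<times> ?n) + (?n \<times> D 1 x (axis 2 1) + n' x (axis 2 1) \<times> ?x1)
        = (?x2 \<times> n' x (axis 1 1) + n' x (axis 2 1) \<times> ?x1) + (D 2 x (axis 1 1) \<times> ?n + ?n \<times> D 1 x (axis 2 1))"
        by (simp only: add_ac)
      then show ?thesis unfolding cancel Td P(4) by simp
    qed
    \<comment> \<open>Cramer's rule in the frame \<open>X_1\<close>, \<open>X_2\<close>,
      \<open>n\<close>: the \<open>a\<close>-components of the conormals are the coordinates of the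
      tangential part of \<open>a\<close>, up to the density.\<close>
    have B: "((?x2 \<times> ?n) \<bullet> a) *\<^sub>R ?x1 + ((?n \<times> ?x1) \<bullet> a) *\<^sub>R ?x2 = area_density X x *\<^sub>R (a - (?n \<bullet> a) *\<^sub>R ?n)"
    proof -
      have "?n \<bullet> ?n = 1" using P(1) by (simp add: dot_square_norm)
      then show ?thesis using cramer_cross3[of ?x2 ?n a ?x1] unfolding P(4)
        by (simp add: algebra_simps)
    qed
    have "w1' x (axis 1 1) + w2' x (axis 2 1) =
       \<theta> (X x) * (((?x2 \<times> n' x (axis 1 1) + D 2 x (axis 1 1) \<times> ?n) + (?n \<times> D 1 x (axis 2 1) + n' x (axis 2 1) \<times> ?x1)) \<bullet> a)
       + G (X x) \<bullet> (((?x2 \<times> ?n) \<bullet> a) *\<^sub>R ?x1 + ((?n \<times> ?x1) \<bullet> a) *\<^sub>R ?x2)"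
      unfolding w1'_def w2'_def partial_def[of 1 X] partial_def[of 2 X]
      by (simp add: inner_add_left inner_add_right algebra_simps)
    also have "\<dots> = \<theta> (X x) * (T * area_density X x * (?n \<bullet> a)) + area_density X x * (G (X x) \<bullet> (a - (?n \<bullet> a) *\<^sub>R ?n))"
      unfolding A B by simp
    also have "(?n \<bullet> a) *\<^sub>R ?n = (N (X x) \<bullet> a) *\<^sub>R N (X x)"
      unfolding Na unfolding \<epsilon>(2) using \<epsilon>(1) by (simp add: mult_ac)
    also have "\<theta> (X x) * (T * area_density X x * (?n \<bullet> a)) = area_density X x * (\<theta> (X x) * \<alpha> * (N (X x) \<bullet> a)\<^sup>2 / (X x \<bullet> a))"
    proof -
      have "(N (X x) \<bullet> a)\<^sup>2 = (\<epsilon> * \<epsilon>) * (?n \<bullet> a)\<^sup>2" unfolding Na by (simp add: power2_eq_square)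
      then show ?thesis unfolding T using \<epsilon>(1) by (simp add: power2_eq_square)
    qed
    finally show ?thesis by (simp add: algebra_simps)
  qed
  have "(LINT x:K|lborel. area_density X x * (G (X x) \<bullet> (a - (N (X x) \<bullet> a) *\<^sub>R N (X x)) +
        \<theta> (X x) * \<alpha> * (N (X x) \<bullet> a)\<^sup>2 / (X x \<bullet> a))) =
      (LINT x:K|lborel. w1' x (axis 1 1) + w2' x (axis 2 1))"
    unfolding set_lebesgue_integral_def
    by (intro Bochner_Integration.integral_cong refl) (auto simp: indicator_def div)
  also have "\<dots> = - (\<integral>s. (if vector [s, 0] \<in> K then w2 (vector [s, 0]) else 0) \<partial>lborel)"
  proof (rule half_plane_divergence[OF K V(1) dw1 dw2 _ _ cont])
    fix x assume "x \<in> V \<inter> half_plane - K"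
    then have "X x \<in> M - C" using V(2) X'(7) by (auto simp: K_def)
    then show "w1 x = 0" "w2 x = 0" using zero by (auto simp: w1_def w2_def)
  qed
  finally show ?thesis unfolding w2_def .
qed

section \<open>The boundary contribution\<close>

lemma smooth_curve_derivative:
  fixes \<gamma> :: "real \<Rightarrow> real^3"
  assumes "smooth_on \<gamma> UNIV"
  shows "(\<gamma> has_vector_derivative vector_derivative \<gamma> (at t)) (at t)"
    and "continuous_on UNIV (\<lambda>t. vector_derivative \<gamma> (at t))"
proof -
  have d: "(\<gamma> has_derivative frechet_derivative \<gamma> (at t)) (at t)" for t
    by (rule smooth_on_has_derivative[OF assms]) auto
  have d1: "(\<gamma> has_vector_derivative frechet_derivative \<gamma> (at t) 1) (at t)" for t
  proof -
    have "frechet_derivative \<gamma> (at t) v = v *\<^sub>R frechet_derivative \<gamma> (at t) 1" for v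
      using linear_scale[OF has_derivative_linear[OF d[of t]], of v 1] by (simp only: real_scaleR_def mult_1_right)
    then have "frechet_derivative \<gamma> (at t) = (\<lambda>v. v *\<^sub>R frechet_derivative \<gamma> (at t) 1)" by (rule ext)
    from has_derivative_eq_rhs[OF d[of t] this] show ?thesis unfolding has_vector_derivative_def .
  qed
  then have "vector_derivative \<gamma> (at t) = frechet_derivative \<gamma> (at t) 1" for t
    by (rule vector_derivative_at)
  with d1 show "(\<gamma> has_vector_derivative vector_derivative \<gamma> (at t)) (at t)" for t by simp
  have "vector_derivative \<gamma> (at t) = frechet_derivative \<gamma> (at t) 1" for t
    by (rule vector_derivative_at[OF d1])
  then show "continuous_on UNIV (\<lambda>t. vector_derivative \<gamma> (at t))"
    using smooth_on_continuous_on[OF smooth_on_frechet_derivative[OF assms]] by simp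
qed

lemma simple_closed_curve_range:
  fixes \<gamma> :: "real \<Rightarrow> real^3"
  assumes per: "\<And>t. \<gamma> (t + 1) = \<gamma> t"
  shows "range \<gamma> = \<gamma> ` {0..<1}"
proof -
  have n: "\<gamma> (t + real n) = \<gamma> t" for t n
    using per[of "t + real _"] by (induction n) (simp_all add: add.assoc[symmetric] add.commute[of 1])
  have i: "\<gamma> (t + of_int k) = \<gamma> t" for t k
  proof (cases "k \<ge> 0")
    case True
    then show ?thesis using n[of t "nat k"] by simp
  next
    case False
    then show ?thesis using n[of "t + of_int k" "nat (- k)"] by simp
  qed
  have "\<gamma> t \<in> \<gamma> ` {0..<1}" for t
    using i[of t "- \<lfloor>t\<rfloor>"] frac_lt_1[of t] frac_ge_0[of t]
    by (intro image_eqI[of _ _ "frac t"]) (auto simp: frac_def)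
  then show ?thesis by auto
qed

text \<open>A map into the compact interval \<open>{0..1}\<close> is continuous once its graph is
  closed, and the graph is given by the closed condition \<gamma> t = p. The point \<gamma> 0 is
  removed because both ends of the interval map to it.\<close>

lemma simple_closed_curve_inverse:
  fixes \<gamma> :: "real \<Rightarrow> real^3"
  assumes cont: "continuous_on UNIV \<gamma>" and inj: "inj_on \<gamma> {0..<1}" and per: "\<And>t. \<gamma> (t + 1) = \<gamma> t"
  obtains \<eta> where "continuous_on (range \<gamma> - {\<gamma> 0}) \<eta>"
    "\<And>p. p \<in> range \<gamma> - {\<gamma> 0} \<Longrightarrow> \<eta> p \<in> {0<..<1} \<and> \<gamma> (\<eta> p) = p"
proof -
  let ?S = "range \<gamma> - {\<gamma> 0}"
  have ex: "\<exists>t. t \<in> {0<..<1} \<and> \<gamma> t = p" if "p \<in> ?S" for p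
  proof -
    have "p \<in> \<gamma> ` {0..<1}" using that simple_closed_curve_range[of \<gamma>, OF per] by blast
    then obtain t where "t \<in> {0..<1}" "\<gamma> t = p" by blast
    then show ?thesis using that by (intro exI[of _ t]) (auto simp: less_le)
  qed
  define \<eta> where "\<eta> = (\<lambda>p. SOME t. t \<in> {0<..<1} \<and> \<gamma> t = p)"
  have \<eta>: "\<eta> p \<in> {0<..<1} \<and> \<gamma> (\<eta> p) = p" if "p \<in> ?S" for p
    unfolding \<eta>_def by (rule someI_ex[OF ex[OF that]])
  have \<gamma>1: "\<gamma> 1 = \<gamma> 0" using per[of 0] by simp
  have uniq: "t = \<eta> p" if "p \<in> ?S" "t \<in> {0..1}" "\<gamma> t = p" for p t
  proof -
    have "t \<noteq> 1" "t \<noteq> 0" using that \<gamma>1 by auto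
    then show ?thesis using inj_onD[OF inj, of t "\<eta> p"] that \<eta>[OF that(1)] by auto
  qed
  have "continuous_on ?S \<eta>"
  proof (rule continuous_closed_graph_eq[THEN iffD2])
    show "compact {0..1::real}" by simp
    show "\<eta> \<in> ?S \<rightarrow> {0..1}" using \<eta> by force
    have "(\<lambda>x. (x, \<eta> x)) ` ?S = Sigma ?S (\<lambda>_. {0..1}) \<inter> {x. \<gamma> (snd x) = fst x}"
      using \<eta> uniq by force
    moreover have "closed {x. \<gamma> (snd x) = fst x}"
      by (intro closed_Collect_eq continuous_intros continuous_on_compose2[OF cont]) auto
    ultimately show "closedin (top_of_set (Sigma ?S (\<lambda>_. {0..1}))) ((\<lambda>x. (x, \<eta> x)) ` ?S)"
      by (auto simp: closedin_closed)
  qed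
  with \<eta> that show thesis by blast
qed

text \<open>The edge of the chart is \<gamma> after an injective reparametrization \<tau>, so change
  of variables turns the edge integral into an integral over the parameters that \<tau> reaches. The
  edge may cover only part of the curve, hence an inequality; the absolute value of the derivative
  of \<tau> accounts for either orientation.\<close>

lemma edge_length_le:
  fixes g :: "real^3 \<Rightarrow> real"
  assumes X: "local_param M U X" and \<gamma>: "smooth_simple_closed_curve \<gamma>"
    and edge: "\<And>s. vector [s, 0] \<in> U \<Longrightarrow> X (vector [s, 0]) \<in> range \<gamma>"
    and g: "g \<in> borel_measurable borel" "\<And>p. 0 \<le> g p"
  shows "(\<integral>\<^sup>+s\<in>{s. vector [s, 0] \<in> U}. (g (X (vector [s, 0])) * norm (partial 1 X (vector [s, 0]))) \<partial>lborel) \<le>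
    (\<integral>\<^sup>+t\<in>{0..1}. (g (\<gamma> t) * norm (vector_derivative \<gamma> (at t))) \<partial>lborel)"
proof -
  note X' = local_paramD[OF X]
  have \<gamma>s: "smooth_on \<gamma> UNIV" and \<gamma>0: "\<And>t. vector_derivative \<gamma> (at t) \<noteq> 0"
    and per: "\<And>t. \<gamma> (t + 1) = \<gamma> t" and inj\<gamma>: "inj_on \<gamma> {0..<1}"
    using \<gamma> by (auto simp: smooth_simple_closed_curve_def)
  note d\<gamma> = smooth_curve_derivative[OF \<gamma>s]
  obtain \<eta> where \<eta>: "continuous_on (range \<gamma> - {\<gamma> 0}) \<eta>"
    "\<And>p. p \<in> range \<gamma> - {\<gamma> 0} \<Longrightarrow> \<eta> p \<in> {0<..<1} \<and> \<gamma> (\<eta> p) = p"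
    using simple_closed_curve_inverse[OF smooth_on_continuous_on[OF \<gamma>s] inj\<gamma> per] by blast
  have vec: "vector [s, 0] = 0 + s *\<^sub>R (axis 1 1 :: real^2)" for s :: real
    by (simp add: vec_eq_iff forall_2 axis_def)
  have cvec: "continuous_on S (\<lambda>s::real. vector [s, 0] :: real^2)" for S
    unfolding vec by (intro continuous_intros)
  define A where "A = {s. vector [s, 0] \<in> U}"
  define \<sigma> where "\<sigma> = (\<lambda>s. X (vector [s, 0]))"
  define \<sigma>' where "\<sigma>' = (\<lambda>s. partial 1 X (vector [s, 0]))"
  have A: "open A" unfolding A_def vimage_def[symmetric]
    by (rule open_vimage[OF X'(1) cvec])
  have d\<sigma>: "(\<sigma> has_vector_derivative \<sigma>' s) (at s)" if "s \<in> A" for s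
  proof -
    have "((\<lambda>s. vector [s, 0] :: real^2) has_derivative (\<lambda>v. v *\<^sub>R axis 1 1)) (at s)"
      unfolding vec by (auto intro!: derivative_eq_intros)
    from has_derivative_compose[OF this smooth_on_has_derivative[OF X'(2,1)]]
    have "(\<sigma> has_derivative (\<lambda>v. frechet_derivative X (at (vector [s, 0])) (v *\<^sub>R axis 1 1))) (at s)"
      using that unfolding \<sigma>_def A_def by simp
    moreover have "frechet_derivative X (at (vector [s, 0])) (v *\<^sub>R axis 1 1) = v *\<^sub>R \<sigma>' s" for v
      using frechet_derivative_partial[OF X'(2,1), of "vector [s, 0]" "v *\<^sub>R axis 1 1"] that
      unfolding \<sigma>'_def A_def by (simp add: axis_def)
    ultimately show ?thesis by (simp add: has_vector_derivative_def)
  qed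
  have cA: "continuous_on A \<sigma>" "continuous_on A \<sigma>'"
    unfolding \<sigma>_def \<sigma>'_def
    by (rule continuous_on_compose2[OF X'(6) cvec], simp add: A_def image_subset_iff,
        rule continuous_on_compose2[OF smooth_on_continuous_on[OF smooth_on_partial[OF X'(2)]] cvec],
        simp add: A_def image_subset_iff)
  have inj\<sigma>: "inj_on \<sigma> A"
  proof (rule inj_onI)
    fix s t assume st: "s \<in> A" "t \<in> A" "\<sigma> s = \<sigma> t"
    then have "(vector [s, 0] :: real^2) = vector [t, 0]"
      using inj_onD[OF X'(5), of "vector [s, 0]" "vector [t, 0]"] by (auto simp: \<sigma>_def A_def half_plane_def)
    then show "s = t" by (metis vector_2(1))
  qed
  \<comment> \<open>By injectivity of the edge at most one parameter is dropped, so the integral is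
    unaffected.\<close>
  define A' where "A' = {s \<in> A. \<sigma> s \<noteq> \<gamma> 0}"
  have A': "open A'"
  proof -
    have "A' = A \<inter> \<sigma> -` (- {\<gamma> 0})" by (auto simp: A'_def)
    then show ?thesis using continuous_open_preimage[OF cA(1) A, of "- {\<gamma> 0}"] by (simp add: open_Compl)
  qed
  have inS: "\<sigma> s \<in> range \<gamma> - {\<gamma> 0}" if "s \<in> A'" for s
    using that edge by (auto simp: A'_def A_def \<sigma>_def)
  define \<tau> where "\<tau> = (\<lambda>s. \<eta> (\<sigma> s))"
  have \<tau>: "\<tau> s \<in> {0<..<1}" "\<gamma> (\<tau> s) = \<sigma> s" if "s \<in> A'" for s
    using \<eta>(2)[OF inS[OF that]] by (auto simp: \<tau>_def)
  have c\<tau>: "continuous_on A' \<tau>" unfolding \<tau>_def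
    by (rule continuous_on_compose2[OF \<eta>(1) continuous_on_subset[OF cA(1)]])
      (use inS in \<open>auto simp: A'_def\<close>)
  have inj\<tau>: "inj_on \<tau> A'"
    using inj\<sigma> \<tau>(2) unfolding inj_on_def A'_def by (metis (no_types, lifting) mem_Collect_eq A'_def)
  have "\<exists>d. (\<tau> has_field_derivative d) (at s) \<and> \<sigma>' s = d *\<^sub>R vector_derivative \<gamma> (at (\<tau> s))"
    if s: "s \<in> A'" for s
  proof -
    have sA: "s \<in> A" using s by (auto simp: A'_def)
    have d1: "(\<sigma> has_derivative (\<lambda>v. v *\<^sub>R \<sigma>' s)) (at s within A')"
      using d\<sigma>[OF sA] unfolding has_vector_derivative_def by (rule has_derivative_at_withinI)
    have d2: "(\<gamma> has_derivative (\<lambda>v. v *\<^sub>R vector_derivative \<gamma> (at (\<tau> s)))) (at (\<tau> s))"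
      using d\<gamma>(1) unfolding has_vector_derivative_def .
    have i: "inj (\<lambda>v. v *\<^sub>R vector_derivative \<gamma> (at (\<tau> s)))"
      using \<gamma>0 by (auto simp: inj_on_def)
    have c: "continuous (at s within A') \<tau>"
      using c\<tau> s by (simp add: continuous_on_eq_continuous_within)
    obtain L where L: "(\<tau> has_derivative (\<lambda>v. L (v *\<^sub>R \<sigma>' s))) (at s within A')" "linear L"
      by (rule has_derivative_implicit_left_inverse[where t=\<tau> and Y=\<gamma>, OF d1 d2 i c _ s])
        (use \<tau>(2) in auto)
    define d where "d = L (\<sigma>' s)"
    have "(\<lambda>v. L (v *\<^sub>R \<sigma>' s)) = (*) d"
      using linear_scale[OF L(2)] by (auto simp: fun_eq_iff d_def)
    then have d: "(\<tau> has_field_derivative d) (at s)"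
      using L(1) A' s by (simp add: has_field_derivative_def at_within_open[OF s A'])
    have "((\<gamma> \<circ> \<tau>) has_vector_derivative d *\<^sub>R vector_derivative \<gamma> (at (\<tau> s))) (at s)"
      by (rule vector_diff_chain_at[OF d[unfolded has_real_derivative_iff_has_vector_derivative] d\<gamma>(1)])
    then have "(\<sigma> has_vector_derivative d *\<^sub>R vector_derivative \<gamma> (at (\<tau> s))) (at s)"
      by (rule has_vector_derivative_transform_within_open[OF _ A' s]) (use \<tau>(2) in simp)
    then have "\<sigma>' s = d *\<^sub>R vector_derivative \<gamma> (at (\<tau> s))"
      using d\<sigma>[OF sA] vector_derivative_unique_at by blast
    with d show ?thesis by blast
  qed
  then obtain \<tau>' where \<tau>': "\<And>s. s \<in> A' \<Longrightarrow> (\<tau> has_field_derivative \<tau>' s) (at s)"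
    "\<And>s. s \<in> A' \<Longrightarrow> \<sigma>' s = \<tau>' s *\<^sub>R vector_derivative \<gamma> (at (\<tau> s))" by metis
  define f where "f = (\<lambda>t. g (\<gamma> t) * norm (vector_derivative \<gamma> (at t)))"
  have fb: "f \<in> borel_measurable borel" unfolding f_def
    using borel_measurable_continuous_onI[OF smooth_on_continuous_on[OF \<gamma>s]]
      borel_measurable_continuous_onI[OF d\<gamma>(2)] g(1) by measurable
  \<comment> \<open>Invariance of domain on the line makes the image open and hence Borel, as the
    change of variables requires.\<close>
  have op: "open (\<tau> ` A')" by (rule invariance_of_domain[OF c\<tau> A' inj\<tau>])
  have eq: "\<bar>\<tau>' s\<bar> * f (\<tau> s) = g (\<sigma> s) * norm (\<sigma>' s)" if "s \<in> A'" for s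
    using \<tau>(2)[OF that] \<tau>'(2)[OF that] by (simp add: f_def)
  have m: "(\<lambda>s. indicator A' s *\<^sub>R (g (\<sigma> s) * norm (\<sigma>' s))) \<in> borel_measurable borel"
  proof -
    have A'A: "A' \<subseteq> A" by (auto simp: A'_def)
    have "(\<lambda>s. indicator A' s *\<^sub>R \<sigma> s) \<in> borel_measurable borel" "(\<lambda>s. indicator A' s *\<^sub>R \<sigma>' s) \<in> borel_measurable borel"
      using A' cA continuous_on_subset[OF _ A'A]
      by (auto intro!: borel_measurable_continuous_on_indicator)
    then have "(\<lambda>s. g (indicator A' s *\<^sub>R \<sigma> s) * norm (indicator A' s *\<^sub>R \<sigma>' s)) \<in> borel_measurable borel"
      using g(1) by measurable
    moreover have "(\<lambda>s. g (indicator A' s *\<^sub>R \<sigma> s) * norm (indicator A' s *\<^sub>R \<sigma>' s)) =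
        (\<lambda>s. indicator A' s *\<^sub>R (g (\<sigma> s) * norm (\<sigma>' s)))" by (auto simp: fun_eq_iff indicator_def)
    ultimately show ?thesis by simp
  qed
  have "(\<integral>\<^sup>+s\<in>A. (g (\<sigma> s) * norm (\<sigma>' s)) \<partial>lborel) = (\<integral>\<^sup>+s\<in>A'. (g (\<sigma> s) * norm (\<sigma>' s)) \<partial>lborel)"
  proof (rule nn_integral_cong_AE)
    have sub: "\<exists>x. A - A' \<subseteq> {x}"
    proof (cases "A - A' = {}")
      case False
      then obtain x where "x \<in> A - A'" by blast
      then have "A - A' \<subseteq> {x}" using inj\<sigma> by (auto simp: A'_def inj_on_def)
      then show ?thesis by blast
    qed auto
    then obtain x where x: "A - A' \<subseteq> {x}" by blast
    have "AE s in lborel. s \<noteq> x" by (rule AE_lborel_singleton)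
    then show "AE s in lborel. ennreal (g (\<sigma> s) * norm (\<sigma>' s)) * indicator A s =
        ennreal (g (\<sigma> s) * norm (\<sigma>' s)) * indicator A' s"
      by eventually_elim (use x in \<open>auto simp: A'_def indicator_def\<close>)
  qed
  also have "\<dots> = (\<integral>\<^sup>+s\<in>A'. (\<bar>\<tau>' s\<bar> * f (\<tau> s)) \<partial>lborel)"
    by (intro nn_integral_cong) (auto simp: indicator_def eq)
  also have "\<dots> = (\<integral>\<^sup>+t\<in>\<tau> ` A'. f t \<partial>lborel)"
  proof (rule nn_integral_change_of_variables_real)
    show "A' \<in> sets borel" using A' by simp
    show "(\<tau> has_field_derivative \<tau>' s) (at s within A')" if "s \<in> A'" for s
      by (rule has_field_derivative_at_within[OF \<tau>'(1)[OF that]])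
    show "set_borel_measurable borel (\<tau> ` A') f"
      unfolding set_borel_measurable_def using fb op by simp
    show "0 \<le> f y" for y using g(2) by (simp add: f_def)
    have "(\<lambda>s. indicator A' s *\<^sub>R (\<bar>\<tau>' s\<bar> * f (\<tau> s))) = (\<lambda>s. indicator A' s *\<^sub>R (g (\<sigma> s) * norm (\<sigma>' s)))"
      by (auto simp: fun_eq_iff indicator_def eq)
    then show "set_borel_measurable borel A' (\<lambda>s. \<bar>\<tau>' s\<bar> * f (\<tau> s))"
      unfolding set_borel_measurable_def using m by simp
  qed (rule inj\<tau>)
  also have "\<dots> \<le> (\<integral>\<^sup>+t\<in>{0..1}. f t \<partial>lborel)"
  proof (intro nn_integral_mono mult_left_mono)
    have "\<tau> ` A' \<subseteq> {0..1}" using \<tau>(1) by force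
    then show "indicator (\<tau> ` A') t \<le> (indicator {0..1} t :: ennreal)" for t
      by (auto simp: indicator_def)
  qed simp
  finally show ?thesis unfolding A_def \<sigma>_def \<sigma>'_def f_def .
qed

text \<open>No integrability is assumed: the Bochner integral of a non-integrable function is 0 by
  convention. The edge integrand can thus be estimated pointwise under the nonnegative
  integral.\<close>

lemma ennreal_abs_integral_le:
  fixes f :: "'a \<Rightarrow> real"
  shows "ennreal \<bar>integral\<^sup>L M f\<bar> \<le> (\<integral>\<^sup>+x. ennreal \<bar>f x\<bar> \<partial>M)"
proof (cases "integrable M f")
  case True
  then show ?thesis using integral_norm_bound_ennreal[OF True] by simp
qed (simp add: not_integrable_integral_eq)

lemma norm_cross3_le: "norm (x \<times> y) \<le> norm x * norm y"
proof (rule power2_le_imp_le)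
  show "(norm (x \<times> y))\<^sup>2 \<le> (norm x * norm y)\<^sup>2"
    using norm_cross_dot[of x y] zero_le_power2[of "x \<bullet> y"] by linarith
qed simp

lemma surface_boundary_subset: "surface_boundary M \<subseteq> M"
proof
  fix p assume "p \<in> surface_boundary M"
  then obtain U X x where X: "local_param M U X" and x: "x \<in> U" "x$2 = 0" "p = X x"
    unfolding surface_boundary_def by blast
  then have "x \<in> U \<inter> half_plane" by (simp add: half_plane_def)
  then show "p \<in> M" using local_paramD(7)[OF X] x(3) by blast
qed

lemma integrable_on_closed_curve:
  fixes f :: "real^3 \<Rightarrow> real"
  assumes "smooth_simple_closed_curve \<gamma>" "continuous_on S f" "range \<gamma> \<subseteq> S"
  shows "(\<lambda>t. \<bar>f (\<gamma> t)\<bar> * norm (vector_derivative \<gamma> (at t))) integrable_on {0..1}"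
proof -
  have \<gamma>: "smooth_on \<gamma> UNIV" using assms(1) by (simp add: smooth_simple_closed_curve_def)
  have "continuous_on {0..1} (\<lambda>t. f (\<gamma> t))"
    by (rule continuous_on_compose2[OF assms(2) continuous_on_subset[OF smooth_on_continuous_on[OF \<gamma>]]])
      (use assms(3) in auto)
  then show ?thesis
    by (intro integrable_continuous_real continuous_intros
        continuous_on_subset[OF smooth_curve_derivative(2)[OF \<gamma>]]) auto
qed

text \<open>Edge points of a chart belong to the boundary and so lie on the curve. There the
  conormal \<open>n \<times> X_1\<close> has length at most that of the edge tangent
  \<open>X_1\<close>, and \<open>a\<close> is a unit vector, so the flux is at most the integral of
  the absolute value of \<theta> along the edge and then along the whole curve.\<close>

lemma surface_flux_le:
  fixes \<theta> :: "real^3 \<Rightarrow> real" and G :: "real^3 \<Rightarrow> real^3"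
  assumes M: "compact M" and \<mu>: "surface_measure M \<mu>" and X: "local_param M U X" and N: "gauss_map M N"
    and H: "\<And>x. x \<in> U \<inter> half_plane \<Longrightarrow> 2 * mean_curvature N X x = \<alpha> * (N (X x) \<bullet> a) / (X x \<bullet> a)"
    and pos: "\<And>p. p \<in> M \<Longrightarrow> p \<bullet> a > 0" and a: "norm a = 1"
    and bd: "surface_boundary M = range \<gamma>" and \<gamma>: "smooth_simple_closed_curve \<gamma>"
    and W: "open W" "M \<subseteq> W" and G: "\<And>p. p \<in> W \<Longrightarrow> (\<theta> has_derivative (\<lambda>v. G p \<bullet> v)) (at p)"
    and cG: "continuous_on W G"
    and C: "compact C" "C \<subseteq> X ` (U \<inter> half_plane)"
    and zero: "\<And>p. p \<in> M - C \<Longrightarrow> \<theta> p = 0" "\<And>p. p \<in> M - C \<Longrightarrow> G p = 0"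
  shows "(\<integral>p. indicator M p *\<^sub>R (G p \<bullet> (a - (N p \<bullet> a) *\<^sub>R N p) + \<theta> p * \<alpha> * (N p \<bullet> a)\<^sup>2 / (p \<bullet> a)) \<partial>\<mu>)
    \<le> integral {0..1} (\<lambda>t. \<bar>\<theta> (\<gamma> t)\<bar> * norm (vector_derivative \<gamma> (at t)))"
proof -
  note X' = local_paramD[OF X] and N' = gauss_mapD[OF N]
  have clM: "closed M" by (simp add: M compact_imp_closed)
  define F where "F = (\<lambda>p. G p \<bullet> (a - (N p \<bullet> a) *\<^sub>R N p) + \<theta> p * \<alpha> * (N p \<bullet> a)\<^sup>2 / (p \<bullet> a))"
  define K where "K = {x \<in> U \<inter> half_plane. X x \<in> C}"
  define h where "h = (\<lambda>s. if vector [s, 0] \<in> K then \<theta> (X (vector [s, 0])) *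
          ((unormal X (vector [s, 0]) \<times> partial 1 X (vector [s, 0])) \<bullet> a) else 0)"
  have c\<theta>: "continuous_on W \<theta>" by (rule has_derivative_continuous_on[OF has_derivative_at_withinI[OF G]])
  have "continuous_on M F" unfolding F_def
    using pos by (intro continuous_intros N'(1) continuous_on_subset[OF cG W(2)] continuous_on_subset[OF c\<theta> W(2)])
      (auto simp: less_imp_neq[symmetric])
  then have Fb: "(\<lambda>p. indicator M p *\<^sub>R F p) \<in> borel_measurable borel"
    by (intro borel_measurable_continuous_on_indicator) (use M in \<open>auto simp: borel_compact\<close>)
  have CM: "C \<subseteq> M" using C(2) X'(7) by blast
  have F0: "F p = 0" if "p \<in> M - C" for p using zero that by (simp add: F_def)
  have "(\<integral>p. indicator M p *\<^sub>R F p \<partial>\<mu>) = (LINT x:U \<inter> half_plane|lborel. area_density X x * (indicator M (X x) *\<^sub>R F (X x)))"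
    by (rule integral_surface_measure_chart[OF \<mu> X clM Fb]) (use F0 C(2) in auto)
  also have "\<dots> = (LINT x:K|lborel. area_density X x * F (X x))"
    unfolding set_lebesgue_integral_def
  proof (intro Bochner_Integration.integral_cong refl)
    fix x
    show "indicator (U \<inter> half_plane) x *\<^sub>R (area_density X x * (indicator M (X x) *\<^sub>R F (X x))) =
      indicator K x *\<^sub>R (area_density X x * F (X x))"
    proof (cases "x \<in> U \<inter> half_plane")
      case True
      then have "X x \<in> M" using X'(7) by blast
      then show ?thesis using F0[of "X x"] True by (cases "X x \<in> C") (auto simp: K_def)
    qed (auto simp: K_def)
  qed
  also have "\<dots> = - (\<integral>s. h s \<partial>lborel)"
    unfolding F_def K_def h_def by (rule chart_flux[OF X N H W G cG C zero(1)])
  finally have eq: "(\<integral>p. indicator M p *\<^sub>R F p \<partial>\<mu>) = - (\<integral>s. h s \<partial>lborel)" .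
  \<comment> \<open>\<theta> is controlled only on \<open>W\<close>; cut off to the compact
    \<open>C\<close>, its absolute value is Borel on the whole space. Nothing is lost, since the
    edge integrand \<open>h\<close> vanishes unless the edge point is mapped into
    \<open>C\<close>.\<close>
  define g where "g = (\<lambda>p. indicator C p *\<^sub>R \<bar>\<theta> p\<bar>)"
  have gb: "g \<in> borel_measurable borel" unfolding g_def
    by (intro borel_measurable_continuous_on_indicator continuous_intros continuous_on_subset[OF c\<theta>])
      (use C(1) CM W(2) in \<open>auto simp: borel_compact\<close>)
  have edge: "X (vector [s, 0]) \<in> range \<gamma>" if "vector [s, 0] \<in> U" for s
  proof -
    have "X (vector [s, 0]) \<in> surface_boundary M" unfolding surface_boundary_def
      using X that by (intro CollectI exI[of _ U] exI[of _ X] exI[of _ "vector [s, 0]"]) simp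
    then show ?thesis using bd by simp
  qed
  have hb: "\<bar>h s\<bar> \<le> (if vector [s, 0] \<in> U then g (X (vector [s, 0])) * norm (partial 1 X (vector [s, 0])) else 0)" for s
  proof (cases "vector [s, 0] \<in> K")
    case True
    let ?x = "vector [s, 0] :: real^2"
    have x: "?x \<in> U" "X ?x \<in> C" using True by (auto simp: K_def)
    have "\<bar>(unormal X ?x \<times> partial 1 X ?x) \<bullet> a\<bar> \<le> norm (unormal X ?x \<times> partial 1 X ?x) * norm a"
      by (rule Cauchy_Schwarz_ineq2)
    also have "\<dots> \<le> norm (unormal X ?x) * norm (partial 1 X ?x)" using a norm_cross3_le by simp
    also have "norm (unormal X ?x) = 1"
      by (rule unormal_props(1)[OF X'(2,1) x(1) X'(3)[OF x(1)]])
    finally have "\<bar>(unormal X ?x \<times> partial 1 X ?x) \<bullet> a\<bar> \<le> norm (partial 1 X ?x)" by simp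
    then show ?thesis using True x by (auto simp: h_def g_def abs_mult intro!: mult_left_mono)
  qed (auto simp: h_def g_def)
  have int: "(\<lambda>t. \<bar>\<theta> (\<gamma> t)\<bar> * norm (vector_derivative \<gamma> (at t))) integrable_on {0..1}"
    using bd surface_boundary_subset[of M] W(2) by (intro integrable_on_closed_curve[OF \<gamma> c\<theta>]) auto
  have "ennreal (\<integral>p. indicator M p *\<^sub>R F p \<partial>\<mu>) \<le> ennreal \<bar>\<integral>s. h s \<partial>lborel\<bar>"
    unfolding eq by (intro ennreal_leI) simp
  also have "\<dots> \<le> (\<integral>\<^sup>+s. ennreal \<bar>h s\<bar> \<partial>lborel)" by (rule ennreal_abs_integral_le)
  also have "\<dots> \<le> (\<integral>\<^sup>+s\<in>{s. vector [s, 0] \<in> U}. (g (X (vector [s, 0])) * norm (partial 1 X (vector [s, 0]))) \<partial>lborel)"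
  proof (intro nn_integral_mono)
    fix s
    show "ennreal \<bar>h s\<bar> \<le> ennreal (g (X (vector [s, 0])) * norm (partial 1 X (vector [s, 0]))) * indicator {s. vector [s, 0] \<in> U} s"
      using hb[of s] by (cases "vector [s, 0] \<in> U") (auto intro: ennreal_leI)
  qed
  also have "\<dots> \<le> (\<integral>\<^sup>+t\<in>{0..1}. (g (\<gamma> t) * norm (vector_derivative \<gamma> (at t))) \<partial>lborel)"
    by (rule edge_length_le[OF X \<gamma> edge gb]) (auto simp: g_def)
  also have "\<dots> \<le> (\<integral>\<^sup>+t\<in>{0..1}. (\<bar>\<theta> (\<gamma> t)\<bar> * norm (vector_derivative \<gamma> (at t))) \<partial>lborel)"
    by (intro nn_integral_mono mult_right_mono ennreal_leI) (auto simp: g_def indicator_def)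
  also have "\<dots> = ennreal (integral {0..1} (\<lambda>t. \<bar>\<theta> (\<gamma> t)\<bar> * norm (vector_derivative \<gamma> (at t))))"
    by (rule nn_integral_has_integral_lebesgue'[OF _ integrable_integral[OF int]]) simp
  finally have "(\<integral>p. indicator M p *\<^sub>R F p \<partial>\<mu>) \<le> integral {0..1} (\<lambda>t. \<bar>\<theta> (\<gamma> t)\<bar> * norm (vector_derivative \<gamma> (at t)))"
    by (rule ennreal_le_iff[THEN iffD1, rotated]) (rule integral_nonneg[OF int], simp)
  then show ?thesis unfolding F_def .
qed

section \<open>Partition of unity\<close>

text \<open>One continuous derivative is all that the flux formula asks of the cut-off, so the
  square of a positive part suffices. It is positive exactly in the open ball when
  \<open>r > 0\<close>, and its gradient is the elementary formula \<open>bump_grad\<close>.\<close>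

definition bump :: "'a::real_inner \<Rightarrow> real \<Rightarrow> 'a \<Rightarrow> real" where
  "bump q r p = (max 0 (r\<^sup>2 - (p - q) \<bullet> (p - q)))\<^sup>2"

definition bump_grad :: "'a::real_inner \<Rightarrow> real \<Rightarrow> 'a \<Rightarrow> 'a" where
  "bump_grad q r p = (- 4 * max 0 (r\<^sup>2 - (p - q) \<bullet> (p - q))) *\<^sub>R (p - q)"

text \<open>Only \<open>t = 0\<close> is delicate; there the difference quotient is bounded by the
  absolute value of the increment.\<close>

lemma max_0_square_has_derivative: "((\<lambda>t::real. (max 0 t)\<^sup>2) has_real_derivative 2 * max 0 t) (at t)"
proof -
  consider "t < 0" | "t = 0" | "t > 0" by linarith
  then show ?thesis
  proof cases
    case 1
    have "((\<lambda>t::real. (max 0 t)\<^sup>2) has_real_derivative 0) (at t)"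
      by (rule has_field_derivative_transform_within_open[of "\<lambda>_. 0" _ _ "{..<0}"]) (use 1 in auto)
    then show ?thesis using 1 by simp
  next
    case 2
    have "((\<lambda>h. ((max 0 h)\<^sup>2 - 0) / h) \<longlongrightarrow> 0) (at (0::real))"
    proof (rule Lim_null_comparison)
      show "\<forall>\<^sub>F h in at 0. norm (((max 0 h)\<^sup>2 - 0) / h) \<le> \<bar>h\<bar>"
        by (rule always_eventually) (auto simp: max_def power2_eq_square)
      show "((\<lambda>h::real. \<bar>h\<bar>) \<longlongrightarrow> 0) (at 0)" by (rule tendsto_rabs_zero) (rule tendsto_ident_at)
    qed
    then show ?thesis using 2 by (simp add: DERIV_def)
  next
    case 3
    have "((\<lambda>t::real. (max 0 t)\<^sup>2) has_real_derivative 2 * t) (at t)"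
      by (rule has_field_derivative_transform_within_open[of "\<lambda>t. t\<^sup>2" _ _ "{0<..}"])
        (use 3 in \<open>auto intro!: derivative_eq_intros\<close>)
    then show ?thesis using 3 by simp
  qed
qed

lemma bump_has_derivative: "(bump q r has_derivative (\<lambda>v. bump_grad q r p \<bullet> v)) (at p)"
proof -
  have "((\<lambda>p. r\<^sup>2 - (p - q) \<bullet> (p - q)) has_derivative (\<lambda>v. - 2 * ((p - q) \<bullet> v))) (at p)"
    by (auto intro!: derivative_eq_intros simp: inner_commute)
  from has_derivative_compose[OF this max_0_square_has_derivative[unfolded has_field_derivative_def]]
  show ?thesis unfolding bump_def[abs_def] bump_grad_def
    by (rule has_derivative_eq_rhs) (auto simp: fun_eq_iff)
qed

lemma bump_nonneg: "0 \<le> bump q r p" by (simp add: bump_def)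

lemma bump_pos: "p \<in> ball q r \<Longrightarrow> 0 < bump q r p"
proof -
  assume "p \<in> ball q r"
  then have "norm (p - q) < r" by (simp add: dist_norm norm_minus_commute)
  then have "(norm (p - q))\<^sup>2 < r\<^sup>2" by (intro power_strict_mono) auto
  then show ?thesis by (simp add: bump_def dot_square_norm)
qed

lemma bump_zero:
  assumes "p \<notin> cball q r" "0 \<le> r" shows "bump q r p = 0" "bump_grad q r p = 0"
proof -
  have "r \<le> norm (p - q)" using assms by (simp add: dist_norm norm_minus_commute)
  then have "r\<^sup>2 \<le> (norm (p - q))\<^sup>2" using assms(2) by (intro power_mono) auto
  then show "bump q r p = 0" "bump_grad q r p = 0"
    by (auto simp: bump_def bump_grad_def dot_square_norm)
qed

lemma continuous_on_bump: "continuous_on S (bump q r)" "continuous_on S (bump_grad q r)"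
  unfolding bump_def[abs_def] bump_grad_def[abs_def] by (intro continuous_intros)+

lemma integrable_surface_measure_continuous:
  fixes f :: "real^3 \<Rightarrow> real"
  assumes M: "compact M" and \<mu>: "surface_measure M \<mu>" and f: "continuous_on M f"
  shows "integrable \<mu> (\<lambda>p. indicator M p *\<^sub>R f p)"
proof -
  note m = surface_measureD[OF \<mu>]
  obtain B where B: "\<And>p. p \<in> M \<Longrightarrow> \<bar>f p\<bar> \<le> B"
    using compact_imp_bounded[OF compact_continuous_image[OF f M]] by (auto simp: bounded_iff)
  have "(\<lambda>p. indicator M p *\<^sub>R f p) \<in> borel_measurable borel"
    by (intro borel_measurable_continuous_on_indicator f) (use M in \<open>simp add: borel_compact\<close>)
  then have "(\<lambda>p. indicator M p *\<^sub>R f p) \<in> borel_measurable \<mu>"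
    by (simp add: m(1) cong: measurable_cong_sets)
  moreover have "norm (indicator M p *\<^sub>R f p) \<le> \<bar>B\<bar>" for p
    using B[of p] by (cases "p \<in> M") auto
  ultimately show ?thesis
    by (intro finite_measure.integrable_const_bound[OF m(3), of _ "\<bar>B\<bar>"] AE_I2)
qed

text \<open>Each cut-off height is supported in a single chart, where \<open>surface_flux_le\<close>
  applies. Normalising the bumps by their sum \<open>B\<close> makes the integrands add up to the
  divergence of the height times its gradient; \<open>B\<close> is positive on the open
  neighbourhood \<open>W\<close> of \<open>M\<close>, so the quotients have full derivatives
  there.\<close>

lemma height_flux_le:
  fixes a :: "real^3"
  assumes M: "compact M" "smooth_surface M" and \<mu>: "surface_measure M \<mu>" and N: "gauss_map M N"
    and H: "\<And>U X x. local_param M U X \<Longrightarrow> x \<in> U \<inter> half_plane \<Longrightarrow>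
      2 * mean_curvature N X x = \<alpha> * (N (X x) \<bullet> a) / (X x \<bullet> a)"
    and pos: "\<And>p. p \<in> M \<Longrightarrow> p \<bullet> a > 0" and a: "norm a = 1"
    and bd: "surface_boundary M = range \<gamma>" and \<gamma>: "smooth_simple_closed_curve \<gamma>"
  shows "(\<integral>p. indicator M p *\<^sub>R (1 - (1 - \<alpha>) * (N p \<bullet> a)\<^sup>2) \<partial>\<mu>)
    \<le> integral {0..1} (\<lambda>t. (\<gamma> t \<bullet> a) * norm (vector_derivative \<gamma> (at t)))"
proof -
  note N' = gauss_mapD[OF N]
  obtain Q U X r where Q: "Q \<subseteq> M" "finite Q" "M \<subseteq> (\<Union>p\<in>Q. ball p (r p))"
    and c: "\<And>p. p \<in> M \<Longrightarrow> local_param M (U p) (X p)" "\<And>p. p \<in> M \<Longrightarrow> (r p :: real) > 0"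
      "\<And>p. p \<in> M \<Longrightarrow> M \<inter> cball p (r p) \<subseteq> X p ` (U p \<inter> half_plane)"
    by (rule compact_surface_chart_cover[OF M]) blast
  define b where "b = (\<lambda>q. bump q (r q))"
  define b' where "b' = (\<lambda>q. bump_grad q (r q))"
  define B where "B = (\<lambda>p. \<Sum>q\<in>Q. b q p)"
  define B' where "B' = (\<lambda>p. \<Sum>q\<in>Q. b' q p)"
  define W where "W = {p. B p > 0}"
  define \<theta> where "\<theta> = (\<lambda>q p. (p \<bullet> a) * b q p / B p)"
  \<comment> \<open>\<open>\<theta> q\<close> is the height times a partition of unity and \<open>G q\<close> its gradient, so that \<open>\<Sum>q. G q = a\<close>.\<close>
  define G where "G = (\<lambda>q p. ((p \<bullet> a) / B p) *\<^sub>R b' q p + (b q p / B p) *\<^sub>R a - ((p \<bullet> a) * b q p / (B p * B p)) *\<^sub>R B' p)"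
  have cb: "continuous_on S (b q)" "continuous_on S (b' q)" for q S
    unfolding b_def b'_def by (rule continuous_on_bump)+
  have cB: "continuous_on S B" "continuous_on S B'" for S
    unfolding B_def B'_def by (intro continuous_intros cb)+
  have W: "open W" unfolding W_def by (intro open_Collect_less continuous_intros cB)
  have MW: "M \<subseteq> W"
  proof
    fix p assume "p \<in> M"
    then obtain q where q: "q \<in> Q" "p \<in> ball q (r q)" using Q(3) by blast
    have "0 < b q p" unfolding b_def by (rule bump_pos[OF q(2)])
    also have "b q p \<le> B p" unfolding B_def b_def
      by (rule member_le_sum[OF q(1)]) (use Q(2) in \<open>auto simp: bump_nonneg\<close>)
    finally show "p \<in> W" by (simp add: W_def)
  qed
  have db: "(b q has_derivative (\<lambda>v. b' q p \<bullet> v)) (at p)" for q p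
    unfolding b_def b'_def by (rule bump_has_derivative)
  have dB: "(B has_derivative (\<lambda>v. B' p \<bullet> v)) (at p)" for p
    unfolding B_def B'_def inner_sum_left by (intro has_derivative_sum db)
  have dG: "(\<theta> q has_derivative (\<lambda>v. G q p \<bullet> v)) (at p)" if p: "p \<in> W" for q p
  proof -
    have "((\<lambda>p. (p \<bullet> a) * b q p) has_derivative (\<lambda>v. (p \<bullet> a) * (b' q p \<bullet> v) + (v \<bullet> a) * b q p)) (at p)"
      by (intro has_derivative_mult has_derivative_inner_left has_derivative_ident db)
    from has_derivative_divide'[OF this dB[of p]] p
    have "((\<lambda>p. (p \<bullet> a) * b q p / B p) has_derivative
        (\<lambda>v. (((p \<bullet> a) * (b' q p \<bullet> v) + (v \<bullet> a) * b q p) * B p - ((p \<bullet> a) * b q p) * (B' p \<bullet> v)) / (B p * B p))) (at p)"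
      by (simp add: W_def)
    then show ?thesis unfolding \<theta>_def
    proof (rule has_derivative_eq_rhs)
      have "B p \<noteq> 0" using p by (simp add: W_def)
      then show "(\<lambda>v. (((p \<bullet> a) * (b' q p \<bullet> v) + (v \<bullet> a) * b q p) * B p - ((p \<bullet> a) * b q p) * (B' p \<bullet> v)) / (B p * B p)) =
          (\<lambda>v. G q p \<bullet> v)"
        unfolding G_def by (auto simp: fun_eq_iff inner_diff_left inner_add_left inner_commute[of a] field_simps)
    qed
  qed
  have cG: "continuous_on W (G q)" for q
    unfolding G_def by (intro continuous_intros cb cB) (auto simp: W_def)
  have c\<theta>: "continuous_on W (\<theta> q)" for q
    unfolding \<theta>_def by (intro continuous_intros cb cB) (auto simp: W_def)
  have Bpos: "B p > 0" if "p \<in> M" for p using MW that by (auto simp: W_def)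
  have sum\<theta>: "(\<Sum>q\<in>Q. \<theta> q p) = p \<bullet> a" if "p \<in> M" for p
    using Bpos[OF that] by (simp add: \<theta>_def sum_divide_distrib[symmetric] sum_distrib_left[symmetric] B_def)
  have sumG: "(\<Sum>q\<in>Q. G q p) = a" if p: "p \<in> M" for p
  proof -
    have "(\<Sum>q\<in>Q. G q p) = ((p \<bullet> a) / B p) *\<^sub>R B' p + ((\<Sum>q\<in>Q. b q p) / B p) *\<^sub>R a
        - ((p \<bullet> a) * (\<Sum>q\<in>Q. b q p) / (B p * B p)) *\<^sub>R B' p"
      unfolding G_def B'_def sum_subtractf sum.distrib scaleR_sum_right[symmetric]
        scaleR_sum_left[symmetric] sum_divide_distrib[symmetric] sum_distrib_left[symmetric] ..
    also have "(\<Sum>q\<in>Q. b q p) = B p" by (simp add: B_def)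
    finally show ?thesis using Bpos[OF p] by simp
  qed
  \<comment> \<open>Nonnegativity lets the chartwise bounds be added without loss: on the curve the
    absolute values of the cut-off heights sum to the height.\<close>
  have \<theta>_nonneg: "0 \<le> \<theta> q p" if "p \<in> M" for q p
    using Bpos[OF that] pos[OF that] by (simp add: \<theta>_def b_def bump_nonneg)
  define F where "F = (\<lambda>q p. G q p \<bullet> (a - (N p \<bullet> a) *\<^sub>R N p) + \<theta> q p * \<alpha> * (N p \<bullet> a)\<^sup>2 / (p \<bullet> a))"
  have flux: "(\<integral>p. indicator M p *\<^sub>R F q p \<partial>\<mu>) \<le> integral {0..1} (\<lambda>t. \<bar>\<theta> q (\<gamma> t)\<bar> * norm (vector_derivative \<gamma> (at t)))"
    if q: "q \<in> Q" for q
  proof -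
    have qM: "q \<in> M" using q Q(1) by blast
    show ?thesis unfolding F_def
    proof (rule surface_flux_le[OF M(1) \<mu> c(1)[OF qM] N _ pos a bd \<gamma> W MW dG cG _ c(3)[OF qM]])
      show "compact (M \<inter> cball q (r q))" by (intro compact_Int_closed M) simp
      fix p assume p: "p \<in> M - M \<inter> cball q (r q)"
      have "b q p = 0" "b' q p = 0" unfolding b_def b'_def
        using bump_zero[of p q "r q"] p c(2)[OF qM] by auto
      then show "\<theta> q p = 0" "G q p = 0" by (auto simp: \<theta>_def G_def)
    qed (use H c(1)[OF qM] in auto)
  qed
  have cF: "continuous_on M (F q)" for q unfolding F_def
    using pos by (intro continuous_intros N'(1) continuous_on_subset[OF cG MW] continuous_on_subset[OF c\<theta> MW])
      (auto simp: less_imp_neq[symmetric])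
  have "(\<integral>p. indicator M p *\<^sub>R (1 - (1 - \<alpha>) * (N p \<bullet> a)\<^sup>2) \<partial>\<mu>) = (\<integral>p. (\<Sum>q\<in>Q. indicator M p *\<^sub>R F q p) \<partial>\<mu>)"
  proof (rule Bochner_Integration.integral_cong[OF refl])
    fix p
    show "indicator M p *\<^sub>R (1 - (1 - \<alpha>) * (N p \<bullet> a)\<^sup>2) = (\<Sum>q\<in>Q. indicator M p *\<^sub>R F q p)"
    proof (cases "p \<in> M")
      case True
      have "(\<Sum>q\<in>Q. F q p) = (\<Sum>q\<in>Q. G q p) \<bullet> (a - (N p \<bullet> a) *\<^sub>R N p) + (\<Sum>q\<in>Q. \<theta> q p) * \<alpha> * (N p \<bullet> a)\<^sup>2 / (p \<bullet> a)"
        unfolding F_def by (simp add: sum.distrib inner_sum_left sum_distrib_right sum_divide_distrib)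
      also have "\<dots> = a \<bullet> (a - (N p \<bullet> a) *\<^sub>R N p) + \<alpha> * (N p \<bullet> a)\<^sup>2"
        using pos[OF True] by (simp add: sumG[OF True] sum\<theta>[OF True])
      also have "\<dots> = 1 - (1 - \<alpha>) * (N p \<bullet> a)\<^sup>2"
        using a by (simp add: inner_diff_right dot_square_norm inner_commute[of a] power2_eq_square algebra_simps)
      finally show ?thesis using True by simp
    qed simp
  qed
  also have "\<dots> = (\<Sum>q\<in>Q. \<integral>p. indicator M p *\<^sub>R F q p \<partial>\<mu>)"
    by (rule Bochner_Integration.integral_sum) (rule integrable_surface_measure_continuous[OF M(1) \<mu> cF])
  also have "\<dots> \<le> (\<Sum>q\<in>Q. integral {0..1} (\<lambda>t. \<bar>\<theta> q (\<gamma> t)\<bar> * norm (vector_derivative \<gamma> (at t))))"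
    by (rule sum_mono[OF flux])
  also have "\<dots> = integral {0..1} (\<lambda>t. \<Sum>q\<in>Q. \<bar>\<theta> q (\<gamma> t)\<bar> * norm (vector_derivative \<gamma> (at t)))"
    by (rule integral_sum[symmetric, OF Q(2) integrable_on_closed_curve[OF \<gamma> c\<theta>]])
      (use bd surface_boundary_subset[of M] MW in auto)
  also have "\<dots> = integral {0..1} (\<lambda>t. (\<gamma> t \<bullet> a) * norm (vector_derivative \<gamma> (at t)))"
  proof (rule integral_cong)
    fix t
    have "\<gamma> t \<in> M" using bd surface_boundary_subset[of M] by auto
    then show "(\<Sum>q\<in>Q. \<bar>\<theta> q (\<gamma> t)\<bar> * norm (vector_derivative \<gamma> (at t))) = (\<gamma> t \<bullet> a) * norm (vector_derivative \<gamma> (at t))"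
      using \<theta>_nonneg sum\<theta> by (simp add: sum_distrib_right[symmetric])
  qed
  finally show ?thesis .
qed

section \<open>Area estimates for singular minimal graphs\<close>

text \<open>The area of the base is still the Lebesgue measure of the projection of
  \<open>M\<close>. Its comparison with \<open>surface_area\<close> of \<Omega> is kept apart
  because the two conclusions need it in opposite directions.\<close>

lemma singular_minimal_area_estimates:
  fixes a :: "real^3"
  assumes \<alpha>: "0 < \<alpha>" "\<alpha> < 1" and a: "norm a = 1" and M: "compact M" "singular_minimal \<alpha> a M"
    and bd: "surface_boundary M = range \<gamma>" and \<gamma>: "smooth_simple_closed_curve \<gamma>"
    and c: "\<And>t. \<gamma> t \<bullet> a = c" and e: "e1 \<times> e2 = a" and inj: "inj_on (proj2 e1 e2) M"
  shows "surface_area M \<le> ennreal (c * curve_length \<gamma>) + ennreal (1 - \<alpha>) * emeasure lborel (proj2 e1 e2 ` M)"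
    and "ennreal \<alpha> * emeasure lborel (proj2 e1 e2 ` M) \<le> ennreal (c * curve_length \<gamma>)"
proof -
  obtain N where sm: "smooth_surface M" and pos: "M \<subseteq> pos_halfspace a" and N: "gauss_map M N"
    and H: "\<And>U X x. local_param M U X \<Longrightarrow> x \<in> U \<inter> half_plane \<Longrightarrow>
      2 * mean_curvature N X x = \<alpha> * (N (X x) \<bullet> a) / (X x \<bullet> a)"
    using M(2) unfolding singular_minimal_def by blast
  note N' = gauss_mapD[OF N]
  obtain \<mu> where \<mu>: "surface_measure M \<mu>" by (rule surface_measure_exists[OF M(1) sm])
  note m = surface_measureD[OF \<mu>]
  define \<nu> where "\<nu> = (\<lambda>p. N p \<bullet> a)"
  define f where "f = (\<lambda>p. 1 - (1 - \<alpha>) * (\<nu> p)\<^sup>2)"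
  have \<nu>1: "\<bar>\<nu> p\<bar> \<le> 1" if "p \<in> M" for p
    using Cauchy_Schwarz_ineq2[of "N p" a] N'(2)[OF that] a by (simp add: \<nu>_def)
  have \<nu>2: "(\<nu> p)\<^sup>2 \<le> \<bar>\<nu> p\<bar>" if "p \<in> M" for p
    using mult_left_mono[OF \<nu>1[OF that], of "\<bar>\<nu> p\<bar>"] by (simp add: power2_eq_square)
  \<comment> \<open>The constant \<alpha> lies between the two sides: \<open>f\<close> is at least
    \<alpha> because the square of \<nu> is at most 1, and the left side is at most \<alpha> because
    the absolute value of \<nu> is.\<close>
  have f_ge: "\<alpha> * \<bar>\<nu> p\<bar> \<le> f p" if "p \<in> M" for p
  proof -
    have "\<alpha> * \<bar>\<nu> p\<bar> \<le> \<alpha>" using mult_left_mono[OF \<nu>1[OF that], of \<alpha>] \<alpha> by simp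
    moreover have "(1 - \<alpha>) * (\<nu> p)\<^sup>2 \<le> (1 - \<alpha>) * 1"
      using \<nu>1[OF that] \<nu>2[OF that] \<alpha> by (intro mult_left_mono) auto
    ultimately show ?thesis by (simp add: f_def)
  qed
  have f0: "0 \<le> f p" if "p \<in> M" for p
  proof -
    have "0 \<le> \<alpha> * \<bar>\<nu> p\<bar>" using \<alpha> by simp
    then show ?thesis using f_ge[OF that] by linarith
  qed
  have cf: "continuous_on M f" "continuous_on M \<nu>"
    unfolding f_def \<nu>_def by (intro continuous_intros N'(1))+
  have "(\<integral>p. indicator M p *\<^sub>R f p \<partial>\<mu>) \<le> integral {0..1} (\<lambda>t. (\<gamma> t \<bullet> a) * norm (vector_derivative \<gamma> (at t)))"
    unfolding f_def \<nu>_def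
    by (rule height_flux_le[OF M(1) sm \<mu> N H _ a bd \<gamma>]) (use pos in \<open>auto simp: pos_halfspace_def\<close>)
  also have "\<dots> = c * curve_length \<gamma>" by (simp add: c curve_length_def)
  finally have I: "(\<integral>p. indicator M p *\<^sub>R f p \<partial>\<mu>) \<le> c * curve_length \<gamma>" .
  have If: "(\<integral>\<^sup>+p\<in>M. f p \<partial>\<mu>) \<le> ennreal (c * curve_length \<gamma>)"
  proof -
    have "(\<integral>\<^sup>+p\<in>M. f p \<partial>\<mu>) = (\<integral>\<^sup>+p. ennreal (indicator M p *\<^sub>R f p) \<partial>\<mu>)"
      by (intro nn_integral_cong) (auto simp: indicator_def)
    also have "\<dots> = ennreal (\<integral>p. indicator M p *\<^sub>R f p \<partial>\<mu>)"
      by (rule nn_integral_eq_integral[OF integrable_surface_measure_continuous[OF M(1) \<mu> cf(1)]])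
        (use f0 in \<open>auto simp: indicator_def\<close>)
    finally show ?thesis using I by (simp add: ennreal_leI)
  qed
  have A: "(\<integral>\<^sup>+p\<in>M. \<bar>\<nu> p\<bar> \<partial>\<mu>) = emeasure lborel (proj2 e1 e2 ` M)"
    using nn_integral_normal_component[OF M(1) sm \<mu> N inj] by (simp add: \<nu>_def e)
  have Mb: "M \<in> sets \<mu>" using M(1) m(1) by (simp add: borel_compact)
  have meas: "(\<lambda>p. ennreal (g p) * indicator M p) \<in> borel_measurable \<mu>" if "continuous_on M g" for g :: "real^3 \<Rightarrow> real"
    using ennreal_indicator_measurable[OF _ that] Mb m(1) by (simp cong: measurable_cong_sets)
  have c\<nu>: "continuous_on M (\<lambda>p. \<bar>\<nu> p\<bar>)" by (intro continuous_intros cf)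
  have scale: "ennreal r * emeasure lborel (proj2 e1 e2 ` M) = (\<integral>\<^sup>+p\<in>M. (ennreal r * ennreal \<bar>\<nu> p\<bar>) \<partial>\<mu>)" for r
    unfolding A[symmetric] mult.assoc by (rule nn_integral_cmult[symmetric]) (rule meas[OF c\<nu>])
  have "ennreal \<alpha> * emeasure lborel (proj2 e1 e2 ` M) \<le> (\<integral>\<^sup>+p\<in>M. f p \<partial>\<mu>)"
    unfolding scale
    by (intro nn_integral_mono) (use f_ge \<alpha> in \<open>auto simp: indicator_def ennreal_mult'[symmetric] intro!: ennreal_leI\<close>)
  then show "ennreal \<alpha> * emeasure lborel (proj2 e1 e2 ` M) \<le> ennreal (c * curve_length \<gamma>)"
    using If by (rule order_trans)
  have "emeasure \<mu> UNIV = emeasure \<mu> (- M) + emeasure \<mu> M"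
    using Mb m(1) by (subst plus_emeasure) (auto simp: borel_comp Compl_eq_Diff_UNIV)
  then have "surface_area M \<le> emeasure \<mu> M"
    using surface_area_le_emeasure[OF \<mu>] m(4) by simp
  also have "\<dots> = (\<integral>\<^sup>+p. indicator M p \<partial>\<mu>)" using Mb by simp
  also have "\<dots> \<le> (\<integral>\<^sup>+p. (ennreal (f p) * indicator M p + (ennreal (1 - \<alpha>) * ennreal \<bar>\<nu> p\<bar>) * indicator M p) \<partial>\<mu>)"
  proof (intro nn_integral_mono)
    fix p
    show "indicator M p \<le> ennreal (f p) * indicator M p + (ennreal (1 - \<alpha>) * ennreal \<bar>\<nu> p\<bar>) * indicator M p"
    proof (cases "p \<in> M")
      case True
      have "1 \<le> f p + (1 - \<alpha>) * \<bar>\<nu> p\<bar>"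
        using mult_left_mono[OF \<nu>2[OF True], of "1 - \<alpha>"] \<alpha> by (simp add: f_def)
      then have "ennreal 1 \<le> ennreal (f p + (1 - \<alpha>) * \<bar>\<nu> p\<bar>)" by (rule ennreal_leI)
      then show ?thesis using True f0[OF True] \<alpha> by (simp add: ennreal_mult' ennreal_plus)
    qed simp
  qed
  also have "\<dots> = (\<integral>\<^sup>+p\<in>M. f p \<partial>\<mu>) + (\<integral>\<^sup>+p\<in>M. (ennreal (1 - \<alpha>) * ennreal \<bar>\<nu> p\<bar>) \<partial>\<mu>)"
  proof (rule nn_integral_add)
    show "(\<lambda>p. ennreal (f p) * indicator M p) \<in> borel_measurable \<mu>" by (rule meas[OF cf(1)])
    show "(\<lambda>p. (ennreal (1 - \<alpha>) * ennreal \<bar>\<nu> p\<bar>) * indicator M p) \<in> borel_measurable \<mu>"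
      unfolding mult.assoc by (intro borel_measurable_times_ennreal borel_measurable_const meas[OF c\<nu>])
  qed
  also have "\<dots> \<le> ennreal (c * curve_length \<gamma>) + ennreal (1 - \<alpha>) * emeasure lborel (proj2 e1 e2 ` M)"
    unfolding scale using If by (rule add_right_mono)
  finally show "surface_area M \<le> ennreal (c * curve_length \<gamma>) + ennreal (1 - \<alpha>) * emeasure lborel (proj2 e1 e2 ` M)" .
qed

text \<open>A point off the boundary has a parameter strictly above the edge. A neighbourhood
  \<open>V\<close> of it, open in the plane, is mapped injectively and continuously to the plane, so
  invariance of domain applies. Closedness of the boundary lets \<open>V\<close> avoid its
  preimage.\<close>

lemma open_proj2_interior:
  assumes M: "smooth_surface M" and cl: "closed (surface_boundary M)" and inj: "inj_on (proj2 e1 e2) M"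
  shows "open (proj2 e1 e2 ` (M - surface_boundary M))"
  unfolding open_subopen[of "proj2 e1 e2 ` _"]
proof
  let ?\<pi> = "proj2 e1 e2" and ?B = "surface_boundary M"
  fix y assume "y \<in> ?\<pi> ` (M - ?B)"
  then obtain p where p: "p \<in> M" "p \<notin> ?B" "y = ?\<pi> p" by blast
  then obtain U X where X: "local_param M U X" "p \<in> X ` (U \<inter> half_plane)"
    using M unfolding smooth_surface_def by blast
  note X' = local_paramD[OF X(1)]
  obtain x where x: "x \<in> U" "x \<in> half_plane" "p = X x" using X(2) by blast
  have "x$2 \<noteq> 0" using p(2) X(1) x unfolding surface_boundary_def by blast
  then have x2: "x$2 > 0" using x(2) by (simp add: half_plane_def)
  define V where "V = (U \<inter> X -` (- ?B)) \<inter> {x. 0 < x$2}"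
  have V: "open V" unfolding V_def
    by (intro open_Int continuous_open_preimage[OF X'(6,1)] open_Collect_less continuous_intros)
      (simp add: cl open_Compl)
  have VU: "V \<subseteq> U \<inter> half_plane" by (auto simp: V_def half_plane_def)
  have "X ` V \<subseteq> M" using image_mono[OF VU, of X] X'(7) by (rule order_trans)
  then have XV: "X ` V \<subseteq> M - ?B" by (auto simp: V_def)
  have "open ((\<lambda>x. ?\<pi> (X x)) ` V)"
  proof (rule invariance_of_domain[OF _ V])
    show "continuous_on V (\<lambda>x. ?\<pi> (X x))"
      by (rule continuous_on_compose2[OF continuous_on_proj2 continuous_on_subset[OF X'(6)] subset_UNIV])
        (use VU in auto)
    show "inj_on (\<lambda>x. ?\<pi> (X x)) V"
    proof (rule inj_onI)
      fix s t assume st: "s \<in> V" "t \<in> V" "?\<pi> (X s) = ?\<pi> (X t)"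
      then have "X s = X t" using inj_onD[OF inj st(3)] XV by blast
      then show "s = t" using inj_onD[OF X'(5)] st VU by blast
    qed
  qed
  moreover have "y \<in> (\<lambda>x. ?\<pi> (X x)) ` V" using x x2 p by (auto simp: V_def)
  moreover have "(\<lambda>x. ?\<pi> (X x)) ` V \<subseteq> ?\<pi> ` (M - ?B)" using XV by blast
  ultimately show "\<exists>T. open T \<and> y \<in> T \<and> T \<subseteq> ?\<pi> ` (M - ?B)" by blast
qed

lemma compact_simple_closed_curve:
  assumes "smooth_simple_closed_curve \<gamma>"
  shows "compact (range \<gamma>)"
proof -
  have per: "\<And>t. \<gamma> (t + 1) = \<gamma> t" and s: "smooth_on \<gamma> UNIV"
    using assms by (auto simp: smooth_simple_closed_curve_def)
  have "range \<gamma> = \<gamma> ` {0..1}"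
  proof
    show "range \<gamma> \<subseteq> \<gamma> ` {0..1}"
      unfolding simple_closed_curve_range[of \<gamma>, OF per] by (intro image_mono) auto
  qed auto
  moreover have "compact (\<gamma> ` {0..1})"
    by (intro compact_continuous_image continuous_on_subset[OF smooth_on_continuous_on[OF s]]) auto
  ultimately show ?thesis by simp
qed

text \<open>A differentiable image of the line in the plane is negligible, so removing the boundary
  curve from the domain does not change its area.\<close>

lemma emeasure_proj2_curve:
  assumes "smooth_simple_closed_curve \<gamma>"
  shows "emeasure lborel (proj2 e1 e2 ` range \<gamma>) = 0"
proof -
  have s: "smooth_on \<gamma> UNIV" using assms by (simp add: smooth_simple_closed_curve_def)
  have "(\<lambda>t. proj2 e1 e2 (\<gamma> t)) differentiable_on UNIV"
    unfolding differentiable_on_def differentiable_def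
    using bounded_linear.has_derivative[OF bounded_linear_proj2 smooth_on_has_derivative[OF s open_UNIV UNIV_I]]
    by blast
  then have "negligible ((\<lambda>t. proj2 e1 e2 (\<gamma> t)) ` UNIV)"
    by (intro negligible_differentiable_image_lowdim) auto
  then have "proj2 e1 e2 ` range \<gamma> \<in> null_sets lebesgue"
    by (simp add: negligible_iff_null_sets image_image)
  moreover have "compact (proj2 e1 e2 ` range \<gamma>)"
    by (intro compact_continuous_image continuous_on_proj2 compact_simple_closed_curve assms)
  ultimately have "proj2 e1 e2 ` range \<gamma> \<in> null_sets lborel"
    by (subst (asm) null_sets_completion_iff) (simp_all add: borel_compact)
  then show ?thesis by (rule null_setsD1)
qed

text \<open>As \<open>u\<close> is arbitrary, the topology of \<open>D\<close> is read off from
  \<open>M\<close>: \<open>D\<close> is the image of the compact \<open>M\<close> under the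
  continuous projection along \<open>a\<close> to the plane at height \<open>c\<close>. Points of
  \<open>B\<close> already have height \<open>c\<close>, so the graph leaves them in place.\<close>

lemma graph_base:
  assumes D: "D \<subseteq> {p. p \<bullet> a = c}" and g: "graph_over a D M" and M: "compact M" and a: "norm a = 1"
    and B: "B \<subseteq> M" "B \<subseteq> {p. p \<bullet> a = c}"
    and e: "e1 \<bullet> a = 0" "e2 \<bullet> a = 0"
    and fr: "\<And>p. p = (p \<bullet> e1) *\<^sub>R e1 + (p \<bullet> e2) *\<^sub>R e2 + (p \<bullet> a) *\<^sub>R a"
  shows "compact D" "inj_on (proj2 e1 e2) M" "proj2 e1 e2 ` M = proj2 e1 e2 ` D"
    "B \<subseteq> D" "proj2 e1 e2 ` (M - B) = proj2 e1 e2 ` (D - B)"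
proof -
  let ?\<pi> = "proj2 e1 e2"
  obtain u where Mu: "M = (\<lambda>q. q + u q *\<^sub>R a) ` D" using g by (auto simp: graph_over_def)
  have aa: "a \<bullet> a = 1" using a by (simp add: dot_square_norm)
  have ae: "a \<bullet> e1 = 0" "a \<bullet> e2 = 0" using e by (simp_all add: inner_commute)
  have h: "(q + u q *\<^sub>R a) \<bullet> a = c + u q" if "q \<in> D" for q
    using that D aa by (auto simp: inner_add_left)
  have pq: "?\<pi> (q + u q *\<^sub>R a) = ?\<pi> q" for q by (simp add: proj2_def inner_add_left ae)
  have "D = (\<lambda>p. p - (p \<bullet> a - c) *\<^sub>R a) ` M"
    unfolding Mu image_image by (force simp: h)
  moreover have "compact ((\<lambda>p. p - (p \<bullet> a - c) *\<^sub>R a) ` M)"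
    by (intro compact_continuous_image continuous_intros M)
  ultimately show "compact D" by simp
  have injD: "inj_on ?\<pi> D" by (rule inj_on_subset[OF proj2_inj_on_plane[OF fr] D])
  show "inj_on ?\<pi> M"
  proof (rule inj_onI)
    fix p p' assume pp: "p \<in> M" "p' \<in> M" "?\<pi> p = ?\<pi> p'"
    obtain q q' where q: "q \<in> D" "p = q + u q *\<^sub>R a" and q': "q' \<in> D" "p' = q' + u q' *\<^sub>R a"
      using pp(1,2) unfolding Mu by blast
    have "?\<pi> q = ?\<pi> q'" using pp(3) unfolding q(2) q'(2) pq .
    then have "q = q'" by (rule inj_onD[OF injD _ q(1) q'(1)])
    then show "p = p'" using q q' by simp
  qed
  show "?\<pi> ` M = ?\<pi> ` D" unfolding Mu image_image pq ..
  \<comment> \<open>A graph point over \<open>q\<close> has height \<open>c + u q\<close>; lying in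
    \<open>B\<close> it has height \<open>c\<close>, which forces \<open>u q = 0\<close>.\<close>
  have Bq: "q + u q *\<^sub>R a = q" if "q \<in> D" "q + u q *\<^sub>R a \<in> B" for q
  proof -
    have "(q + u q *\<^sub>R a) \<bullet> a = c" using that(2) B(2) by blast
    then show ?thesis using h[OF that(1)] by simp
  qed
  show BD: "B \<subseteq> D"
  proof
    fix p assume p: "p \<in> B"
    then obtain q where "q \<in> D" "p = q + u q *\<^sub>R a" using B(1) unfolding Mu by blast
    then show "p \<in> D" using Bq[of q] p by metis
  qed
  have iff: "q + u q *\<^sub>R a \<in> B \<longleftrightarrow> q \<in> B" if q: "q \<in> D" for q
  proof
    assume "q + u q *\<^sub>R a \<in> B" then show "q \<in> B" using Bq[OF q] by metis
  next
    assume qB: "q \<in> B"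
    then obtain q' where q': "q' \<in> D" "q = q' + u q' *\<^sub>R a" using B(1) unfolding Mu by blast
    then have "q = q'" using Bq[of q'] qB by metis
    then have "q = q + u q *\<^sub>R a" using q'(2) by metis
    then show "q + u q *\<^sub>R a \<in> B" using qB by metis
  qed
  have "M - B = (\<lambda>q. q + u q *\<^sub>R a) ` (D - B)"
    unfolding Mu using iff by (auto simp: image_iff)
  then show "?\<pi> ` (M - B) = ?\<pi> ` (D - B)" by (simp add: image_image pq)
qed

text \<open>The set \<open>D - B\<close> is relatively open in \<open>P - B\<close> by the
  assumption on its image, and relatively closed because \<open>D\<close> is compact. A component of
  \<open>P - B\<close> through one of its points therefore stays in \<open>D\<close> and is
  bounded.\<close>

lemma inside_in_superset:
  assumes P: "B \<subseteq> D" "D \<subseteq> P" "compact D" and inj: "inj_on f P" and f: "continuous_on UNIV f"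
    and op: "open (f ` (D - B))"
  shows "D - B \<subseteq> inside_in P B"
proof
  fix q assume q: "q \<in> D - B"
  let ?C = "connected_component_set (P - B) q"
  have CP: "?C \<subseteq> P - B" by (rule connected_component_subset)
  have qC: "q \<in> ?C" using q P(2) by (auto simp: connected_component_refl_eq)
  have opA: "open (f -` (f ` (D - B)))" by (rule open_vimage[OF op f])
  have opD: "open (- D)" using P(3) by (simp add: compact_imp_closed open_Compl)
  have A: "s \<in> D - B" if s: "s \<in> P" "f s \<in> f ` (D - B)" for s
  proof -
    obtain s' where s': "s' \<in> D - B" "f s = f s'" using s(2) by blast
    then have "s = s'" using inj_onD[OF inj s'(2) s(1)] P(2) by blast
    then show ?thesis using s' by simp
  qed
  have "f -` (f ` (D - B)) \<inter> ?C = {} \<or> - D \<inter> ?C = {}"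
  proof (rule connectedD[OF connected_connected_component opA opD])
    show "f -` (f ` (D - B)) \<inter> - D \<inter> ?C = {}" using A CP by blast
    show "?C \<subseteq> f -` (f ` (D - B)) \<union> - D" using CP by auto
  qed
  then have "?C \<subseteq> D" using qC q by blast
  then have "bounded ?C" using P(3) bounded_subset compact_imp_bounded by blast
  then show "q \<in> inside_in P B" using q P(2) by (auto simp: inside_in_def)
qed

theorem proposition3p3:
  fixes \<alpha> c :: real and a :: "real^3" and \<gamma> :: "real \<Rightarrow> real^3"
    and P \<Gamma> \<Omega> :: "(real^3) set"
  assumes "0 < \<alpha>" and "\<alpha> < 1" and "norm a = 1" and "c > 0"
    and "P = {p. p \<bullet> a = c}"
    and "smooth_simple_closed_curve \<gamma>" and "\<Gamma> = range \<gamma>"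
    and "\<Gamma> \<subseteq> pos_halfspace a" and "\<Gamma> \<subseteq> P"
    and "\<Omega> = inside_in P \<Gamma>"
  shows "(\<forall>M. compact M \<and> singular_minimal \<alpha> a M \<and> (\<exists>D\<subseteq>P. graph_over a D M) \<and>
              surface_boundary M = \<Gamma> \<longrightarrow>
            surface_area M \<le> ennreal (c * curve_length \<gamma>) + ennreal (1 - \<alpha>) * surface_area \<Omega>) \<and>
         ((\<exists>M. compact M \<and> singular_minimal \<alpha> a M \<and> graph_over a (closure \<Omega>) M \<and>
              surface_boundary M = \<Gamma>) \<longrightarrow>
            surface_area \<Omega> \<le> ennreal (c / \<alpha> * curve_length \<gamma>))"
proof -
  obtain e1 e2 where e: "norm e1 = 1" "norm e2 = 1" "e1 \<bullet> e2 = 0" "e1 \<bullet> a = 0" "e2 \<bullet> a = 0"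
    "e1 \<times> e2 = a" and fr: "\<And>p. p = (p \<bullet> e1) *\<^sub>R e1 + (p \<bullet> e2) *\<^sub>R e2 + (p \<bullet> a) *\<^sub>R a"
    using orthonormal_cross_frame[OF assms(3)] by blast
  let ?\<pi> = "proj2 e1 e2"
  have \<gamma>c: "\<gamma> t \<bullet> a = c" for t using assms(5,7,9) by auto
  have \<Omega>P: "\<Omega> \<subseteq> P" using assms(10) by (auto simp: inside_in_def)
  have first: "surface_area M \<le> ennreal (c * curve_length \<gamma>) + ennreal (1 - \<alpha>) * surface_area \<Omega>"
    if M: "compact M" "singular_minimal \<alpha> a M" and D: "D \<subseteq> P" "graph_over a D M" and bd: "surface_boundary M = \<Gamma>"
    for M D
  proof -
    have \<Gamma>M: "\<Gamma> \<subseteq> M" using surface_boundary_subset[of M] bd by simp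
    note G = graph_base[OF D(1)[unfolded assms(5)] D(2) M(1) assms(3) \<Gamma>M assms(9)[unfolded assms(5)] e(4,5) fr]
    have comp\<Gamma>: "compact \<Gamma>" unfolding assms(7) by (rule compact_simple_closed_curve[OF assms(6)])
    have sm: "smooth_surface M" using M(2) by (simp add: singular_minimal_def)
    have "open (?\<pi> ` (M - \<Gamma>))"
      using open_proj2_interior[OF sm _ G(2)] comp\<Gamma> by (simp add: bd compact_imp_closed)
    then have op: "open (?\<pi> ` (D - \<Gamma>))" by (simp only: G(5))
    \<comment> \<open>The domain \<open>D\<close> is any subset of the plane here, so its position
      relative to the curve has to be deduced from the boundary condition.\<close>
    have sub: "D - \<Gamma> \<subseteq> \<Omega>" unfolding assms(10)
      by (rule inside_in_superset[OF G(4) D(1) G(1) _ continuous_on_proj2 op])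
        (unfold assms(5), rule proj2_inj_on_plane[OF fr])
    have cD: "compact (?\<pi> ` D)" by (intro compact_continuous_image continuous_on_proj2 G(1))
    have "bounded (?\<pi> ` (D - \<Gamma>))"
      by (rule bounded_subset[OF compact_imp_bounded[OF cD]]) auto
    then have ge: "emeasure lborel (?\<pi> ` (D - \<Gamma>)) \<le> surface_area \<Omega>"
      by (intro planar_surface_area_ge[OF e(1-5) assms(3) e(6) fr sub \<Omega>P[unfolded assms(5)] op])
    have \<Gamma>b: "?\<pi> ` \<Gamma> \<in> sets lborel"
      using compact_continuous_image[OF continuous_on_proj2 comp\<Gamma>] by (simp add: borel_compact)
    \<comment> \<open>Only \<open>D - \<Gamma>\<close> is known to lie in \<Omega>; the curve itself
      projects to a null set, so it adds nothing.\<close>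
    have "emeasure lborel (?\<pi> ` M) \<le> emeasure lborel (?\<pi> ` (D - \<Gamma>) \<union> ?\<pi> ` \<Gamma>)"
    proof (rule emeasure_mono)
      show "?\<pi> ` (D - \<Gamma>) \<union> ?\<pi> ` \<Gamma> \<in> sets lborel"
        using op \<Gamma>b by (intro sets.Un) simp_all
    qed (use G(3) in auto)
    also have "\<dots> \<le> emeasure lborel (?\<pi> ` (D - \<Gamma>)) + emeasure lborel (?\<pi> ` \<Gamma>)"
    by (rule emeasure_subadditive) (use op \<Gamma>b in simp_all)
    also have "\<dots> \<le> surface_area \<Omega>"
      using ge emeasure_proj2_curve[OF assms(6), of e1 e2] by (simp add: assms(7))
    finally have "emeasure lborel (?\<pi> ` M) \<le> surface_area \<Omega>" .
    then have "ennreal (1 - \<alpha>) * emeasure lborel (?\<pi> ` M) \<le> ennreal (1 - \<alpha>) * surface_area \<Omega>"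
      by (rule mult_left_mono) simp
    then show ?thesis
      using singular_minimal_area_estimates(1)[OF assms(1-3) M bd[unfolded assms(7)] assms(6) \<gamma>c e(6) G(2)]
      by (meson add_left_mono order_trans)
  qed
  have second: "surface_area \<Omega> \<le> ennreal (c / \<alpha> * curve_length \<gamma>)"
    if M: "compact M" "singular_minimal \<alpha> a M" and D: "graph_over a (closure \<Omega>) M" and bd: "surface_boundary M = \<Gamma>"
    for M
  proof -
    have "closed P" unfolding assms(5) by (intro closed_Collect_eq continuous_intros)
    then have cP: "closure \<Omega> \<subseteq> P" by (rule closure_minimal[OF \<Omega>P])
    have \<Gamma>M: "\<Gamma> \<subseteq> M" using surface_boundary_subset[of M] bd by simp
    note G = graph_base[OF cP[unfolded assms(5)] D M(1) assms(3) \<Gamma>M assms(9)[unfolded assms(5)] e(4,5) fr]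
    \<comment> \<open>Here the domain is the closure of \<Omega>, so the projection of
      \<open>M\<close> contains that of \<Omega> and bounds its area from above.\<close>
    have "surface_area \<Omega> \<le> emeasure lborel (?\<pi> ` M)"
      unfolding G(3)
      by (rule planar_surface_area_le[OF assms(3) e(6) fr closure_subset cP[unfolded assms(5)] G(1)])
    then have "ennreal \<alpha> * surface_area \<Omega> \<le> ennreal \<alpha> * emeasure lborel (?\<pi> ` M)"
      by (rule mult_left_mono) simp
    also have "\<dots> \<le> ennreal (c * curve_length \<gamma>)"
      by (rule singular_minimal_area_estimates(2)[OF assms(1-3) M bd[unfolded assms(7)] assms(6) \<gamma>c e(6) G(2)])
    finally have "ennreal (1 / \<alpha>) * (ennreal \<alpha> * surface_area \<Omega>) \<le> ennreal (1 / \<alpha>) * ennreal (c * curve_length \<gamma>)"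
      by (rule mult_left_mono) simp
    moreover have "ennreal (1 / \<alpha>) * (ennreal \<alpha> * surface_area \<Omega>) = surface_area \<Omega>"
      using assms(1) by (simp add: mult.assoc[symmetric] ennreal_mult'[symmetric])
    moreover have "ennreal (1 / \<alpha>) * ennreal (c * curve_length \<gamma>) = ennreal (c / \<alpha> * curve_length \<gamma>)"
      using assms(1) by (simp add: ennreal_mult'[symmetric])
    ultimately show ?thesis by simp
  qed
  show ?thesis using first second by blast
qed

end
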